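(* Suppose there is at least one true model among the candidate models: there is $J^*\in\mathcal J$ with $J^*<\infty$ and $b(t)=\sum_{j=1}^{J^*}b_j\phi_j(t)$, and there is a sequence $d_n\to0$ such that $$\widehat a_{J^*}-a=O_p(d_n)\quad\text{and}\quad\int_{\mathcal T}\{\widehat b_{J^*}(t)-b(t)\}^2\,dt=O_p(d_n^2).$$ Assume Conditions 1--3 and 5--7 stated in the context, and that $n^{-1}|\mathcal J|\to0$ as $n\to\infty$. Then the weighted average estimators $\widehat a_{\widehat{\mathbf w}}$ and $\widehat b_{\widehat{\mathbf w}}(t)$ satisfy $$(\widehat a_{\widehat{\mathbf w}}-a)^2+\int_{\mathcal T}\left\{\widehat b_{\widehat{\mathbf w}}(t)-b(t)\right\}^2dt=O_p\left(d_n^2+c_n+g_n+n^{-1/2}|\mathcal J|^{1/2}\right),$$ where $c_n$ and $g_n$ are the sequences in Conditions 1 and 3, respectively.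
   Context: **Model.** Fix $\tau\in(0,1)$ and a compact interval $\mathcal T\subset\mathbb R$. $\{(Y_i,X_i)\}_{i=1}^n$ are i.i.d., $Y_i$ a real random variable, $X_i=\{X_i(t):t\in\mathcal T\}$ a random function with mean function $\mu(t)=E\{X_i(t)\}$ and covariance function $G(s,t)=\mathrm{Cov}\{X_i(s),X_i(t)\}=\sum_{j\ge1}\kappa_j\phi_j(s)\phi_j(t)$, where $\kappa_1\ge\kappa_2\ge\cdots>0$ and $\{\phi_j\}$ is an orthonormal basis of $L_2(\mathcal T)$. Put $X_i^c=X_i-\mu$. The $\tau$th conditional quantile of $Y_i$ given $X_i$ is $Q_\tau(X_i)=a+\int_{\mathcal T}b(t)X_i^c(t)\,dt$ with $a\in\mathbb R$, $b\in L_2(\mathcal T)$, and $b_j=\int_{\mathcal T}b(t)\phi_j(t)\,dt$. Let $\varepsilon_i=Y_i-Q_\tau(X_i)$, so $P(\varepsilon_i\le0\mid X_i)=\tau$ a.s., and let $f(\cdot\mid X_i)$ be the conditional density of $\varepsilon_i$ given $X_i$. Let $\rho_\tau(e)=[\tau-\mathbf 1\{e\le0\}]e$. **Observations.** One observes $U_{il}=X_i(T_{il})+\epsilon_{il}$, $T_{il}\in\mathcal T$, $l=1,\dots,N_i$, where the $\epsilon_{il}$ are i.i.d. with mean zero and finite variance $\sigma_u^2$, independent of the $X_i$. $\mathcal D_n=\{(Y_i,T_{il},U_{il}):l=1,\dots,N_i;\ i=1,\dots,n\}$. $(Y_0,X_0)$ is an independent copy of the $(Y_i,X_i)$; only $\{(T_{0l},U_{0l})\}_{l=1}^{N_0}$,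 with $U_{0l}=X_0(T_{0l})+\epsilon_{0l}$, is observed for $X_0$. **Estimators.** $\widehat\mu$ and $\widehat G$ are the estimators of $\mu$ and $G$ obtained from the data $\{(T_{il},U_{il})\}_{i=1}^n$ by local linear smoothing (kernel and bandwidths are not fixed; the required accuracy is encoded in the Conditions), $\widehat\sigma_u^2$ is an estimate of $\sigma_u^2$, and $\widehat G(s,t)=\sum_{j\ge1}\widehat\kappa_j\widehat\phi_j(s)\widehat\phi_j(t)$ is the spectral decomposition, $\widehat\kappa_1\ge\widehat\kappa_2\ge\cdots\ge0$. For $i=0,1,\dots,n$ put $\mathbf U_i=(U_{i1},\dots,U_{iN_i})^\top$, $\widehat{\boldsymbol\phi}_{ij}=(\widehat\phi_j(T_{i1}),\dots,\widehat\phi_j(T_{iN_i}))^\top$, $\widehat{\boldsymbol\mu}_i=(\widehat\mu(T_{i1}),\dots,\widehat\mu(T_{iN_i}))^\top$, $\widehat{\boldsymbol\Sigma}_{\mathbf U_i}=\{\widehat G(T_{il},T_{il'})+\widehat\sigma_u^2\mathbf 1\{l=l'\}\}_{l,l'=1}^{N_i}$, and $\widehat\xi_{ij}=\widehat\kappa_j\widehat{\boldsymbol\phi}_{ij}^\top\widehat{\boldsymbol\Sigma}_{\mathbf U_i}^{-1}(\mathbf U_i-\widehat{\boldsymbol\mu}_i)$. The set $\mathcal J$ of candidate models is a predetermined finite set of numbers $J_n$ of principal components (it may depend on $n$); $|\mathcal J|$ is its cardinality. For $J_n\in\mathcal J$, $$(\widehat a_{J_n},\widehat b_{1,J_n},\dots,\widehat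 b_{J_n,J_n})=\arg\min_{a,b_1,\dots,b_{J_n}}\sum_{i=1}^n\rho_\tau\Big(Y_i-a-\sum_{j=1}^{J_n}b_j\widehat\xi_{ij}\Big),\qquad \widehat b_{J_n}(t)=\sum_{j=1}^{J_n}\widehat b_{j,J_n}\widehat\phi_j(t),$$ $\widehat X_{i,J_n}(t)=\widehat\mu(t)+\sum_{j=1}^{J_n}\widehat\xi_{ij}\widehat\phi_j(t)$ and $\widehat Q_{\tau,J_n}(X_i)=\widehat a_{J_n}+\int_{\mathcal T}\widehat b_{J_n}(t)\{\widehat X_{i,J_n}(t)-\widehat\mu(t)\}\,dt$, $i=0,1,\dots,n$. Also $\widehat X_i(t)=\widehat\mu(t)+\sum_{j=1}^\infty\widehat\xi_{ij}\widehat\phi_j(t)$, $i=1,\dots,n$. **Model averaging.** $\mathcal W=\{\mathbf w=(w_{J_n})_{J_n\in\mathcal J}:w_{J_n}\ge0,\ \sum_{J_n\in\mathcal J}w_{J_n}=1\}$, $\widehat Q_\tau(X_i,\mathbf w)=\sum_{J_n\in\mathcal J}w_{J_n}\widehat Q_{\tau,J_n}(X_i)$, $\widehat a_{\mathbf w}=\sum_{J_n\in\mathcal J}w_{J_n}\widehat a_{J_n}$, $\widehat b_{\mathbf w}(t)=\sum_{J_n\in\mathcal J}w_{J_n}\widehat b_{J_n}(t)$. The data are divided into $K\ge2$ groups, each of size $M=\lfloor n/K\rfloor$, the $k$th group having indices $(k-1)M+1,\dots,kM$. Let $\widehat a^{[-k]}_{J_n}$, $\widehat b^{[-k]}_{J_n}(t)$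 be the intercept and slope function estimates obtained from all observations except those of the $k$th group. For $i$ in the $k$th group, $\widehat Q^{[-k]}_{\tau,J_n}(X_i)=\widehat a^{[-k]}_{J_n}+\int_{\mathcal T}\widehat b^{[-k]}_{J_n}(t)\{\widehat X_{i,J_n}(t)-\widehat\mu(t)\}\,dt$ (with $\widehat\mu$, $\widehat X_{i,J_n}$ computed from all data), and $\widehat Q^{[-k]}_\tau(X_i,\mathbf w)=\sum_{J_n\in\mathcal J}w_{J_n}\widehat Q^{[-k]}_{\tau,J_n}(X_i)$. Define $$\mathrm{CV}_K(\mathbf w)=\frac1n\sum_{k=1}^K\sum_{m=1}^M\rho_\tau\Big(Y_{(k-1)M+m}-\widehat Q^{[-k]}_\tau(X_{(k-1)M+m},\mathbf w)\Big),\qquad \widehat{\mathbf w}=\arg\min_{\mathbf w\in\mathcal W}\mathrm{CV}_K(\mathbf w).$$ **Conditions.** All limits are as $n\to\infty$; "$O_p$ uniformly" means the supremum of the absolute value over the stated indices is $O_p$. Condition 1: there exist a constant $a^*_{J_n}$, functions $b^*_{J_n}(t)$, $X^*_{i,J_n}(t)$, $X^*_{0,J_n}(t)$, and a sequence $c_n\to0$ such that $\widehat a_{J_n}-a^*_{J_n}=O_p(c_n)$, $\widehat b_{J_n}(t)-b^*_{J_n}(t)=O_p(c_n)$, $\widehat\mu(t)-\mu(t)=O_p(c_n)$, $\widehat X_{i,J_n}(t)-X^*_{i,J_n}(t)=O_p(c_n)$ and $E\{|\widehat X_{0,J_n}(t)-X^*_{0,J_n}(t)|\mid\mathcal D_n\}=O_p(c_n)$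 uniformly for $t\in\mathcal T$, $J_n\in\mathcal J$, $i\in\{1,\dots,n\}$. When model $J_n$ is a true model (i.e. $b=\sum_{j\le J_n}b_j\phi_j$), $a^*_{J_n}$, $b^*_{J_n}(t)$, $X^*_{i,J_n}(t)$, $X^*_{0,J_n}(t)$ are the true values: $a^*_{J_n}=a$, $b^*_{J_n}=b$, and $X^*_{i,J_n}(t)=\mu(t)+\sum_{j=1}^{J_n}\xi_{ij}\phi_j(t)$ for $i=0,1,\dots,n$, where $\xi_{ij}=\int_{\mathcal T}X_i^c(t)\phi_j(t)\,dt$. Notation: for $i=0,1,\dots,n$, $Q^*_{\tau,J_n}(X_i)=a^*_{J_n}+\int_{\mathcal T}b^*_{J_n}(t)\{X^*_{i,J_n}(t)-\mu(t)\}\,dt$ (as the notation indicates, $Q^*_{\tau,J_n}(\cdot)$ is regarded as a nonrandom functional, the same for every $i$, evaluated at $X_i$). Condition 2: there is a constant $\varrho>0$ with $|Q^*_{\tau,J_n}(X_i)-Q_\tau(X_i)|\le\varrho$ a.s. uniformly for $i\in\{0,1,\dots,n\}$ and $J_n\in\mathcal J$. Condition 3: there is a sequence $g_n\to0$ such that $\widehat Q_\tau(X_{(k-1)M+m},\mathbf w)-\widehat Q^{[-k]}_\tau(X_{(k-1)M+m},\mathbf w)=O_p(g_n)$ uniformly for $\mathbf w\in\mathcal W$, $k\in\{1,\dots,K\}$, $m\in\{1,\dots,M\}$. Condition 5: there are constants $0<\underline C\le\bar C<\infty$ such that $\underline C\le f(s\mid X_i)\le\bar C$ uniformly for $|s|\le\varrho$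 and $i=1,\dots,n$, with $\varrho$ from Condition 2. Condition 6: $\widehat X_i(t)$ and $\widehat\mu(t)$ are $O_p(1)$ uniformly for $i\in\{1,\dots,n\}$ and $t\in\mathcal T$. Condition 7: there exists $\lambda_{\min}>0$ such that, uniformly for $\mathbf w\in\mathcal W$ and for almost all $i\in\{1,\dots,n\}$ (meaning that the number of indices $i\in\{1,\dots,n\}$ for which the inequality holds is of the same order as $n$), $$\left[\widehat a_{\mathbf w}-a+\int_{\mathcal T}\{\widehat b_{\mathbf w}(t)-b(t)\}\{\widehat X_i(t)-\widehat\mu(t)\}\,dt\right]^2\ge\lambda_{\min}\left[(\widehat a_{\mathbf w}-a)^2+\int_{\mathcal T}\{\widehat b_{\mathbf w}(t)-b(t)\}^2\,dt\right].$$ *)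

theory Defs
  imports "HOL-Probability.Probability" "Jordan_Normal_Form.Gauss_Jordan_Elimination"
begin

section \<open>Square-integrable functions on a domain, path space\<close>

definition L2_on :: "real set \<Rightarrow> (real \<Rightarrow> real) \<Rightarrow> bool" where
  "L2_on T f \<longleftrightarrow> set_borel_measurable lborel T f \<and> set_integrable lborel T (\<lambda>t. (f t)\<^sup>2)"

definition inner_on :: "real set \<Rightarrow> (real \<Rightarrow> real) \<Rightarrow> (real \<Rightarrow> real) \<Rightarrow> real" where
  "inner_on T f g = (LINT t:T|lborel. f t * g t)"

text \<open>Systems are indexed by \<open>j \<ge> 1\<close>; the value at index 0 is never used.\<close>

definition orthonormal_on :: "real set \<Rightarrow> (nat \<Rightarrow> real \<Rightarrow> real) \<Rightarrow> bool" where
  "orthonormal_on T e \<longleftrightarrow> (\<forall>j\<ge>1. L2_on T (e j)) \<and>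
     (\<forall>j\<ge>1. \<forall>k\<ge>1. inner_on T (e j) (e k) = (if j = k then 1 else 0))"

definition orthonormal_basis_on :: "real set \<Rightarrow> (nat \<Rightarrow> real \<Rightarrow> real) \<Rightarrow> bool" where
  "orthonormal_basis_on T e \<longleftrightarrow> orthonormal_on T e \<and>
     (\<forall>f. L2_on T f \<longrightarrow>
        (\<lambda>m. LINT t:T|lborel. (f t - (\<Sum>j=1..m. inner_on T f (e j) * e j t))\<^sup>2) \<longlonglongrightarrow> 0)"

text \<open>The state space of a random function: square-integrable paths, with the sigma-algebra that
  makes the evaluations at the points of \<open>T\<close> and the inner products with \<open>L2\<close> functions measurable.
  Paths are total functions, but only their restriction to \<open>T\<close> matters.\<close>

definition path_space :: "real set \<Rightarrow> (real \<Rightarrow> real) measure" where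
  "path_space T = sigma {x. L2_on T x}
     ({{x. L2_on T x \<and> x t \<in> B} | t B. t \<in> T \<and> B \<in> sets borel} \<union>
      {{x. L2_on T x \<and> inner_on T h x \<in> B} | h B. L2_on T h \<and> B \<in> sets borel})"


section \<open>Generated sigma-algebras, conditional quantiles, stochastic orders\<close>

definition sigma_rv :: "'a measure \<Rightarrow> ('a \<Rightarrow> real) set \<Rightarrow> 'a measure" where
  "sigma_rv M \<F> = sigma (space M) {f -` B \<inter> space M | f B. f \<in> \<F> \<and> B \<in> sets borel}"

definition cond_probability :: "'a measure \<Rightarrow> 'a measure \<Rightarrow> ('a \<Rightarrow> bool) \<Rightarrow> 'a \<Rightarrow> real" where
  "cond_probability M F P = real_cond_exp M F (indicator {\<omega> \<in> space M. P \<omega>})"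

text \<open>\<open>Q\<close> is a conditional \<open>\<tau>\<close>-quantile of \<open>Y\<close> given \<open>F\<close>.  When \<open>Y - Q\<close> has a conditional density this
  says that the conditional probability of \<open>Y \<le> Q\<close> equals \<open>\<tau>\<close>.\<close>

definition cond_quantile ::
    "'a measure \<Rightarrow> 'a measure \<Rightarrow> real \<Rightarrow> ('a \<Rightarrow> real) \<Rightarrow> ('a \<Rightarrow> real) \<Rightarrow> bool" where
  "cond_quantile M F \<tau> Y Q \<longleftrightarrow> Q \<in> borel_measurable F \<and>
     (AE \<omega> in M. cond_probability M F (\<lambda>\<omega>. Y \<omega> < Q \<omega>) \<omega> \<le> \<tau> \<and>
                  \<tau> \<le> cond_probability M F (\<lambda>\<omega>. Y \<omega> \<le> Q \<omega>) \<omega>)"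

text \<open>\<open>Z\<close> is \<open>O\<^sub>p(r)\<close> uniformly over the indices in \<open>I n\<close>, i.e. the supremum over \<open>I n\<close> of
  \<open>\<bar>Z n i\<bar>\<close> is \<open>O\<^sub>p(r)\<close>.  The exceptional event is covered by a measurable set of small probability
  because a supremum over uncountably many indices need not be measurable.\<close>

definition Op_unif :: "'a measure \<Rightarrow> (nat \<Rightarrow> 'i set) \<Rightarrow> (nat \<Rightarrow> 'i \<Rightarrow> 'a \<Rightarrow> real) \<Rightarrow> (nat \<Rightarrow> real) \<Rightarrow> bool"
  where
  "Op_unif M I Z r \<longleftrightarrow> (\<forall>e>0. \<exists>C>0. \<forall>\<^sub>F n in sequentially. \<exists>A\<in>sets M.
      measure M A \<le> e \<and> (\<forall>\<omega>\<in>space M - A. \<forall>i\<in>I n. \<bar>Z n i \<omega>\<bar> \<le> C * r n))"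

definition Op :: "'a measure \<Rightarrow> (nat \<Rightarrow> 'a \<Rightarrow> real) \<Rightarrow> (nat \<Rightarrow> real) \<Rightarrow> bool" where
  "Op M Z r \<longleftrightarrow> Op_unif M (\<lambda>_. {()}) (\<lambda>n _. Z n) r"

definition check_loss :: "real \<Rightarrow> real \<Rightarrow> real" where
  "check_loss \<tau> e = (\<tau> - (if e \<le> 0 then 1 else 0)) * e"


section \<open>Local linear smoothing\<close>

definition smoothing_kernel :: "('b::euclidean_space \<Rightarrow> real) \<Rightarrow> bool" where
  "smoothing_kernel k \<longleftrightarrow> (\<forall>x. 0 \<le> k x) \<and> integrable lborel k \<and> (LINT x|lborel. k x) = 1"

text \<open>\<open>m\<close> is a local linear smoother at \<open>t\<close> of the scatter plot \<open>(x p, z p)\<close>, \<open>p \<in> P\<close>: the intercept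
  of a kernel-weighted least squares fit of an affine function around \<open>t\<close>.\<close>

definition local_linear ::
    "('b::euclidean_space \<Rightarrow> real) \<Rightarrow> real \<Rightarrow> 'p set \<Rightarrow> ('p \<Rightarrow> 'b) \<Rightarrow> ('p \<Rightarrow> real) \<Rightarrow> 'b \<Rightarrow> real \<Rightarrow> bool"
  where
  "local_linear k h P x z t m \<longleftrightarrow> (\<exists>\<beta>. is_arg_min
      (\<lambda>(c, v). \<Sum>p\<in>P. k ((x p - t) /\<^sub>R h) * (z p - c - inner v (x p - t))\<^sup>2) (\<lambda>_. True) (m, \<beta>))"


section \<open>Functional linear quantile regression\<close>

text \<open>Subjects are numbered \<open>i = 0, 1, 2, \<dots>\<close>; subject 0 is the one to be predicted and subjects
  \<open>1, \<dots>, n\<close> form the sample of size \<open>n\<close>.  The sampling design (\<open>nobs\<close>, \<open>tpt\<close>, \<open>err\<close>) may change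
  with \<open>n\<close>, as dense designs require.  Estimators take the sample size \<open>n\<close> and the set \<open>S\<close> of subjects
  they are computed from: \<open>S = {1..n}\<close> for the full sample, or \<open>{1..n}\<close> without one fold.\<close>

record 'a flqr =
  prb :: "'a measure"
  tdom :: "real set"
  tau :: real
  resp :: "nat \<Rightarrow> 'a \<Rightarrow> real"
  traj :: "nat \<Rightarrow> 'a \<Rightarrow> real \<Rightarrow> real"
  icpt :: real
  slope :: "real \<Rightarrow> real"
  eigval :: "nat \<Rightarrow> real"
  eigfun :: "nat \<Rightarrow> real \<Rightarrow> real"
  dens :: "real \<Rightarrow> (real \<Rightarrow> real) \<Rightarrow> real"
  nobs :: "nat \<Rightarrow> nat \<Rightarrow> nat"
  tpt :: "nat \<Rightarrow> nat \<Rightarrow> nat \<Rightarrow> 'a \<Rightarrow> real"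
  err :: "nat \<Rightarrow> nat \<Rightarrow> nat \<Rightarrow> 'a \<Rightarrow> real"
  noise_var :: real
  cand :: "nat \<Rightarrow> nat set"
  nfold :: nat
  kern_mean :: "real \<Rightarrow> real"
  kern_cov :: "real \<times> real \<Rightarrow> real"
  bw_mean :: "nat \<Rightarrow> nat set \<Rightarrow> 'a \<Rightarrow> real"
  bw_cov :: "nat \<Rightarrow> nat set \<Rightarrow> 'a \<Rightarrow> real"
  muhat :: "nat \<Rightarrow> nat set \<Rightarrow> 'a \<Rightarrow> real \<Rightarrow> real"
  Gsmooth :: "nat \<Rightarrow> nat set \<Rightarrow> 'a \<Rightarrow> real \<times> real \<Rightarrow> real"
  Ghat :: "nat \<Rightarrow> nat set \<Rightarrow> 'a \<Rightarrow> real \<times> real \<Rightarrow> real"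
  nvarhat :: "nat \<Rightarrow> nat set \<Rightarrow> 'a \<Rightarrow> real"
  eigvalhat :: "nat \<Rightarrow> nat set \<Rightarrow> nat \<Rightarrow> 'a \<Rightarrow> real"
  eigfunhat :: "nat \<Rightarrow> nat set \<Rightarrow> nat \<Rightarrow> 'a \<Rightarrow> real \<Rightarrow> real"
  icpthat :: "nat \<Rightarrow> nat set \<Rightarrow> nat \<Rightarrow> 'a \<Rightarrow> real"
  coefhat :: "nat \<Rightarrow> nat set \<Rightarrow> nat \<Rightarrow> 'a \<Rightarrow> nat \<Rightarrow> real"

subsection \<open>Population quantities\<close>

definition mean_fun :: "'a flqr \<Rightarrow> real \<Rightarrow> real" where
  "mean_fun D t = (LINT \<omega>|prb D. traj D 0 \<omega> t)"

definition cov_fun :: "'a flqr \<Rightarrow> real \<Rightarrow> real \<Rightarrow> real" where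
  "cov_fun D s t =
     (LINT \<omega>|prb D. (traj D 0 \<omega> s - mean_fun D s) * (traj D 0 \<omega> t - mean_fun D t))"

definition score :: "'a flqr \<Rightarrow> nat \<Rightarrow> nat \<Rightarrow> 'a \<Rightarrow> real" where
  "score D i j \<omega> = inner_on (tdom D) (\<lambda>t. traj D i \<omega> t - mean_fun D t) (eigfun D j)"

definition Qtrue :: "'a flqr \<Rightarrow> nat \<Rightarrow> 'a \<Rightarrow> real" where
  "Qtrue D i \<omega> = icpt D + (LINT t:tdom D|lborel. slope D t * (traj D i \<omega> t - mean_fun D t))"

definition resid :: "'a flqr \<Rightarrow> nat \<Rightarrow> 'a \<Rightarrow> real" where
  "resid D i \<omega> = resp D i \<omega> - Qtrue D i \<omega>"

definition sigma_traj :: "'a flqr \<Rightarrow> nat \<Rightarrow> 'a measure" where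
  "sigma_traj D i = vimage_algebra (space (prb D)) (traj D i) (path_space (tdom D))"

definition uobs :: "'a flqr \<Rightarrow> nat \<Rightarrow> nat \<Rightarrow> nat \<Rightarrow> 'a \<Rightarrow> real" where
  "uobs D n i l \<omega> = traj D i \<omega> (tpt D n i l \<omega>) + err D n i l \<omega>"

definition true_model :: "'a flqr \<Rightarrow> nat \<Rightarrow> bool" where
  "true_model D J \<longleftrightarrow> (AE t in lborel. t \<in> tdom D \<longrightarrow>
     slope D t = (\<Sum>j=1..J. inner_on (tdom D) (slope D) (eigfun D j) * eigfun D j t))"

text \<open>Joint measurability in \<open>(\<omega>, t)\<close> (\<open>traj_measurable\<close>) makes \<open>traj D i \<omega> (tpt D n i l \<omega>)\<close> a random
  variable.  The conditional density \<open>dens\<close> does not depend on \<open>i\<close> because the pairs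
  \<open>(resp D i, traj D i)\<close> are identically distributed.\<close>

locale flqr_model = prob_space "prb D" for D :: "'a flqr" +
  assumes tau: "0 < tau D" "tau D < 1"
    and tdom: "\<exists>lo hi. lo < hi \<and> tdom D = {lo..hi}"
    and sample_rv:
      "\<And>i. (\<lambda>\<omega>. (resp D i \<omega>, traj D i \<omega>)) \<in> prb D \<rightarrow>\<^sub>M borel \<Otimes>\<^sub>M path_space (tdom D)"
    and sample_indep: "indep_vars (\<lambda>_. borel \<Otimes>\<^sub>M path_space (tdom D))
      (\<lambda>i \<omega>. (resp D i \<omega>, traj D i \<omega>)) UNIV"
    and sample_ident: "\<And>i.
      distr (prb D) (borel \<Otimes>\<^sub>M path_space (tdom D)) (\<lambda>\<omega>. (resp D i \<omega>, traj D i \<omega>)) =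
      distr (prb D) (borel \<Otimes>\<^sub>M path_space (tdom D)) (\<lambda>\<omega>. (resp D 0 \<omega>, traj D 0 \<omega>))"
    and second_moment: "\<And>t. t \<in> tdom D \<Longrightarrow> integrable (prb D) (\<lambda>\<omega>. (traj D 0 \<omega> t)\<^sup>2)"
    and traj_measurable: "\<And>i. (\<lambda>(\<omega>, t). traj D i \<omega> t) \<in>
      borel_measurable (prb D \<Otimes>\<^sub>M restrict_space borel (tdom D))"
    and eigval_pos: "\<And>j. 1 \<le> j \<Longrightarrow> 0 < eigval D j"
    and eigval_mono: "\<And>j. 1 \<le> j \<Longrightarrow> eigval D (Suc j) \<le> eigval D j"
    and eigfun_basis: "orthonormal_basis_on (tdom D) (eigfun D)"
    and cov_spectral: "\<And>s t. s \<in> tdom D \<Longrightarrow> t \<in> tdom D \<Longrightarrow>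
      (\<lambda>j. eigval D (Suc j) * eigfun D (Suc j) s * eigfun D (Suc j) t) sums cov_fun D s t"
    and slope_L2: "L2_on (tdom D) (slope D)"
    and quantile: "\<And>i. cond_quantile (prb D) (sigma_traj D i) (tau D) (resp D i) (Qtrue D i)"
    and dens_measurable:
      "(\<lambda>(s, x). dens D s x) \<in> borel_measurable (borel \<Otimes>\<^sub>M path_space (tdom D))"
    and dens_nonneg: "\<And>s x. 0 \<le> dens D s x"
    and dens: "\<And>i B. B \<in> sets borel \<Longrightarrow> AE \<omega> in prb D.
      cond_probability (prb D) (sigma_traj D i) (\<lambda>\<omega>. resid D i \<omega> \<in> B) \<omega> =
      (LINT s:B|lborel. dens D s (traj D i \<omega>))"
    and tpt_rv: "\<And>n i l. tpt D n i l \<in> borel_measurable (prb D)"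
    and tpt_in: "\<And>n i l \<omega>. \<omega> \<in> space (prb D) \<Longrightarrow> tpt D n i l \<omega> \<in> tdom D"
    and err_indep: "\<And>n. indep_vars (\<lambda>_. borel) (\<lambda>(i, l). err D n i l) (SIGMA i:{0..n}. {1..nobs D n i})"
    and err_ident: "\<And>n i l i' l'.
      i \<le> n \<Longrightarrow> l \<in> {1..nobs D n i} \<Longrightarrow> i' \<le> n \<Longrightarrow> l' \<in> {1..nobs D n i'} \<Longrightarrow>
      distr (prb D) borel (err D n i l) = distr (prb D) borel (err D n i' l')"
    and err_moments: "\<And>n i l. i \<le> n \<Longrightarrow> l \<in> {1..nobs D n i} \<Longrightarrow>
      integrable (prb D) (\<lambda>\<omega>. (err D n i l \<omega>)\<^sup>2) \<and> expectation (err D n i l) = 0 \<and>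
      variance (err D n i l) = noise_var D"
    and err_indep_traj: "\<And>n. indep_set
      (sets (sigma_rv (prb D) {err D n i l | i l. i \<le> n \<and> l \<in> {1..nobs D n i}}))
      (sets (sigma (space (prb D)) (\<Union>i. sets (sigma_traj D i))))"
    and cand_finite: "\<And>n. finite (cand D n)"


subsection \<open>Estimators\<close>

definition sigma_design :: "'a flqr \<Rightarrow> nat \<Rightarrow> nat set \<Rightarrow> 'a measure" where
  "sigma_design D n S = sigma_rv (prb D)
     ({tpt D n i l | i l. i \<in> S \<and> l \<in> {1..nobs D n i}} \<union>
      {uobs D n i l | i l. i \<in> S \<and> l \<in> {1..nobs D n i}})"

definition sigma_data :: "'a flqr \<Rightarrow> nat \<Rightarrow> nat set \<Rightarrow> 'a measure" where
  "sigma_data D n S = sigma_rv (prb D)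
     ({resp D i | i. i \<in> S} \<union>
      {tpt D n i l | i l. i \<in> S \<and> l \<in> {1..nobs D n i}} \<union>
      {uobs D n i l | i l. i \<in> S \<and> l \<in> {1..nobs D n i}})"

definition fold_size :: "'a flqr \<Rightarrow> nat \<Rightarrow> nat" where
  "fold_size D n = n div nfold D"

definition train_set :: "'a flqr \<Rightarrow> nat \<Rightarrow> nat \<Rightarrow> nat set" where
  "train_set D n k = {1..n} - {(k - 1) * fold_size D n + 1..k * fold_size D n}"

definition fit_sets :: "'a flqr \<Rightarrow> nat \<Rightarrow> nat set set" where
  "fit_sets D n = insert {1..n} (train_set D n ` {1..nfold D})"

definition obs_pts :: "'a flqr \<Rightarrow> nat \<Rightarrow> nat set \<Rightarrow> (nat \<times> nat) set" where
  "obs_pts D n S = (SIGMA i:S. {1..nobs D n i})"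

definition obs_pairs :: "'a flqr \<Rightarrow> nat \<Rightarrow> nat set \<Rightarrow> (nat \<times> nat \<times> nat) set" where
  "obs_pairs D n S = {(i, l, l'). i \<in> S \<and> l \<in> {1..nobs D n i} \<and> l' \<in> {1..nobs D n i} \<and> l \<noteq> l'}"

text \<open>\<open>muhat\<close> smooths the pooled observations and \<open>Gsmooth\<close> the off-diagonal raw covariances.  A smoothed
  covariance surface need not be nonnegative definite, whereas the spectral decomposition of \<open>Ghat\<close>
  has nonnegative eigenvalues only.  Hence \<open>Ghat\<close> is the nonnegative definite part of \<open>Gsmooth\<close>: its
  positive eigenpairs are eigenpairs of \<open>Gsmooth\<close>, and \<open>Gsmooth - Ghat\<close> is nonpositive definite.
  If \<open>Gsmooth\<close> is nonnegative definite, this makes \<open>Ghat\<close> and \<open>Gsmooth\<close> the same integral kernel.\<close>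

definition fpca_fit :: "'a flqr \<Rightarrow> nat \<Rightarrow> nat set \<Rightarrow> 'a \<Rightarrow> bool" where
  "fpca_fit D n S \<omega> \<longleftrightarrow>
     0 < bw_mean D n S \<omega> \<and> 0 < bw_cov D n S \<omega> \<and>
     (\<forall>t\<in>tdom D. local_linear (kern_mean D) (bw_mean D n S \<omega>) (obs_pts D n S)
        (\<lambda>(i, l). tpt D n i l \<omega>) (\<lambda>(i, l). uobs D n i l \<omega>) t (muhat D n S \<omega> t)) \<and>
     (\<forall>s\<in>tdom D. \<forall>t\<in>tdom D. local_linear (kern_cov D) (bw_cov D n S \<omega>) (obs_pairs D n S)
        (\<lambda>(i, l, l'). (tpt D n i l \<omega>, tpt D n i l' \<omega>))
        (\<lambda>(i, l, l'). (uobs D n i l \<omega> - muhat D n S \<omega> (tpt D n i l \<omega>)) *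
                       (uobs D n i l' \<omega> - muhat D n S \<omega> (tpt D n i l' \<omega>)))
        (s, t) (Gsmooth D n S \<omega> (s, t))) \<and>
     set_borel_measurable lborel (tdom D \<times> tdom D) (Gsmooth D n S \<omega>) \<and>
     set_integrable lborel (tdom D \<times> tdom D) (\<lambda>p. (Gsmooth D n S \<omega> p)\<^sup>2) \<and>
     orthonormal_on (tdom D) (\<lambda>j. eigfunhat D n S j \<omega>) \<and>
     (\<forall>j\<ge>1. 0 \<le> eigvalhat D n S j \<omega> \<and> eigvalhat D n S (Suc j) \<omega> \<le> eigvalhat D n S j \<omega>) \<and>
     (\<forall>s\<in>tdom D. \<forall>t\<in>tdom D.
        (\<lambda>j. eigvalhat D n S (Suc j) \<omega> * eigfunhat D n S (Suc j) \<omega> s * eigfunhat D n S (Suc j) \<omega> t)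
        sums Ghat D n S \<omega> (s, t)) \<and>
     (\<forall>j\<ge>1. 0 < eigvalhat D n S j \<omega> \<longrightarrow>
        (AE s in lborel. s \<in> tdom D \<longrightarrow>
          (LINT t:tdom D|lborel. Gsmooth D n S \<omega> (s, t) * eigfunhat D n S j \<omega> t) =
          eigvalhat D n S j \<omega> * eigfunhat D n S j \<omega> s)) \<and>
     (\<forall>f. L2_on (tdom D) f \<longrightarrow>
        (LINT p:tdom D \<times> tdom D|lborel.
          f (fst p) * (Gsmooth D n S \<omega> p - Ghat D n S \<omega> p) * f (snd p)) \<le> 0)"

text \<open>Vectors and matrices are indexed from 0, observation times from 1.\<close>

definition Sigmahat :: "'a flqr \<Rightarrow> nat \<Rightarrow> nat set \<Rightarrow> nat \<Rightarrow> 'a \<Rightarrow> real mat" where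
  "Sigmahat D n S i \<omega> = mat (nobs D n i) (nobs D n i) (\<lambda>(l, l').
     Ghat D n S \<omega> (tpt D n i (Suc l) \<omega>, tpt D n i (Suc l') \<omega>) +
     (if l = l' then nvarhat D n S \<omega> else 0))"

definition scorehat :: "'a flqr \<Rightarrow> nat \<Rightarrow> nat set \<Rightarrow> nat \<Rightarrow> nat \<Rightarrow> 'a \<Rightarrow> real" where
  "scorehat D n S i j \<omega> = eigvalhat D n S j \<omega> *
     scalar_prod (vec (nobs D n i) (\<lambda>l. eigfunhat D n S j \<omega> (tpt D n i (Suc l) \<omega>)))
       (mult_mat_vec (the (mat_inverse (Sigmahat D n S i \<omega>)))
         (vec (nobs D n i) (\<lambda>l. uobs D n i (Suc l) \<omega> - muhat D n S \<omega> (tpt D n i (Suc l) \<omega>))))"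

definition quantile_fit :: "'a flqr \<Rightarrow> nat \<Rightarrow> nat set \<Rightarrow> nat \<Rightarrow> 'a \<Rightarrow> bool" where
  "quantile_fit D n S J \<omega> \<longleftrightarrow> is_arg_min
     (\<lambda>(c, \<beta>). \<Sum>i\<in>S. check_loss (tau D)
        (resp D i \<omega> - c - (\<Sum>j=1..J. \<beta> j * scorehat D n S i j \<omega>)))
     (\<lambda>_. True) (icpthat D n S J \<omega>, coefhat D n S J \<omega>)"

text \<open>Besides their defining properties, the estimators are assumed to be functions of the data they
  are computed from, and the matrices that get inverted are assumed to be invertible.\<close>

locale flqr_estimators =
  fixes D :: "'a flqr"
  assumes kernels: "smoothing_kernel (kern_mean D)" "smoothing_kernel (kern_cov D)"
    and fpca: "\<And>n S. S \<in> fit_sets D n \<Longrightarrow> AE \<omega> in prb D. fpca_fit D n S \<omega>"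
    and Sigmahat_invertible: "\<And>n S i. S \<in> fit_sets D n \<Longrightarrow> i \<in> S \<Longrightarrow>
      AE \<omega> in prb D. invertible_mat (Sigmahat D n S i \<omega>)"
    and Sigmahat0_invertible: "\<And>n. AE \<omega> in prb D. invertible_mat (Sigmahat D n {1..n} 0 \<omega>)"
    and quantile_fit: "\<And>n S J. S \<in> fit_sets D n \<Longrightarrow> J \<in> cand D n \<Longrightarrow>
      AE \<omega> in prb D. quantile_fit D n S J \<omega>"
    and muhat_measurable: "\<And>n S. S \<in> fit_sets D n \<Longrightarrow> (\<lambda>(\<omega>, t). muhat D n S \<omega> t) \<in>
      borel_measurable (sigma_design D n S \<Otimes>\<^sub>M restrict_space borel (tdom D))"
    and eigfunhat_measurable: "\<And>n S j. S \<in> fit_sets D n \<Longrightarrow> 1 \<le> j \<Longrightarrow>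
      (\<lambda>(\<omega>, t). eigfunhat D n S j \<omega> t) \<in>
      borel_measurable (sigma_design D n S \<Otimes>\<^sub>M restrict_space borel (tdom D))"
    and eigvalhat_measurable: "\<And>n S j. S \<in> fit_sets D n \<Longrightarrow> 1 \<le> j \<Longrightarrow>
      eigvalhat D n S j \<in> borel_measurable (sigma_design D n S)"
    and nvarhat_measurable: "\<And>n S. S \<in> fit_sets D n \<Longrightarrow>
      nvarhat D n S \<in> borel_measurable (sigma_design D n S)"
    and icpthat_measurable: "\<And>n S J. S \<in> fit_sets D n \<Longrightarrow> J \<in> cand D n \<Longrightarrow>
      icpthat D n S J \<in> borel_measurable (sigma_data D n S)"
    and coefhat_measurable: "\<And>n S J j. S \<in> fit_sets D n \<Longrightarrow> J \<in> cand D n \<Longrightarrow> j \<in> {1..J} \<Longrightarrow>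
      (\<lambda>\<omega>. coefhat D n S J \<omega> j) \<in> borel_measurable (sigma_data D n S)"

definition slopehat :: "'a flqr \<Rightarrow> nat \<Rightarrow> nat set \<Rightarrow> nat \<Rightarrow> 'a \<Rightarrow> real \<Rightarrow> real" where
  "slopehat D n S J \<omega> t = (\<Sum>j=1..J. coefhat D n S J \<omega> j * eigfunhat D n S j \<omega> t)"

definition trajhat_trunc :: "'a flqr \<Rightarrow> nat \<Rightarrow> nat \<Rightarrow> nat \<Rightarrow> 'a \<Rightarrow> real \<Rightarrow> real" where
  "trajhat_trunc D n i J \<omega> t = muhat D n {1..n} \<omega> t +
     (\<Sum>j=1..J. scorehat D n {1..n} i j \<omega> * eigfunhat D n {1..n} j \<omega> t)"

definition trajhat :: "'a flqr \<Rightarrow> nat \<Rightarrow> nat \<Rightarrow> 'a \<Rightarrow> real \<Rightarrow> real" where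
  "trajhat D n i \<omega> t = muhat D n {1..n} \<omega> t +
     (\<Sum>j. scorehat D n {1..n} i (Suc j) \<omega> * eigfunhat D n {1..n} (Suc j) \<omega> t)"

text \<open>Intercept and slope come from the fit on \<open>S\<close>; the trajectory that is plugged in always comes
  from the full sample.\<close>

definition Qhat :: "'a flqr \<Rightarrow> nat \<Rightarrow> nat set \<Rightarrow> nat \<Rightarrow> nat \<Rightarrow> 'a \<Rightarrow> real" where
  "Qhat D n S J i \<omega> = icpthat D n S J \<omega> +
     (LINT t:tdom D|lborel. slopehat D n S J \<omega> t * (trajhat_trunc D n i J \<omega> t - muhat D n {1..n} \<omega> t))"


subsection \<open>Model averaging\<close>

definition weights :: "'a flqr \<Rightarrow> nat \<Rightarrow> (nat \<Rightarrow> real) set" where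
  "weights D n = {w. (\<forall>J\<in>cand D n. 0 \<le> w J) \<and> (\<Sum>J\<in>cand D n. w J) = 1}"

definition Qavg :: "'a flqr \<Rightarrow> nat \<Rightarrow> nat set \<Rightarrow> (nat \<Rightarrow> real) \<Rightarrow> nat \<Rightarrow> 'a \<Rightarrow> real" where
  "Qavg D n S w i \<omega> = (\<Sum>J\<in>cand D n. w J * Qhat D n S J i \<omega>)"

definition icptavg :: "'a flqr \<Rightarrow> nat \<Rightarrow> (nat \<Rightarrow> real) \<Rightarrow> 'a \<Rightarrow> real" where
  "icptavg D n w \<omega> = (\<Sum>J\<in>cand D n. w J * icpthat D n {1..n} J \<omega>)"

definition slopeavg :: "'a flqr \<Rightarrow> nat \<Rightarrow> (nat \<Rightarrow> real) \<Rightarrow> 'a \<Rightarrow> real \<Rightarrow> real" where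
  "slopeavg D n w \<omega> t = (\<Sum>J\<in>cand D n. w J * slopehat D n {1..n} J \<omega> t)"

definition cv_criterion :: "'a flqr \<Rightarrow> nat \<Rightarrow> 'a \<Rightarrow> (nat \<Rightarrow> real) \<Rightarrow> real" where
  "cv_criterion D n \<omega> w = 1 / real n * (\<Sum>k=1..nfold D. \<Sum>m=1..fold_size D n.
     check_loss (tau D) (resp D ((k - 1) * fold_size D n + m) \<omega> -
       Qavg D n (train_set D n k) w ((k - 1) * fold_size D n + m) \<omega>))"


subsection \<open>Regularity conditions\<close>

definition Qlim :: "'a flqr \<Rightarrow> (nat \<Rightarrow> real) \<Rightarrow> (nat \<Rightarrow> real \<Rightarrow> real) \<Rightarrow>
    (nat \<Rightarrow> nat \<Rightarrow> 'a \<Rightarrow> real \<Rightarrow> real) \<Rightarrow> nat \<Rightarrow> nat \<Rightarrow> 'a \<Rightarrow> real" where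
  "Qlim D as bs Xs J i \<omega> = as J + (LINT t:tdom D|lborel. bs J t * (Xs i J \<omega> t - mean_fun D t))"

text \<open>The limits depend on the sample size only through the number of components.  The conditional
  expectation is defined for each \<open>t\<close> and \<open>J\<close> up to a null set, so a version \<open>Z\<close> has to be chosen
  before the supremum over \<open>t\<close> is taken.\<close>

definition limit_condition :: "'a flqr \<Rightarrow> (nat \<Rightarrow> real) \<Rightarrow> (nat \<Rightarrow> real \<Rightarrow> real) \<Rightarrow>
    (nat \<Rightarrow> nat \<Rightarrow> 'a \<Rightarrow> real \<Rightarrow> real) \<Rightarrow> (nat \<Rightarrow> real) \<Rightarrow> bool" where
  "limit_condition D as bs Xs c \<longleftrightarrow>
     c \<longlonglongrightarrow> 0 \<and>
     (\<forall>n. \<forall>J\<in>cand D n. L2_on (tdom D) (bs J)) \<and>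
     (\<forall>n. \<forall>J\<in>cand D n. \<forall>i. (\<lambda>(\<omega>, t). Xs i J \<omega> t) \<in>
        borel_measurable (prb D \<Otimes>\<^sub>M restrict_space borel (tdom D))) \<and>
     Op_unif (prb D) (cand D) (\<lambda>n J \<omega>. icpthat D n {1..n} J \<omega> - as J) c \<and>
     Op_unif (prb D) (\<lambda>n. tdom D \<times> cand D n)
       (\<lambda>n (t, J) \<omega>. slopehat D n {1..n} J \<omega> t - bs J t) c \<and>
     Op_unif (prb D) (\<lambda>n. tdom D) (\<lambda>n t \<omega>. muhat D n {1..n} \<omega> t - mean_fun D t) c \<and>
     Op_unif (prb D) (\<lambda>n. tdom D \<times> cand D n \<times> {1..n})
       (\<lambda>n (t, J, i) \<omega>. trajhat_trunc D n i J \<omega> t - Xs i J \<omega> t) c \<and>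
     (\<exists>Z. (\<forall>n. \<forall>t\<in>tdom D. \<forall>J\<in>cand D n. AE \<omega> in prb D. 0 \<le> Z n (t, J) \<omega> \<and>
             nn_cond_exp (prb D) (sigma_data D n {1..n})
               (\<lambda>\<omega>. ennreal \<bar>trajhat_trunc D n 0 J \<omega> t - Xs 0 J \<omega> t\<bar>) \<omega> = ennreal (Z n (t, J) \<omega>)) \<and>
          Op_unif (prb D) (\<lambda>n. tdom D \<times> cand D n) Z c) \<and>
     (\<forall>n. \<forall>J\<in>cand D n. true_model D J \<longrightarrow>
        as J = icpt D \<and>
        (AE t in lborel. t \<in> tdom D \<longrightarrow> bs J t = slope D t) \<and>
        (\<forall>i. AE \<omega> in prb D. \<forall>t\<in>tdom D.
           Xs i J \<omega> t = mean_fun D t + (\<Sum>j=1..J. score D i j \<omega> * eigfun D j t)))"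

text \<open>\<open>Qlim\<close> is a nonrandom functional, common to all subjects, of the trajectory.\<close>

definition functional_condition :: "'a flqr \<Rightarrow> (nat \<Rightarrow> real) \<Rightarrow> (nat \<Rightarrow> real \<Rightarrow> real) \<Rightarrow>
    (nat \<Rightarrow> nat \<Rightarrow> 'a \<Rightarrow> real \<Rightarrow> real) \<Rightarrow> (nat \<Rightarrow> (real \<Rightarrow> real) \<Rightarrow> real) \<Rightarrow> bool" where
  "functional_condition D as bs Xs q \<longleftrightarrow> (\<forall>n. \<forall>J\<in>cand D n.
     q J \<in> borel_measurable (path_space (tdom D)) \<and>
     (\<forall>i. AE \<omega> in prb D. Qlim D as bs Xs J i \<omega> = q J (traj D i \<omega>)))"

definition bias_condition :: "'a flqr \<Rightarrow> (nat \<Rightarrow> real) \<Rightarrow> (nat \<Rightarrow> real \<Rightarrow> real) \<Rightarrow>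
    (nat \<Rightarrow> nat \<Rightarrow> 'a \<Rightarrow> real \<Rightarrow> real) \<Rightarrow> real \<Rightarrow> bool" where
  "bias_condition D as bs Xs \<rho> \<longleftrightarrow> 0 < \<rho> \<and>
     (\<forall>n. AE \<omega> in prb D. \<forall>i\<in>{0..n}. \<forall>J\<in>cand D n. \<bar>Qlim D as bs Xs J i \<omega> - Qtrue D i \<omega>\<bar> \<le> \<rho>)"

definition cv_condition :: "'a flqr \<Rightarrow> (nat \<Rightarrow> real) \<Rightarrow> bool" where
  "cv_condition D g \<longleftrightarrow> g \<longlonglongrightarrow> 0 \<and>
     Op_unif (prb D) (\<lambda>n. weights D n \<times> {1..nfold D} \<times> {1..fold_size D n})
       (\<lambda>n (w, k, m) \<omega>. Qavg D n {1..n} w ((k - 1) * fold_size D n + m) \<omega> -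
                         Qavg D n (train_set D n k) w ((k - 1) * fold_size D n + m) \<omega>) g"

definition density_condition :: "'a flqr \<Rightarrow> real \<Rightarrow> bool" where
  "density_condition D \<rho> \<longleftrightarrow> (\<exists>Cl Cu. 0 < Cl \<and> Cl \<le> Cu \<and>
     (\<forall>i\<ge>1. AE \<omega> in prb D. \<forall>s. \<bar>s\<bar> \<le> \<rho> \<longrightarrow>
        Cl \<le> dens D s (traj D i \<omega>) \<and> dens D s (traj D i \<omega>) \<le> Cu))"

definition bounded_condition :: "'a flqr \<Rightarrow> bool" where
  "bounded_condition D \<longleftrightarrow>
     Op_unif (prb D) (\<lambda>n. {1..n} \<times> tdom D) (\<lambda>n (i, t) \<omega>. trajhat D n i \<omega> t) (\<lambda>_. 1) \<and>
     Op_unif (prb D) (\<lambda>_. tdom D) (\<lambda>n t \<omega>. muhat D n {1..n} \<omega> t) (\<lambda>_. 1)"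

text \<open>The inequality involves estimators; it is required outside an event whose probability tends to 0.
  There, for every weight vector, it holds for at least a fixed fraction of the indices.\<close>

definition eigen_condition :: "'a flqr \<Rightarrow> bool" where
  "eigen_condition D \<longleftrightarrow> (\<exists>lmin>0. \<exists>\<delta>>0. \<exists>A.
     (\<forall>n. A n \<in> sets (prb D)) \<and> (\<lambda>n. measure (prb D) (A n)) \<longlonglongrightarrow> 0 \<and>
     (\<forall>\<^sub>F n in sequentially. \<forall>\<omega>\<in>space (prb D) - A n. \<forall>w\<in>weights D n.
        \<delta> * real n \<le> real (card {i \<in> {1..n}.
          (icptavg D n w \<omega> - icpt D +
            (LINT t:tdom D|lborel. (slopeavg D n w \<omega> t - slope D t) *
               (trajhat D n i \<omega> t - muhat D n {1..n} \<omega> t)))\<^sup>2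
          \<ge> lmin * ((icptavg D n w \<omega> - icpt D)\<^sup>2 +
                (LINT t:tdom D|lborel. (slopeavg D n w \<omega> t - slope D t)\<^sup>2))})))"

end

theory Submission
  imports Defs
begin

text \<open>Let \<open>V\<^sub>i(w) = (\<Sum>J. w J * (Q\<^sub>J(X\<^sub>i) - Q(X\<^sub>i)))\<close> be the error at subject \<open>i\<close> of the weighted average of the limit fits,
  where \<open>Q\<^sub>J\<close> is \<open>Qlim\<close> and \<open>Q\<close> is \<open>Qtrue\<close>, and let \<open>\<epsilon>\<^sub>i\<close> be \<open>resid\<close>.  Put unit weight on the true model: there \<open>V\<^sub>i = 0\<close>.
  The check loss is Lipschitz, so the cross-validation criterion at \<open>w\<close> is the mean of \<open>check_loss (\<epsilon>\<^sub>i - V\<^sub>i(w))\<close> up to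
  \<open>O(c + g)\<close>, uniformly in \<open>w\<close> (\<open>cv_approx\<close>).  Since the selected weights do at least as well as the unit weight,
  the mean of the excess losses \<open>check_loss (\<epsilon>\<^sub>i - V\<^sub>i(w)) - check_loss \<epsilon>\<^sub>i\<close> at the selected weights is at most \<open>O(c + g)\<close>.

  On the other side, the excess loss has curvature.  Its expectation is at least a multiple of the expectation of
  \<open>V\<^sub>i(w)\<^sup>2\<close>, because the conditional density of \<open>\<epsilon>\<^sub>i\<close> is bounded below near its \<open>\<tau>\<close>-quantile 0
  (\<open>quantile_loss_excess\<close>).  Hence the excess loss minus that multiple of \<open>V\<^sub>i(w)\<^sup>2\<close> is a process indexed by the
  weights with nonnegative mean, with independent summands that are bounded and Lipschitz in \<open>w\<close> for the
  \<open>l\<^sup>1\<close> distance.  Chaining over lattice points of the simplex shows that its sum over the sample falls below its mean by at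
  most a multiple of \<open>sqrt (n * card (cand D n))\<close> for all weights at once (\<open>subsimplex_process_deviation\<close>,
  \<open>excess_loss_lower_bound\<close>).  The selected weights are random, but this bound is uniform, so the mean of
  \<open>V\<^sub>i(w)\<^sup>2\<close> at the selected weights is \<open>O(c + g + sqrt (card (cand D n)) / sqrt n)\<close>.

  It remains to pass from predictions to coefficients.  The quantity that is squared in \<open>eigen_condition\<close> differs from
  \<open>V\<^sub>i(w)\<close> by \<open>O(c + d)\<close> (\<open>fitted_contrast_approx\<close>): an estimated slope with \<open>J\<close> components is orthogonal to all
  later components of a fitted trajectory, so that the full and the truncated trajectory give the same prediction, and
  the error in replacing the estimated true model by the true coefficients is of order \<open>d\<close>.  Summing the squares over
  the indices provided by \<open>eigen_condition\<close> gives the claim (\<open>est_error_le\<close>).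

  One point needs care: plug-in errors are of order \<open>c\<close> times the norm of the limit slope of a model, and the number of
  models may grow with \<open>n\<close>.  A bound on these norms that is uniform over the models comes out of \<open>eigen_condition\<close>
  at the unit weights, since the predictions are bounded by \<open>bias_condition\<close> (\<open>slope_limit_bound\<close>).\<close>

section \<open>Events of high probability\<close>

text \<open>The exceptional event is required to be measurable, the property is not: the properties of interest are suprema over
  uncountably many weights.\<close>

definition likely :: "'a measure \<Rightarrow> real \<Rightarrow> ('a \<Rightarrow> bool) \<Rightarrow> bool" where
  "likely M e P \<longleftrightarrow> (\<exists>A\<in>sets M. measure M A \<le> e \<and> (\<forall>\<omega>\<in>space M - A. P \<omega>))"

lemma likely_mono:
  "likely M e P \<Longrightarrow> (\<And>\<omega>. \<omega> \<in> space M \<Longrightarrow> P \<omega> \<Longrightarrow> Q \<omega>) \<Longrightarrow> e \<le> e' \<Longrightarrow> likely M e' Q"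
  unfolding likely_def by (meson DiffD1 order_trans)

lemma (in prob_space) likely_conj:
  assumes "likely M e P" "likely M e' Q"
  shows "likely M (e + e') (\<lambda>\<omega>. P \<omega> \<and> Q \<omega>)"
proof -
  obtain A B where "A \<in> events" "prob A \<le> e" "\<forall>\<omega>\<in>space M - A. P \<omega>"
    and "B \<in> events" "prob B \<le> e'" "\<forall>\<omega>\<in>space M - B. Q \<omega>"
    using assms by (auto simp: likely_def)
  thus ?thesis unfolding likely_def
    by (intro bexI[of _ "A \<union> B"]) (auto intro: order_trans[OF measure_Un_le])
qed

lemma (in prob_space) likely_AE:
  assumes "AE \<omega> in M. P \<omega>"
  shows "likely M 0 P"
proof -
  obtain N where "\<And>\<omega>. \<omega> \<in> space M - N \<Longrightarrow> P \<omega>" "N \<in> null_sets M"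
    using AE_E3[OF assms] by blast
  thus ?thesis unfolding likely_def
    by (intro bexI[of _ N]) (auto simp: measure_eq_0_null_sets)
qed

lemma (in prob_space) likely_witness:
  assumes "likely M e P" "e < 1"
  shows "\<exists>\<omega>\<in>space M. P \<omega>"
proof -
  obtain A where "A \<in> events" "prob A \<le> e" "\<forall>\<omega>\<in>space M - A. P \<omega>"
    using assms by (auto simp: likely_def)
  moreover from this have "A \<noteq> space M" using assms(2) prob_space by force
  ultimately show ?thesis using sets.sets_into_space[of A M] by blast
qed

text \<open>Any larger constant serves as well, since \<open>r n\<close> cannot be negative where the bound holds for some index.
  Therefore finitely many stochastic orders can share one constant.\<close>

lemma Op_unif_likely:
  assumes "Op_unif M I Z r" "0 < e"
  shows "\<forall>\<^sub>F C in at_top. \<forall>\<^sub>F n in sequentially. likely M e (\<lambda>\<omega>. \<forall>i\<in>I n. \<bar>Z n i \<omega>\<bar> \<le> C * r n)"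
proof -
  obtain C0 where C0: "0 < C0"
    and ev: "\<forall>\<^sub>F n in sequentially. likely M e (\<lambda>\<omega>. \<forall>i\<in>I n. \<bar>Z n i \<omega>\<bar> \<le> C0 * r n)"
    using assms unfolding Op_unif_def likely_def by blast
  have mono: "\<bar>z\<bar> \<le> C * s" if "C0 \<le> C" "\<bar>z\<bar> \<le> C0 * s" for C z s :: real
  proof -
    have "0 \<le> C0 * s" using that(2) by linarith
    hence "0 \<le> s" using C0 by (simp add: zero_le_mult_iff)
    hence "C0 * s \<le> C * s" using that(1) by (rule mult_right_mono[rotated])
    thus ?thesis using that(2) by linarith
  qed
  show ?thesis
    using eventually_ge_at_top[of C0]
  proof eventually_elim
    case (elim C)
    show ?case using ev
      by eventually_elim (erule likely_mono, auto intro: mono[OF elim])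
  qed
qed


section \<open>Lattice points of the simplex\<close>

text \<open>Lattice points with mesh \<open>1 / (card C * 2 ^ k)\<close> are counted by a generating function: for \<open>x < 1\<close>, giving the point
  \<open>u\<close> the weight \<open>x ^ (\<Sum>J. u J)\<close> turns the count into a product of \<open>card C\<close> geometric series, at the price of a factor
  \<open>x ^ (card C * 2 ^ k)\<close> that stays above \<open>2 ^ (- card C)\<close> for \<open>1 - x = 2 ^ (- k - 1)\<close>.  The cubic lattice that contains
  these points is larger by a power of \<open>card C\<close>; that factor would put a logarithm of the number of models into the rate.\<close>

lemma card_subsimplex_lattice_le:
  fixes C :: "'j set"
  assumes "finite C"
  shows "finite {u \<in> C \<rightarrow>\<^sub>E {0..N}. (\<Sum>J\<in>C. u J) \<le> card C * 2 ^ k}" (is "finite ?U")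
    and "real (card {u \<in> C \<rightarrow>\<^sub>E {0..N}. (\<Sum>J\<in>C. u J) \<le> card C * 2 ^ k}) \<le> 2 ^ ((k + 2) * card C)"
proof -
  have fin: "finite (C \<rightarrow>\<^sub>E {0..N})"
    using assms by (intro finite_PiE) auto
  show "finite ?U"
    by (rule finite_subset[OF _ fin]) auto
  define x :: real where "x = 1 - 1 / 2 ^ (k + 1)"
  have x: "0 < x" "x < 1"
    unfolding x_def by (simp_all add: field_simps) (metis one_less_numeral_iff one_less_power power_Suc semiring_norm(76) zero_less_Suc)
  have "1 + real (2 ^ k) * (x - 1) \<le> (1 + (x - 1)) ^ (2 ^ k)"
    by (rule Bernoulli_inequality) (use x in auto)
  moreover have "real (2 ^ k) * (x - 1) = - 1 / 2"
    by (simp add: x_def field_simps)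
  ultimately have half: "1 / 2 \<le> x ^ (2 ^ k)" by simp
  have "real (card ?U) * x ^ (card C * 2 ^ k) = (\<Sum>u\<in>?U. x ^ (card C * 2 ^ k))"
    by simp
  also have "\<dots> \<le> (\<Sum>u\<in>?U. x ^ (\<Sum>J\<in>C. u J))"
    using x by (intro sum_mono power_decreasing) auto
  also have "\<dots> \<le> (\<Sum>u\<in>C \<rightarrow>\<^sub>E {0..N}. x ^ (\<Sum>J\<in>C. u J))"
    using x fin by (intro sum_mono2) auto
  also have "\<dots> = (\<Sum>u\<in>C \<rightarrow>\<^sub>E {0..N}. \<Prod>J\<in>C. x ^ u J)"
    by (simp add: power_sum)
  also have "\<dots> = (\<Prod>J\<in>C. \<Sum>v\<in>{0..N}. x ^ v)"
    using assms by (subst prod_sum_PiE) auto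
  also have "\<dots> \<le> (\<Prod>J\<in>C. 2 ^ (k + 1))"
  proof (intro prod_mono conjI)
    have "(\<Sum>v\<in>{0..N}. x ^ v) = (1 - x ^ Suc N) / (1 - x)"
      using x by (subst sum_gp0[folded atLeast0AtMost]) auto
    also have "\<dots> \<le> 1 / (1 - x)"
      using x by (intro divide_right_mono) auto
    also have "\<dots> = 2 ^ (k + 1)"
      by (simp add: x_def)
    finally show "(\<Sum>v\<in>{0..N}. x ^ v) \<le> 2 ^ (k + 1)" .
  qed (use x in \<open>auto intro: sum_nonneg\<close>)
  also have "\<dots> = 2 ^ ((k + 1) * card C)"
    by (simp only: prod_constant power_mult)
  finally have le: "real (card ?U) * x ^ (card C * 2 ^ k) \<le> 2 ^ ((k + 1) * card C)" .
  have "(1 / 2) ^ card C \<le> (x ^ (2 ^ k)) ^ card C"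
    using half by (intro power_mono) auto
  hence "(1 / 2) ^ card C \<le> x ^ (card C * 2 ^ k)"
    by (simp add: power_mult[symmetric] mult.commute)
  hence "real (card ?U) * (1 / 2) ^ card C \<le> real (card ?U) * x ^ (card C * 2 ^ k)"
    by (intro mult_left_mono) auto
  also note le
  finally have "real (card ?U) \<le> 2 ^ ((k + 1) * card C) * 2 ^ card C"
    by (simp add: power_divide field_simps)
  also have "\<dots> = 2 ^ ((k + 2) * card C)"
    by (metis add.assoc add_mult_distrib mult_1 one_add_one power_add)
  finally show "real (card ?U) \<le> 2 ^ ((k + 2) * card C)" .
qed

text \<open>Sums below 1 are allowed because rounding down leaves the simplex, and because the chains below start at 0.\<close>

definition subsimplex :: "'j set \<Rightarrow> ('j \<Rightarrow> real) set" where
  "subsimplex C = {w. (\<forall>J\<in>C. 0 \<le> w J) \<and> (\<Sum>J\<in>C. w J) \<le> 1}"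

text \<open>At level \<open>k\<close>, the integer vector \<open>u\<close> stands for the weights \<open>u / (card C * 2 ^ k)\<close>; the factor \<open>card C\<close> makes the
  \<open>l\<^sup>1\<close> rounding error at most \<open>1 / 2 ^ k\<close>.\<close>

definition mesh_point :: "'j set \<Rightarrow> nat \<Rightarrow> ('j \<Rightarrow> nat) \<Rightarrow> 'j \<Rightarrow> real" where
  "mesh_point C k u = (\<lambda>J. real (u J) / (real (card C) * 2 ^ k))"

definition mesh_index :: "'j set \<Rightarrow> nat \<Rightarrow> ('j \<Rightarrow> real) \<Rightarrow> 'j \<Rightarrow> nat" where
  "mesh_index C k w = (\<lambda>J\<in>C. nat \<lfloor>w J * (real (card C) * 2 ^ k)\<rfloor>)"

definition mesh :: "'j set \<Rightarrow> nat \<Rightarrow> ('j \<Rightarrow> nat) set" where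
  "mesh C k = {u \<in> C \<rightarrow>\<^sub>E {0..card C * 2 ^ k}. (\<Sum>J\<in>C. u J) \<le> card C * 2 ^ k}"

text \<open>The predecessor of a lattice point in a chain: halving the integer vector rounds down to the next coarser level, and
  chains end in 0 below level 0.\<close>

definition coarsen :: "'j set \<Rightarrow> nat \<Rightarrow> ('j \<Rightarrow> nat) \<Rightarrow> 'j \<Rightarrow> real" where
  "coarsen C k u = (case k of 0 \<Rightarrow> (\<lambda>_. 0) | Suc k' \<Rightarrow> mesh_point C k' (\<lambda>J. u J div 2))"

lemma mesh_point_in_subsimplex:
  assumes "finite C" "C \<noteq> {}" "u \<in> mesh C k"
  shows "mesh_point C k u \<in> subsimplex C"
proof -
  have "card C > 0" using assms by (simp add: card_gt_0_iff)
  have "(\<Sum>J\<in>C. mesh_point C k u J) = real (\<Sum>J\<in>C. u J) / (real (card C) * 2 ^ k)"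
    by (simp add: mesh_point_def sum_divide_distrib)
  also have "\<dots> \<le> real (card C * 2 ^ k) / (real (card C) * 2 ^ k)"
    using assms by (intro divide_right_mono of_nat_mono) (auto simp: mesh_def)
  also have "\<dots> = 1" using \<open>card C > 0\<close> by simp
  finally show ?thesis
    by (auto simp: subsimplex_def mesh_point_def)
qed

lemma coarsen_link:
  assumes "finite C" "C \<noteq> {}" "u \<in> mesh C k"
  shows "coarsen C k u \<in> subsimplex C"
    and "(\<Sum>J\<in>C. \<bar>mesh_point C k u J - coarsen C k u J\<bar>) \<le> 2 / 2 ^ k"
proof -
  have p: "card C > 0" using assms by (simp add: card_gt_0_iff)
  have "coarsen C k u \<in> subsimplex C \<and>
        (\<Sum>J\<in>C. \<bar>mesh_point C k u J - coarsen C k u J\<bar>) \<le> 2 / 2 ^ k"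
  proof (cases k)
    case 0
    have "(\<Sum>J\<in>C. \<bar>mesh_point C k u J\<bar>) = (\<Sum>J\<in>C. mesh_point C k u J)"
      by (simp add: mesh_point_def)
    also have "\<dots> \<le> 1"
      using mesh_point_in_subsimplex[OF assms] by (simp add: subsimplex_def)
    finally show ?thesis using 0
      by (auto simp: coarsen_def subsimplex_def)
  next
    case (Suc m)
    have le: "mesh_point C m (\<lambda>J. u J div 2) J \<le> mesh_point C k u J"
         and ge: "mesh_point C k u J - mesh_point C m (\<lambda>J. u J div 2) J \<le> 1 / (real (card C) * 2 ^ k)" for J
    proof -
      have "real (u J) = 2 * real (u J div 2) + real (u J mod 2)"
        by (metis div_mult_mod_eq mult.commute of_nat_add of_nat_mult of_nat_numeral)
      moreover have "real (u J mod 2) \<le> 1" by (simp add: of_nat_le_1_iff)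
      ultimately show "mesh_point C m (\<lambda>J. u J div 2) J \<le> mesh_point C k u J"
        "mesh_point C k u J - mesh_point C m (\<lambda>J. u J div 2) J \<le> 1 / (real (card C) * 2 ^ k)"
        using p by (auto simp: mesh_point_def Suc field_simps)
    qed
    have "(\<Sum>J\<in>C. mesh_point C m (\<lambda>J. u J div 2) J) \<le> (\<Sum>J\<in>C. mesh_point C k u J)"
      by (intro sum_mono le)
    also have "\<dots> \<le> 1"
      using mesh_point_in_subsimplex[OF assms] by (simp add: subsimplex_def)
    finally have "(\<Sum>J\<in>C. mesh_point C m (\<lambda>J. u J div 2) J) \<le> 1" .
    moreover have "(\<Sum>J\<in>C. \<bar>mesh_point C k u J - mesh_point C m (\<lambda>J. u J div 2) J\<bar>)
        \<le> (\<Sum>J\<in>C. 1 / (real (card C) * 2 ^ k))"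
      using le ge by (intro sum_mono) (simp add: abs_of_nonneg)
    moreover have "\<dots> \<le> 2 / 2 ^ k" using p by (simp add: field_simps)
    ultimately show ?thesis
      by (auto simp: coarsen_def Suc subsimplex_def mesh_point_def)
  qed
  thus "coarsen C k u \<in> subsimplex C"
    "(\<Sum>J\<in>C. \<bar>mesh_point C k u J - coarsen C k u J\<bar>) \<le> 2 / 2 ^ k" by auto
qed

text \<open>The last part makes the roundings of one weight vector at successive levels a chain.\<close>

lemma mesh_index_in_mesh:
  assumes "finite C" "C \<noteq> {}" "w \<in> subsimplex C"
  shows "mesh_index C k w \<in> mesh C k"
    and "(\<Sum>J\<in>C. \<bar>w J - mesh_point C k (mesh_index C k w) J\<bar>) \<le> 1 / 2 ^ k"
    and "k = Suc m \<Longrightarrow> J \<in> C \<Longrightarrow>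
           coarsen C k (mesh_index C k w) J = mesh_point C m (mesh_index C m w) J"
proof -
  have p: "card C > 0" using assms by (simp add: card_gt_0_iff)
  let ?N = "real (card C) * 2 ^ k"
  have N: "?N > 0" using p by simp
  have w: "J \<in> C \<Longrightarrow> 0 \<le> w J" "(\<Sum>J\<in>C. w J) \<le> 1" for J
    using assms by (auto simp: subsimplex_def)
  have i: "real (mesh_index C k w J) \<le> w J * ?N" "w J * ?N - 1 < real (mesh_index C k w J)"
    if "J \<in> C" for J
    using w(1)[OF that] that by (auto simp: mesh_index_def)
  have "real (\<Sum>J\<in>C. mesh_index C k w J) \<le> (\<Sum>J\<in>C. w J * ?N)"
    unfolding of_nat_sum by (intro sum_mono i)
  also have "\<dots> = (\<Sum>J\<in>C. w J) * ?N" by (simp add: sum_distrib_right)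
  also have "\<dots> \<le> 1 * ?N" using w(2) N by (intro mult_right_mono) auto
  finally have "real (\<Sum>J\<in>C. mesh_index C k w J) \<le> real (card C * 2 ^ k)"
    by simp
  hence s: "(\<Sum>J\<in>C. mesh_index C k w J) \<le> card C * 2 ^ k"
    unfolding of_nat_le_iff .
  have "mesh_index C k w J \<le> card C * 2 ^ k" if "J \<in> C" for J
    using member_le_sum[OF that, of "mesh_index C k w"] s \<open>finite C\<close> by simp
  with s show "mesh_index C k w \<in> mesh C k"
    by (auto simp: mesh_def mesh_index_def PiE_def)
  have div: "\<bar>x - a / y\<bar> \<le> 1 / y" if "a \<le> x * y" "x * y - 1 < a" "0 < y" for a x y :: real
  proof -
    have "x - a / y = (x * y - a) / y" using that by (simp add: field_simps)
    thus ?thesis using that by (simp add: divide_le_cancel abs_divide)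
  qed
  have "\<bar>w J - mesh_point C k (mesh_index C k w) J\<bar> \<le> 1 / ?N" if "J \<in> C" for J
    unfolding mesh_point_def by (rule div[OF i[OF that] N])
  hence "(\<Sum>J\<in>C. \<bar>w J - mesh_point C k (mesh_index C k w) J\<bar>) \<le> (\<Sum>J\<in>C. 1 / ?N)"
    by (intro sum_mono)
  also have "\<dots> = 1 / 2 ^ k" using p by simp
  finally show "(\<Sum>J\<in>C. \<bar>w J - mesh_point C k (mesh_index C k w) J\<bar>) \<le> 1 / 2 ^ k" .
  show "coarsen C k (mesh_index C k w) J = mesh_point C m (mesh_index C m w) J"
    if "k = Suc m" "J \<in> C"
  proof -
    have "\<lfloor>w J * (real (card C) * 2 ^ m)\<rfloor> = \<lfloor>(w J * (real (card C) * 2 ^ Suc m)) / real_of_int 2\<rfloor>"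
      by (simp add: field_simps)
    also have "\<dots> = \<lfloor>w J * (real (card C) * 2 ^ Suc m)\<rfloor> div 2"
      by (subst floor_divide_real_eq_div) auto
    finally have "nat \<lfloor>w J * (real (card C) * 2 ^ m)\<rfloor> = nat \<lfloor>w J * (real (card C) * 2 ^ Suc m)\<rfloor> div 2"
      using w(1)[OF that(2)] by (simp add: nat_div_distrib)
    thus ?thesis using that by (simp add: coarsen_def mesh_point_def mesh_index_def)
  qed
qed

section \<open>Uniform deviation over a simplex of weights\<close>

lemma sum_Suc_div_pow2_le: "(\<Sum>j\<le>k. (real j + 1) / 2 ^ j) \<le> 4"
proof -
  have "(\<Sum>j\<le>k. (real j + 1) / 2 ^ j) = 4 - (real k + 3) / 2 ^ k"
    by (induction k) (simp_all add: field_simps)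
  thus ?thesis by simp
qed

text \<open>Chaining.  The roundings of \<open>w\<close> at levels \<open>0, 1, 2, \<dots>\<close> join 0 to \<open>w\<close> by links of \<open>l\<^sup>1\<close> length at most \<open>2 / 2 ^ k\<close>.
  At level \<open>k\<close> there are at most \<open>2 ^ ((k + 2) * card C)\<close> links, and Hoeffding's inequality controls all of them
  by a multiple of \<open>(k + 1) / 2 ^ k * sqrt (card S * card C)\<close> with a failure probability that decays geometrically in
  \<open>k\<close>.  These bounds are summable over \<open>k\<close>.  A union bound over one fine lattice would lose a factor
  \<open>sqrt (ln (card S))\<close>.\<close>

lemma (in prob_space) subsimplex_process_deviation:
  fixes X :: "'i \<Rightarrow> ('j \<Rightarrow> real) \<Rightarrow> 'a \<Rightarrow> real"
  assumes S: "finite S" "S \<noteq> {}" and C: "finite C" "C \<noteq> {}" and L: "0 < L"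
    and indep: "\<And>w v. w \<in> subsimplex C \<Longrightarrow> v \<in> subsimplex C \<Longrightarrow>
                  indep_vars (\<lambda>_. borel) (\<lambda>i \<omega>. X i w \<omega> - X i v \<omega>) S"
    and lip: "\<And>i w v \<omega>. i \<in> S \<Longrightarrow> w \<in> subsimplex C \<Longrightarrow> v \<in> subsimplex C \<Longrightarrow> \<omega> \<in> space M \<Longrightarrow>
                \<bar>X i w \<omega> - X i v \<omega>\<bar> \<le> L * (\<Sum>J\<in>C. \<bar>w J - v J\<bar>)"
    and zero: "\<And>i \<omega>. i \<in> S \<Longrightarrow> \<omega> \<in> space M \<Longrightarrow> X i (\<lambda>_. 0) \<omega> = 0"
    and A: "0 < A" "exp (2 - A\<^sup>2 / 2) \<le> 1 / 2" "4 * exp (2 - A\<^sup>2 / 2) \<le> e"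
  shows "likely M e (\<lambda>\<omega>. \<forall>w\<in>subsimplex C.
           \<bar>\<Sum>i\<in>S. X i w \<omega> - expectation (X i w)\<bar> \<le> 8 * A * L * sqrt (real (card S) * real (card C)))"
proof -
  let ?W = "subsimplex C"
  define m where "m = real (card S)"
  define p where "p = card C"
  define R where "R = sqrt (m * real p)"
  define l where "l k = L * (2 / 2 ^ k)" for k :: nat
  define t where "t k = A * l k * (real k + 1) * R" for k
  define q where "q = exp (2 - A\<^sup>2 / 2)"
  have m: "m > 0" using S by (simp add: m_def card_gt_0_iff)
  have p: "p > 0" using C by (simp add: p_def card_gt_0_iff)
  have R: "R > 0" "R\<^sup>2 = m * p" using m p by (simp_all add: R_def)
  have l: "l k > 0" for k using L by (simp add: l_def)
  have t: "t k > 0" for k using A R l by (simp add: t_def)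
  have q: "0 < q" "q \<le> 1 / 2" "4 * q \<le> e" using A by (simp_all add: q_def)
  have zW: "(\<lambda>_. 0) \<in> ?W" by (simp add: subsimplex_def)
  have rv: "X i w \<in> borel_measurable M" if "i \<in> S" "w \<in> ?W" for i w
  proof -
    have "(\<lambda>\<omega>. X i w \<omega> - X i (\<lambda>_. 0) \<omega>) \<in> borel_measurable M"
      using indep[OF that(2) zW] that(1) unfolding indep_vars_def by auto
    also have "?this \<longleftrightarrow> ?thesis"
      using zero[OF that(1)] by (intro measurable_cong) auto
    finally show ?thesis .
  qed
  have bd: "\<bar>X i w \<omega>\<bar> \<le> L" if "i \<in> S" "w \<in> ?W" "\<omega> \<in> space M" for i w \<omega>
  proof -
    have "(\<Sum>J\<in>C. \<bar>w J - 0\<bar>) = (\<Sum>J\<in>C. w J)"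
      using that by (intro sum.cong) (auto simp: subsimplex_def)
    also have "\<dots> \<le> 1" using that by (simp add: subsimplex_def)
    finally have "L * (\<Sum>J\<in>C. \<bar>w J - 0\<bar>) \<le> L * 1" using L by (intro mult_left_mono) auto
    with lip[OF that(1,2) zW that(3)] zero[OF that(1,3)] show ?thesis by simp
  qed
  have int: "integrable M (X i w)" if "i \<in> S" "w \<in> ?W" for i w
    by (rule integrable_const_bound[where B = L]) (use bd[OF that] rv[OF that] in auto)
  \<comment> \<open>the increment of the process along the link that ends in the lattice point \<open>u\<close>\<close>
  define link where "link k u i \<omega> = X i (mesh_point C k u) \<omega> - X i (coarsen C k u) \<omega>" for k u i \<omega>
  define E where "E k u = {\<omega> \<in> space M.
      \<bar>(\<Sum>i\<in>S. link k u i \<omega>) - (\<Sum>i\<in>S. expectation (link k u i))\<bar> \<ge> t k}" for k u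
  define F where "F k = (\<Union>u\<in>mesh C k. E k u)" for k
  have fin_mesh: "finite (mesh C k)" and card_mesh: "real (card (mesh C k)) \<le> 2 ^ ((k + 2) * p)" for k
    using card_subsimplex_lattice_le[OF C(1), of "card C * 2 ^ k" k] by (simp_all add: mesh_def p_def)
  have W1: "mesh_point C k u \<in> ?W" "coarsen C k u \<in> ?W" if "u \<in> mesh C k" for k u
    using mesh_point_in_subsimplex[OF C that] coarsen_link[OF C that] by auto
  have link_rv [measurable]: "link k u i \<in> borel_measurable M" if "u \<in> mesh C k" "i \<in> S" for k u i
    unfolding link_def using rv W1 that by (intro borel_measurable_diff) auto
  have E_sets: "E k u \<in> sets M" if "u \<in> mesh C k" for k u
    unfolding E_def using link_rv[OF that] by measurable
  have probE: "prob (E k u) \<le> 2 * exp (- (A\<^sup>2 * (real k + 1)\<^sup>2 * p / 2))" if u: "u \<in> mesh C k" for k u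
  proof -
    interpret H: Hoeffding_ineq M S "link k u" "\<lambda>_. - l k" "\<lambda>_. l k" "\<Sum>i\<in>S. expectation (link k u i)"
    proof unfold_locales
      show "finite S" by fact
      show "indep_vars (\<lambda>_. borel) (link k u) S"
        using indep[OF W1[OF u]] unfolding link_def .
    next
      fix i assume i: "i \<in> S"
      have "\<bar>link k u i \<omega>\<bar> \<le> l k" if "\<omega> \<in> space M" for \<omega>
      proof -
        have "\<bar>link k u i \<omega>\<bar> \<le> L * (\<Sum>J\<in>C. \<bar>mesh_point C k u J - coarsen C k u J\<bar>)"
          unfolding link_def by (rule lip[OF i W1[OF u] that])
        also have "\<dots> \<le> l k"
          unfolding l_def using L coarsen_link(2)[OF C u] by (intro mult_left_mono) auto
        finally show ?thesis .
      qed
      thus "AE \<omega> in M. link k u i \<omega> \<in> {- l k..l k}"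
        by (intro AE_I2) (auto simp: abs_le_iff minus_le_iff)
    qed (simp)
    have sq: "(\<Sum>i\<in>S. (l k - - l k)\<^sup>2) = m * (4 * (l k)\<^sup>2)"
      by (simp add: m_def power2_eq_square)
    have "prob (E k u) \<le> 2 * exp (-2 * (t k)\<^sup>2 / (\<Sum>i\<in>S. (l k - - l k)\<^sup>2))"
      unfolding E_def
      using t[of k] l[of k] m by (intro H.Hoeffding_ineq_abs_ge) (simp_all only: sq, auto)
    also have "-2 * (t k)\<^sup>2 / (\<Sum>i\<in>S. (l k - - l k)\<^sup>2) = - (A\<^sup>2 * (real k + 1)\<^sup>2 * p / 2)"
      unfolding sq t_def power_mult_distrib R(2) using l[of k] m by (simp add: field_simps)
    finally show ?thesis .
  qed
  \<comment> \<open>Hoeffding's exponent beats the number of links: \<open>2 ^ ((k + 2) * p) \<le> exp (2 * (k + 1) * p)\<close>\<close>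
  have probF: "prob (F k) \<le> 2 * q * q ^ k" for k
  proof -
    have "prob (F k) \<le> (\<Sum>u\<in>mesh C k. prob (E k u))"
      unfolding F_def using fin_mesh E_sets
      by (intro finite_measure_subadditive_finite) auto
    also have "\<dots> \<le> (\<Sum>u\<in>mesh C k. 2 * exp (- (A\<^sup>2 * (real k + 1)\<^sup>2 * p / 2)))"
      by (intro sum_mono probE)
    also have "\<dots> = real (card (mesh C k)) * (2 * exp (- (A\<^sup>2 * (real k + 1)\<^sup>2 * p / 2)))"
      by simp
    also have "\<dots> \<le> exp (2 * ((real k + 1) * p)) * (2 * exp (- (A\<^sup>2 / 2 * ((real k + 1) * p))))"
    proof (rule mult_mono)
      have "real (card (mesh C k)) \<le> 2 ^ ((k + 2) * p)" by (rule card_mesh)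
      also have "(2::real) ^ ((k + 2) * p) \<le> 2 ^ (2 * ((k + 1) * p))"
        by (intro power_increasing) (auto simp: algebra_simps)
      also have "\<dots> \<le> exp 1 ^ (2 * ((k + 1) * p))"
        using exp_ge_add_one_self[of 1] by (intro power_mono) auto
      also have "\<dots> = exp (2 * ((real k + 1) * p))"
        by (simp add: exp_of_nat_mult[symmetric] algebra_simps)
      finally show "real (card (mesh C k)) \<le> exp (2 * ((real k + 1) * p))" .
      have "(real k + 1) * (A\<^sup>2 * (real k + 1) * p / 2) \<ge> 1 * (A\<^sup>2 * (real k + 1) * p / 2)"
        by (intro mult_right_mono) auto
      thus "2 * exp (- (A\<^sup>2 * (real k + 1)\<^sup>2 * p / 2)) \<le> 2 * exp (- (A\<^sup>2 / 2 * ((real k + 1) * p)))"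
        by (simp add: power2_eq_square mult_ac)
    qed auto
    also have "\<dots> = 2 * exp ((2 - A\<^sup>2 / 2) * real ((k + 1) * p))"
      by (simp add: exp_add[symmetric] algebra_simps)
    also have "\<dots> = 2 * q ^ ((k + 1) * p)"
      unfolding q_def by (simp only: exp_of_nat2_mult)
    also have "\<dots> \<le> 2 * q ^ (k + 1)"
    proof -
      have "(k + 1) * 1 \<le> (k + 1) * p" using p by (intro mult_left_mono) auto
      thus ?thesis using q by (intro mult_left_mono power_decreasing) auto
    qed
    finally show ?thesis by simp
  qed
  have F_sets: "F k \<in> sets M" for k
    unfolding F_def using E_sets fin_mesh by (intro sets.finite_UN) auto
  have geo: "summable (\<lambda>k. 2 * q * q ^ k)" "(\<Sum>k. 2 * q * q ^ k) = 2 * q * (1 / (1 - q))"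
    using q by (auto intro!: summable_mult summable_geometric simp: suminf_mult summable_geometric suminf_geometric)
  have sumF: "summable (\<lambda>k. prob (F k))"
    by (rule summable_comparison_test'[OF geo(1), of 0]) (use probF in auto)
  have "prob (\<Union>k. F k) \<le> (\<Sum>k. prob (F k))"
    using F_sets sumF by (intro finite_measure_subadditive_countably) auto
  also have "\<dots> \<le> (\<Sum>k. 2 * q * q ^ k)"
    by (intro suminf_le probF sumF geo)
  also have "\<dots> \<le> 4 * q"
    using q unfolding geo by (simp add: field_simps)
  finally have small: "prob (\<Union>k. F k) \<le> e" using q by simp
  have main: "\<bar>\<Sum>i\<in>S. X i w \<omega> - expectation (X i w)\<bar> \<le> 8 * A * L * R"
    if \<omega>: "\<omega> \<in> space M - (\<Union>k. F k)" and w: "w \<in> ?W" for \<omega> w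
  proof -
    define Z where "Z v = (\<Sum>i\<in>S. X i v \<omega> - expectation (X i v))" for v
    define v where "v k = mesh_point C k (mesh_index C k w)" for k
    have idx: "mesh_index C k w \<in> mesh C k" for k
      by (rule mesh_index_in_mesh[OF C w])
    have vW: "v k \<in> ?W" for k unfolding v_def by (rule W1[OF idx])
    have Zlink: "\<bar>Z (v k) - Z (coarsen C k (mesh_index C k w))\<bar> \<le> t k" for k
    proof -
      let ?u = "mesh_index C k w"
      have "\<omega> \<notin> E k ?u" using \<omega> idx[of k] by (auto simp: F_def)
      hence "\<bar>(\<Sum>i\<in>S. link k ?u i \<omega>) - (\<Sum>i\<in>S. expectation (link k ?u i))\<bar> < t k"
        using \<omega> by (auto simp: E_def)
      also have "(\<Sum>i\<in>S. expectation (link k ?u i)) =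
          (\<Sum>i\<in>S. expectation (X i (v k)) - expectation (X i (coarsen C k ?u)))"
        unfolding link_def v_def using int W1[OF idx] by (intro sum.cong refl Bochner_Integration.integral_diff) auto
      also have "(\<Sum>i\<in>S. link k ?u i \<omega>) - \<dots> = Z (v k) - Z (coarsen C k ?u)"
        by (simp add: Z_def link_def v_def sum_subtractf)
      finally show ?thesis by simp
    qed
    have Zlip: "\<bar>Z a - Z b\<bar> \<le> m * (2 * L * (\<Sum>J\<in>C. \<bar>a J - b J\<bar>))" if ab: "a \<in> ?W" "b \<in> ?W" for a b
    proof -
      have "Z a - Z b = (\<Sum>i\<in>S. (X i a \<omega> - X i b \<omega>) - expectation (\<lambda>\<omega>. X i a \<omega> - X i b \<omega>))"
        unfolding Z_def sum_subtractf[symmetric]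
        using int ab by (intro sum.cong refl) (simp add: Bochner_Integration.integral_diff)
      also have "\<bar>\<dots>\<bar> \<le> (\<Sum>i\<in>S. 2 * L * (\<Sum>J\<in>C. \<bar>a J - b J\<bar>))"
      proof (rule order_trans[OF sum_abs], rule sum_mono)
        fix i assume i: "i \<in> S"
        let ?d = "L * (\<Sum>J\<in>C. \<bar>a J - b J\<bar>)"
        have "\<bar>expectation (\<lambda>\<omega>. X i a \<omega> - X i b \<omega>)\<bar> \<le> expectation (\<lambda>\<omega>. \<bar>X i a \<omega> - X i b \<omega>\<bar>)"
          by (rule integral_abs_bound)
        also have "\<dots> \<le> expectation (\<lambda>_. ?d)"
          using int[OF i] ab lip[OF i ab] by (intro integral_mono_AE) auto
        also have "\<dots> = ?d" by (simp add: prob_space)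
        finally have "\<bar>expectation (\<lambda>\<omega>. X i a \<omega> - X i b \<omega>)\<bar> \<le> ?d" .
        moreover have "\<bar>X i a \<omega> - X i b \<omega>\<bar> \<le> ?d" using lip[OF i ab] \<omega> by auto
        ultimately show "\<bar>(X i a \<omega> - X i b \<omega>) - expectation (\<lambda>\<omega>. X i a \<omega> - X i b \<omega>)\<bar>
            \<le> 2 * L * (\<Sum>J\<in>C. \<bar>a J - b J\<bar>)" by linarith
      qed
      finally show ?thesis by (simp add: m_def)
    qed
    have Z0: "Z (\<lambda>_. 0) = 0"
    proof -
      have "expectation (X i (\<lambda>_. 0)) = 0" if "i \<in> S" for i
        using zero[OF that] by (subst Bochner_Integration.integral_cong[where g = "\<lambda>_. 0"]) auto
      thus ?thesis using zero \<omega> by (simp add: Z_def)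
    qed
    have "\<bar>Z (v k)\<bar> \<le> (\<Sum>j\<le>k. t j)" for k
    proof (induction k)
      case 0
      show ?case using Zlink[of 0] Z0 by (simp add: coarsen_def)
    next
      case (Suc k)
      have "Z (coarsen C (Suc k) (mesh_index C (Suc k) w)) = Z (v k)"
      proof -
        have "(\<Sum>J\<in>C. \<bar>coarsen C (Suc k) (mesh_index C (Suc k) w) J - v k J\<bar>) = 0"
          using mesh_index_in_mesh(3)[OF C w refl] by (simp add: v_def)
        thus ?thesis using Zlip[OF W1(2)[OF idx] vW, of "Suc k" k] by simp
      qed
      thus ?case using Zlink[of "Suc k"] Suc by simp
    qed
    moreover have "(\<Sum>j\<le>k. t j) \<le> 8 * A * L * R" for k
    proof -
      have "(\<Sum>j\<le>k. t j) = 2 * A * L * R * (\<Sum>j\<le>k. (real j + 1) / 2 ^ j)"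
        by (simp add: t_def l_def sum_distrib_left mult_ac)
      also have "\<dots> \<le> 2 * A * L * R * 4"
        using A L R by (intro mult_left_mono sum_Suc_div_pow2_le) auto
      finally show ?thesis by simp
    qed
    \<comment> \<open>the lattice points converge to \<open>w\<close>, and the process is Lipschitz\<close>
    ultimately have Zv: "\<bar>Z (v k)\<bar> \<le> 8 * A * L * R" for k
      by (meson order_trans)
    have "\<bar>Z w\<bar> \<le> 8 * A * L * R + m * (2 * L * (1 / 2 ^ k))" for k
    proof -
      have "\<bar>Z w - Z (v k)\<bar> \<le> m * (2 * L * (\<Sum>J\<in>C. \<bar>w J - v k J\<bar>))"
        by (rule Zlip[OF w vW])
      also have "\<dots> \<le> m * (2 * L * (1 / 2 ^ k))"
        unfolding v_def using m L by (intro mult_left_mono mesh_index_in_mesh(2)[OF C w]) auto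
      finally show ?thesis using Zv[of k] by linarith
    qed
    moreover have "(\<lambda>k. 8 * A * L * R + m * (2 * L * (1 / 2 ^ k))) \<longlonglongrightarrow> 8 * A * L * R + m * (2 * L * 0)"
      by (intro tendsto_intros LIMSEQ_divide_realpow_zero) auto
    ultimately have "\<bar>Z w\<bar> \<le> 8 * A * L * R + m * (2 * L * 0)"
      by (intro LIMSEQ_le_const) auto
    thus ?thesis by (simp add: Z_def)
  qed
  show ?thesis
    unfolding likely_def using small main F_sets
    by (intro bexI[of _ "\<Union>k. F k"]) (auto simp: R_def m_def p_def)
qed

section \<open>Curvature of the expected check loss\<close>

text \<open>Knight's identity: a term that is linear in \<open>v\<close> and a nonnegative remainder.\<close>

lemma check_loss_diff:
  "check_loss \<tau> (e - v) - check_loss \<tau> e =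
     (if 0 < e \<and> e \<le> v then v - e else if v < e \<and> e \<le> 0 then e - v else 0) -
     v * (\<tau> - (if e \<le> 0 then 1 else 0))"
  by (auto simp: check_loss_def algebra_simps)

lemma check_loss_lipschitz:
  assumes "0 < \<tau>" "\<tau> < 1"
  shows "\<bar>check_loss \<tau> x - check_loss \<tau> y\<bar> \<le> \<bar>x - y\<bar>"
proof -
  have mono: "\<bar>check_loss \<tau> x - check_loss \<tau> y\<bar> \<le> x - y" if "y \<le> x" for x y
  proof -
    have "\<tau> * (x - y) \<le> 1 * (x - y)" "0 \<le> \<tau> * (x - y)"
      using assms that mult_right_mono[of \<tau> 1 "x - y"] by (auto intro: mult_nonneg_nonneg)
    moreover have "0 < x \<Longrightarrow> 0 \<le> \<tau> * x" "0 < x \<Longrightarrow> \<tau> * x \<le> 1 * x"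
      using assms by (auto intro: mult_right_mono)
    moreover have "y \<le> 0 \<Longrightarrow> \<tau> * y \<le> 0" "y \<le> 0 \<Longrightarrow> 1 * y \<le> \<tau> * y"
      using assms mult_right_mono_neg[of \<tau> 1 y] by (auto simp: mult_nonneg_nonpos)
    ultimately show ?thesis using that
      by (auto simp: check_loss_def algebra_simps abs_le_iff)
  qed
  show ?thesis using mono[of x y] mono[of y x] by (cases "y \<le> x") (auto simp: abs_minus_commute)
qed

lemma borel_measurable_check_loss [measurable]: "check_loss \<tau> \<in> borel_measurable borel"
  unfolding check_loss_def by measurable

text \<open>Tonelli's theorem reduces the expected length of a random set of thresholds \<open>s\<close> to probabilities at fixed \<open>s\<close>.
  In the application \<open>N s\<close> says that a residual lies between 0 and \<open>s\<close>, and that length is the part of the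
  remainder in Knight's identity that belongs to one sign of \<open>V\<close>.  At a fixed \<open>s\<close>, conditional probabilities are
  needed for a single event only, so no regular conditional distribution is involved.\<close>

lemma (in prob_space) layered_lower_bound:
  fixes V :: "'a \<Rightarrow> real" and N :: "real \<Rightarrow> 'a \<Rightarrow> bool"
  assumes [measurable]: "V \<in> borel_measurable M" "Measurable.pred (borel \<Otimes>\<^sub>M M) (\<lambda>(s, \<omega>). N s \<omega>)"
    and V: "\<And>\<omega>. \<omega> \<in> space M \<Longrightarrow> V \<omega> \<le> r" and c: "0 \<le> c"
    and N: "\<And>s. 0 \<le> s \<Longrightarrow> s < r \<Longrightarrow>
              c * s * prob {\<omega> \<in> space M. s < V \<omega>} \<le> prob {\<omega> \<in> space M. s < V \<omega> \<and> N s \<omega>}"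
  shows "(\<integral>\<^sup>+\<omega>. ennreal (c / 2 * (max 0 (V \<omega>))\<^sup>2) \<partial>M) \<le>
         (\<integral>\<^sup>+\<omega>. emeasure lborel {s. 0 \<le> s \<and> s < V \<omega> \<and> N s \<omega>} \<partial>M)"
proof -
  interpret P: pair_sigma_finite lborel M
    by (intro pair_sigma_finite.intro lborel.sigma_finite_measure_axioms sigma_finite_measure_axioms)
  have quad: "ennreal (c / 2 * (max 0 (V \<omega>))\<^sup>2) =
      (\<integral>\<^sup>+s. ennreal (c * s) * indicator {s. 0 \<le> s \<and> s < V \<omega>} s \<partial>lborel)" for \<omega>
  proof -
    have "(\<integral>\<^sup>+s. ennreal (c * s) * indicator {0..max 0 (V \<omega>)} s \<partial>lborel) =
        ennreal (c / 2 * (max 0 (V \<omega>))\<^sup>2 - c / 2 * 0\<^sup>2)"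
      by (rule nn_integral_FTC_Icc) (use c in \<open>auto intro!: derivative_eq_intros\<close>)
    also have "(\<integral>\<^sup>+s. ennreal (c * s) * indicator {0..max 0 (V \<omega>)} s \<partial>lborel) =
        (\<integral>\<^sup>+s. ennreal (c * s) * indicator {s. 0 \<le> s \<and> s < V \<omega>} s \<partial>lborel)"
      using AE_lborel_singleton[of "V \<omega>"] AE_lborel_singleton[of 0]
      by (intro nn_integral_cong_AE, eventually_elim) (auto simp: indicator_def)
    finally show ?thesis by simp
  qed
  have "(\<integral>\<^sup>+\<omega>. ennreal (c / 2 * (max 0 (V \<omega>))\<^sup>2) \<partial>M) =
      (\<integral>\<^sup>+\<omega>. \<integral>\<^sup>+s. ennreal (c * s) * indicator {s. 0 \<le> s \<and> s < V \<omega>} s \<partial>lborel \<partial>M)"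
    by (simp only: quad)
  also have "\<dots> = (\<integral>\<^sup>+s. \<integral>\<^sup>+\<omega>. ennreal (c * s) * indicator {s. 0 \<le> s \<and> s < V \<omega>} s \<partial>M \<partial>lborel)"
    by (rule P.Fubini') measurable
  also have "\<dots> \<le> (\<integral>\<^sup>+s. \<integral>\<^sup>+\<omega>. indicator {s. 0 \<le> s \<and> s < V \<omega> \<and> N s \<omega>} s \<partial>M \<partial>lborel)"
  proof (rule nn_integral_mono)
    fix s :: real
    show "(\<integral>\<^sup>+\<omega>. ennreal (c * s) * indicator {s. 0 \<le> s \<and> s < V \<omega>} s \<partial>M) \<le>
        (\<integral>\<^sup>+\<omega>. indicator {s. 0 \<le> s \<and> s < V \<omega> \<and> N s \<omega>} s \<partial>M)"
    proof (cases "0 \<le> s \<and> s < r")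
      case True
      have "(\<integral>\<^sup>+\<omega>. ennreal (c * s) * indicator {s. 0 \<le> s \<and> s < V \<omega>} s \<partial>M) =
          (\<integral>\<^sup>+\<omega>. ennreal (c * s) * indicator {\<omega> \<in> space M. s < V \<omega>} \<omega> \<partial>M)"
        using True by (intro nn_integral_cong) (auto simp: indicator_def)
      also have "\<dots> = ennreal (c * s * prob {\<omega> \<in> space M. s < V \<omega>})"
        using True c by (subst nn_integral_cmult_indicator) (auto simp: emeasure_eq_measure ennreal_mult)
      also have "\<dots> \<le> ennreal (prob {\<omega> \<in> space M. s < V \<omega> \<and> N s \<omega>})"
        using N[of s] True by (intro ennreal_leI) auto
      also have "\<dots> = (\<integral>\<^sup>+\<omega>. indicator {\<omega> \<in> space M. s < V \<omega> \<and> N s \<omega>} \<omega> \<partial>M)"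
        by (subst nn_integral_indicator) (auto simp: emeasure_eq_measure)
      also have "\<dots> = (\<integral>\<^sup>+\<omega>. indicator {s. 0 \<le> s \<and> s < V \<omega> \<and> N s \<omega>} s \<partial>M)"
        using True by (intro nn_integral_cong) (auto simp: indicator_def)
      finally show ?thesis .
    next
      case False
      hence "(\<integral>\<^sup>+\<omega>. ennreal (c * s) * indicator {s. 0 \<le> s \<and> s < V \<omega>} s \<partial>M) = (\<integral>\<^sup>+\<omega>. 0 \<partial>M)"
        using V by (intro nn_integral_cong) (force simp: indicator_def)
      thus ?thesis by simp
    qed
  qed
  also have "\<dots> = (\<integral>\<^sup>+\<omega>. \<integral>\<^sup>+s. indicator {s. 0 \<le> s \<and> s < V \<omega> \<and> N s \<omega>} s \<partial>lborel \<partial>M)"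
    by (rule P.Fubini'[symmetric]) measurable
  also have "\<dots> = (\<integral>\<^sup>+\<omega>. emeasure lborel {s. 0 \<le> s \<and> s < V \<omega> \<and> N s \<omega>} \<partial>M)"
    by (intro nn_integral_cong nn_integral_indicator) (simp, measurable)
  finally show ?thesis .
qed

text \<open>In Knight's identity, the linear term has expectation 0: \<open>V\<close> is known given \<open>F\<close>, and the conditional probability of
  \<open>e \<le> 0\<close> is \<open>\<tau>\<close>.  The remainder is the length of the interval of thresholds between \<open>e\<close> and \<open>V\<close> if \<open>e\<close> lies between 0
  and \<open>V\<close>.  A conditional density of at least \<open>c\<close> gives the event that \<open>e\<close> lies between 0 and \<open>s\<close> a conditional
  probability of at least \<open>c * s\<close>, and integrating \<open>c * s\<close> up to \<open>V\<close> gives \<open>c / 2 * V\<^sup>2\<close>.\<close>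

lemma (in prob_space) quantile_loss_excess:
  fixes e V :: "'a \<Rightarrow> real" and f :: "real \<Rightarrow> 'a \<Rightarrow> real"
  assumes F: "subalgebra M F"
    and e [measurable]: "e \<in> borel_measurable M"
    and VF: "V \<in> borel_measurable F" and V: "\<And>\<omega>. \<omega> \<in> space M \<Longrightarrow> \<bar>V \<omega>\<bar> \<le> r"
    and quant: "AE \<omega> in M. cond_probability M F (\<lambda>\<omega>. e \<omega> < 0) \<omega> \<le> \<tau> \<and>
                          \<tau> \<le> cond_probability M F (\<lambda>\<omega>. e \<omega> \<le> 0) \<omega>"
    and f: "\<And>\<omega>. \<omega> \<in> space M \<Longrightarrow> (\<lambda>s. f s \<omega>) \<in> borel_measurable borel"
    and dens: "\<And>B. B \<in> sets borel \<Longrightarrow> AE \<omega> in M.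
                 cond_probability M F (\<lambda>\<omega>. e \<omega> \<in> B) \<omega> = (LINT s:B|lborel. f s \<omega>)"
    and low: "AE \<omega> in M. \<forall>s. \<bar>s\<bar> \<le> r \<longrightarrow> c \<le> f s \<omega> \<and> f s \<omega> \<le> c'" and c: "0 \<le> c"
  shows "c / 2 * expectation (\<lambda>\<omega>. (V \<omega>)\<^sup>2) \<le>
           expectation (\<lambda>\<omega>. check_loss \<tau> (e \<omega> - V \<omega>) - check_loss \<tau> (e \<omega>))"
proof -
  interpret S: finite_measure_subalgebra M F by unfold_locales fact
  have V_M [measurable]: "V \<in> borel_measurable M"
    using VF F by (rule measurable_from_subalg[rotated])
  have FM: "A \<in> sets F \<Longrightarrow> A \<in> sets M" for A using F by (auto simp: subalgebra_def)
  have spF: "space F = space M" using F by (simp add: subalgebra_def)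
  \<comment> \<open>given \<open>F\<close>, sets within distance \<open>r\<close> of 0 have probability at least \<open>c\<close> times their length\<close>
  have mass: "c * s * prob A \<le> prob (A \<inter> {\<omega> \<in> space M. e \<omega> \<in> B})"
    if A: "A \<in> sets F" and B: "B \<in> sets borel" "B \<subseteq> {- r..r}" "emeasure lborel B = ennreal s" "0 \<le> s" for A B s
  proof -
    have [measurable]: "A \<in> sets M" "B \<in> sets borel" using FM A B by auto
    have mB: "measure lborel B = s" using B by (simp add: measure_def)
    have *: "AE \<omega> in M. c * s \<le> real_cond_exp M F (indicator {\<omega> \<in> space M. e \<omega> \<in> B}) \<omega>"
      using dens[OF B(1)] low AE_space
    proof eventually_elim
      case (elim \<omega>)
      have bd: "set_integrable lborel B (\<lambda>s. f s \<omega>)"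
        unfolding set_integrable_def
      proof (rule Bochner_Integration.integrable_bound)
        show "integrable lborel (\<lambda>s. (\<bar>c\<bar> + \<bar>c'\<bar>) * indicator B s)"
          using B by (intro integrable_mult_right integrable_real_indicator) auto
        show "(\<lambda>s. indicator B s *\<^sub>R f s \<omega>) \<in> borel_measurable lborel"
          using f[OF elim(3)] by measurable
        show "AE s in lborel. norm (indicat_real B s *\<^sub>R f s \<omega>) \<le> norm ((\<bar>c\<bar> + \<bar>c'\<bar>) * indicator B s)"
        proof (rule AE_I2)
          fix s
          show "norm (indicat_real B s *\<^sub>R f s \<omega>) \<le> norm ((\<bar>c\<bar> + \<bar>c'\<bar>) * indicator B s)"
          proof (cases "s \<in> B")
            case True
            hence "- r \<le> s" "s \<le> r" using B(2) by auto
            hence "\<bar>s\<bar> \<le> r" by linarith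
            hence "c \<le> f s \<omega>" "f s \<omega> \<le> c'" using elim(2) by auto
            hence "\<bar>f s \<omega>\<bar> \<le> \<bar>c\<bar> + \<bar>c'\<bar>" by linarith
            thus ?thesis using True by simp
          qed simp
        qed
      qed
      have "c * s = (LINT s:B|lborel. c)"
        using B by (simp add: set_lebesgue_integral_def mB)
      also have "\<dots> \<le> (LINT s:B|lborel. f s \<omega>)"
        using elim(2) B bd
        by (intro set_integral_mono) (auto simp: set_integrable_def abs_le_iff minus_le_iff subset_iff)
      finally show ?case using elim(1) by (simp add: cond_probability_def)
    qed
    have "c * s * prob A = (\<integral>\<omega>\<in>A. c * s \<partial>M)"
      by (simp add: set_lebesgue_integral_def)
    also have "\<dots> \<le> (\<integral>\<omega>\<in>A. real_cond_exp M F (indicator {\<omega> \<in> space M. e \<omega> \<in> B}) \<omega> \<partial>M)"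
    proof -
      have "integrable M (real_cond_exp M F (indicator {\<omega> \<in> space M. e \<omega> \<in> B}))"
        by (intro S.real_cond_exp_int integrable_real_indicator) (auto simp: emeasure_eq_measure)
      thus ?thesis using *
        unfolding set_lebesgue_integral_def
        by (intro integral_mono_AE integrable_mult_indicator)
           (auto simp: indicator_def emeasure_eq_measure intro: integrable_mult_indicator)
    qed
    also have "\<dots> = (\<integral>\<omega>\<in>A. indicator {\<omega> \<in> space M. e \<omega> \<in> B} \<omega> \<partial>M)"
      by (intro S.real_cond_exp_intA[symmetric] A integrable_real_indicator) (auto simp: emeasure_eq_measure)
    also have "\<dots> = (\<integral>\<omega>. indicator (A \<inter> {\<omega> \<in> space M. e \<omega> \<in> B}) \<omega> \<partial>M)"
      unfolding set_lebesgue_integral_def by (intro Bochner_Integration.integral_cong) (auto simp: indicator_def)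
    also have "\<dots> = prob (A \<inter> {\<omega> \<in> space M. e \<omega> \<in> B})"
      by (simp add: Int_absorb2 sets.sets_into_space)
    finally show ?thesis .
  qed
  \<comment> \<open>the quantile condition with \<open><\<close> and \<open>\<le>\<close> pins down the conditional probability, as the law given \<open>F\<close> has no atoms\<close>
  define I where "I = {\<omega> \<in> space M. e \<omega> \<le> 0}"
  have I [measurable]: "I \<in> sets M" unfolding I_def by measurable
  have d1: "AE \<omega> in M. cond_probability M F (\<lambda>\<omega>. e \<omega> < 0) \<omega> = (LINT s:{..<0}|lborel. f s \<omega>)"
    using dens[of "{..<0}"] by simp
  have d2: "AE \<omega> in M. cond_probability M F (\<lambda>\<omega>. e \<omega> \<le> 0) \<omega> = (LINT s:{..0}|lborel. f s \<omega>)"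
    using dens[of "{..0}"] by simp
  have tau: "AE \<omega> in M. real_cond_exp M F (indicator I) \<omega> = \<tau>"
    using quant d1 d2 AE_space
  proof eventually_elim
    case (elim \<omega>)
    have "(LINT s:{..<0}|lborel. f s \<omega>) = (LINT s:{..0}|lborel. f s \<omega>)"
      unfolding set_lebesgue_integral_def
    proof (rule integral_cong_AE)
      show "(\<lambda>s. indicat_real {..<0} s *\<^sub>R f s \<omega>) \<in> borel_measurable lborel"
        "(\<lambda>s. indicat_real {..0} s *\<^sub>R f s \<omega>) \<in> borel_measurable lborel"
        using f[OF elim(4)] by measurable
      show "AE s in lborel. indicat_real {..<0} s *\<^sub>R f s \<omega> = indicat_real {..0} s *\<^sub>R f s \<omega>"
        using AE_lborel_singleton[of 0] by eventually_elim (auto simp: indicator_def)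
    qed
    thus ?case using elim by (simp add: cond_probability_def I_def)
  qed
  have bdV: "integrable M V"
    by (rule integrable_const_bound[where B = r]) (use V in auto)
  have iVI: "integrable M (\<lambda>\<omega>. V \<omega> * indicator I \<omega>)"
    using integrable_mult_indicator[OF I bdV] by (simp add: mult.commute)
  have "(\<integral>\<omega>. V \<omega> * indicator I \<omega> \<partial>M) = (\<integral>\<omega>. V \<omega> * real_cond_exp M F (indicator I) \<omega> \<partial>M)"
    by (rule S.real_cond_exp_intg(2)[symmetric]) (use iVI VF in auto)
  also have "\<dots> = (\<integral>\<omega>. V \<omega> * \<tau> \<partial>M)"
    using tau by (intro integral_cong_AE) auto
  finally have score: "(\<integral>\<omega>. V \<omega> * (\<tau> - indicator I \<omega>) \<partial>M) = 0"
    using bdV iVI by (simp add: right_diff_distrib)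
  have iscore: "integrable M (\<lambda>\<omega>. V \<omega> * (\<tau> - indicator I \<omega>))"
    using bdV iVI by (simp add: right_diff_distrib)
  \<comment> \<open>the remainder in Knight's identity, split by the sign of \<open>V\<close>\<close>
  define g where "g \<omega> = (if 0 < e \<omega> \<and> e \<omega> \<le> V \<omega> then V \<omega> - e \<omega> else 0)" for \<omega>
  define h where "h \<omega> = (if V \<omega> < e \<omega> \<and> e \<omega> \<le> 0 then e \<omega> - V \<omega> else 0)" for \<omega>
  have [measurable]: "g \<in> borel_measurable M" "h \<in> borel_measurable M"
    unfolding g_def h_def by measurable
  have g: "0 \<le> g \<omega>" "\<omega> \<in> space M \<Longrightarrow> g \<omega> \<le> r" and h: "0 \<le> h \<omega>" "\<omega> \<in> space M \<Longrightarrow> h \<omega> \<le> r" for \<omega>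
    using V[of \<omega>] by (auto simp: g_def h_def)
  have igh: "integrable M g" "integrable M h"
    by (rule integrable_const_bound[where B = r]; use g h in auto)+
  have split: "check_loss \<tau> (e \<omega> - V \<omega>) - check_loss \<tau> (e \<omega>) =
      g \<omega> + h \<omega> - V \<omega> * (\<tau> - indicator I \<omega>)" if "\<omega> \<in> space M" for \<omega>
    using that by (auto simp: check_loss_diff g_def h_def I_def indicator_def)
  have "expectation (\<lambda>\<omega>. check_loss \<tau> (e \<omega> - V \<omega>) - check_loss \<tau> (e \<omega>)) =
      expectation (\<lambda>\<omega>. g \<omega> + h \<omega> - V \<omega> * (\<tau> - indicator I \<omega>))"
    by (intro Bochner_Integration.integral_cong split refl)
  also have "\<dots> = expectation g + expectation h"
    using igh iscore score by simp
  finally have E: "expectation (\<lambda>\<omega>. check_loss \<tau> (e \<omega> - V \<omega>) - check_loss \<tau> (e \<omega>)) = expectation g + expectation h" .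
  have Vmax: "norm ((max 0 (x \<omega>))\<^sup>2) \<le> r\<^sup>2" if "\<bar>x \<omega>\<bar> \<le> r" for x :: "'a \<Rightarrow> real" and \<omega>
    unfolding real_norm_def abs_power2 using that by (intro power_mono) auto
  have iV: "integrable M (\<lambda>\<omega>. c / 2 * (max 0 (V \<omega>))\<^sup>2)" "integrable M (\<lambda>\<omega>. c / 2 * (max 0 (- V \<omega>))\<^sup>2)"
  proof -
    have "integrable M (\<lambda>\<omega>. (max 0 (V \<omega>))\<^sup>2)"
      by (rule integrable_const_bound[where B = "r\<^sup>2"]) (use V in \<open>auto intro!: AE_I2 Vmax[of V] simp del: real_norm_def\<close>)
    moreover have "integrable M (\<lambda>\<omega>. (max 0 (- V \<omega>))\<^sup>2)"
      by (rule integrable_const_bound[where B = "r\<^sup>2"]) (use V in \<open>auto intro!: AE_I2 Vmax[of "\<lambda>\<omega>. - V \<omega>"] simp del: real_norm_def\<close>)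
    ultimately show "integrable M (\<lambda>\<omega>. c / 2 * (max 0 (V \<omega>))\<^sup>2)" "integrable M (\<lambda>\<omega>. c / 2 * (max 0 (- V \<omega>))\<^sup>2)"
      by auto
  qed
  have "ennreal (\<integral>\<omega>. c / 2 * (max 0 (V \<omega>))\<^sup>2 \<partial>M) \<le> ennreal (expectation g)"
  proof -
    have "ennreal (\<integral>\<omega>. c / 2 * (max 0 (V \<omega>))\<^sup>2 \<partial>M) = (\<integral>\<^sup>+\<omega>. ennreal (c / 2 * (max 0 (V \<omega>))\<^sup>2) \<partial>M)"
      using iV c by (intro nn_integral_eq_integral[symmetric]) auto
    also have "\<dots> \<le> (\<integral>\<^sup>+\<omega>. emeasure lborel {s. 0 \<le> s \<and> s < V \<omega> \<and> (0 < e \<omega> \<and> e \<omega> \<le> s)} \<partial>M)"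
    proof (rule layered_lower_bound[where r = r])
      fix s assume s: "0 \<le> s" "s < r"
      have "{\<omega> \<in> space M. s < V \<omega>} \<in> sets F"
        using VF spF by (metis (no_types, lifting) borel_measurable_iff_greater Collect_cong)
      moreover have "{0<..s} \<subseteq> {- r..r}" using s by (intro subsetI) auto
      ultimately
      have "c * s * prob {\<omega> \<in> space M. s < V \<omega>} \<le> prob ({\<omega> \<in> space M. s < V \<omega>} \<inter> {\<omega> \<in> space M. e \<omega> \<in> {0<..s}})"
        using s by (intro mass) auto
      also have "{\<omega> \<in> space M. s < V \<omega>} \<inter> {\<omega> \<in> space M. e \<omega> \<in> {0<..s}} = {\<omega> \<in> space M. s < V \<omega> \<and> (0 < e \<omega> \<and> e \<omega> \<le> s)}"
        by auto
      finally show "c * s * prob {\<omega> \<in> space M. s < V \<omega>} \<le> prob {\<omega> \<in> space M. s < V \<omega> \<and> (0 < e \<omega> \<and> e \<omega> \<le> s)}" .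
    qed (use V c in \<open>auto simp: abs_le_iff\<close>)
    also have "\<dots> = (\<integral>\<^sup>+\<omega>. ennreal (g \<omega>) \<partial>M)"
    proof (rule nn_integral_cong)
      fix \<omega>
      have "{s. 0 \<le> s \<and> s < V \<omega> \<and> (0 < e \<omega> \<and> e \<omega> \<le> s)} = (if 0 < e \<omega> \<and> e \<omega> \<le> V \<omega> then {e \<omega>..<V \<omega>} else {})"
        by auto
      thus "emeasure lborel {s. 0 \<le> s \<and> s < V \<omega> \<and> (0 < e \<omega> \<and> e \<omega> \<le> s)} = ennreal (g \<omega>)"
        by (simp add: g_def)
    qed
    also have "\<dots> = ennreal (expectation g)"
      using igh g by (intro nn_integral_eq_integral) auto
    finally show ?thesis .
  qed
  hence 1: "(\<integral>\<omega>. c / 2 * (max 0 (V \<omega>))\<^sup>2 \<partial>M) \<le> expectation g"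
    using g by (subst (asm) ennreal_le_iff) (auto intro: integral_nonneg_AE)
  have "ennreal (\<integral>\<omega>. c / 2 * (max 0 (- V \<omega>))\<^sup>2 \<partial>M) \<le> ennreal (expectation h)"
  proof -
    have "ennreal (\<integral>\<omega>. c / 2 * (max 0 (- V \<omega>))\<^sup>2 \<partial>M) = (\<integral>\<^sup>+\<omega>. ennreal (c / 2 * (max 0 (- V \<omega>))\<^sup>2) \<partial>M)"
      using iV c by (intro nn_integral_eq_integral[symmetric]) auto
    also have "\<dots> \<le> (\<integral>\<^sup>+\<omega>. emeasure lborel {s. 0 \<le> s \<and> s < - V \<omega> \<and> (- s < e \<omega> \<and> e \<omega> \<le> 0)} \<partial>M)"
    proof (rule layered_lower_bound[where r = r])
      fix s assume s: "0 \<le> s" "s < r"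
      have "{\<omega> \<in> space M. V \<omega> < - s} \<in> sets F"
        using VF spF by (metis (no_types, lifting) borel_measurable_iff_less Collect_cong)
      moreover have "{\<omega> \<in> space M. V \<omega> < - s} = {\<omega> \<in> space M. s < - V \<omega>}" by auto
      ultimately have "{\<omega> \<in> space M. s < - V \<omega>} \<in> sets F" by simp
      moreover have "{- s<..0} \<subseteq> {- r..r}" using s by (intro subsetI) auto
      ultimately
      have "c * s * prob {\<omega> \<in> space M. s < - V \<omega>} \<le> prob ({\<omega> \<in> space M. s < - V \<omega>} \<inter> {\<omega> \<in> space M. e \<omega> \<in> {- s<..0}})"
        using s by (intro mass) auto
      also have "{\<omega> \<in> space M. s < - V \<omega>} \<inter> {\<omega> \<in> space M. e \<omega> \<in> {- s<..0}} = {\<omega> \<in> space M. s < - V \<omega> \<and> (- s < e \<omega> \<and> e \<omega> \<le> 0)}"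
        by auto
      finally show "c * s * prob {\<omega> \<in> space M. s < - V \<omega>} \<le> prob {\<omega> \<in> space M. s < - V \<omega> \<and> (- s < e \<omega> \<and> e \<omega> \<le> 0)}" .
    qed (use V c in \<open>auto simp: abs_le_iff\<close>)
    also have "\<dots> = (\<integral>\<^sup>+\<omega>. ennreal (h \<omega>) \<partial>M)"
    proof (rule nn_integral_cong)
      fix \<omega>
      have "{s. 0 \<le> s \<and> s < - V \<omega> \<and> (- s < e \<omega> \<and> e \<omega> \<le> 0)} = (if V \<omega> < e \<omega> \<and> e \<omega> \<le> 0 then {- e \<omega><..<- V \<omega>} else {})"
        by auto
      thus "emeasure lborel {s. 0 \<le> s \<and> s < - V \<omega> \<and> (- s < e \<omega> \<and> e \<omega> \<le> 0)} = ennreal (h \<omega>)"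
        by (simp add: h_def)
    qed
    also have "\<dots> = ennreal (expectation h)"
      using igh h by (intro nn_integral_eq_integral) auto
    finally show ?thesis .
  qed
  hence 2: "(\<integral>\<omega>. c / 2 * (max 0 (- V \<omega>))\<^sup>2 \<partial>M) \<le> expectation h"
    using h by (subst (asm) ennreal_le_iff) (auto intro: integral_nonneg_AE)
  have "c / 2 * expectation (\<lambda>\<omega>. (V \<omega>)\<^sup>2) = (\<integral>\<omega>. c / 2 * (max 0 (V \<omega>))\<^sup>2 + c / 2 * (max 0 (- V \<omega>))\<^sup>2 \<partial>M)"
    by (subst Bochner_Integration.integral_mult_right_zero[symmetric], rule Bochner_Integration.integral_cong) (auto simp: max_def)
  also have "\<dots> = (\<integral>\<omega>. c / 2 * (max 0 (V \<omega>))\<^sup>2 \<partial>M) + (\<integral>\<omega>. c / 2 * (max 0 (- V \<omega>))\<^sup>2 \<partial>M)"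
    using iV by simp
  also note add_mono[OF 1 2]
  finally show ?thesis using E by simp
qed

section \<open>Square-integrable functions and orthonormal series\<close>

definition square_integrable :: "'a measure \<Rightarrow> ('a \<Rightarrow> real) \<Rightarrow> bool" where
  "square_integrable M f \<longleftrightarrow> f \<in> borel_measurable M \<and> integrable M (\<lambda>x. (f x)\<^sup>2)"

definition L2_norm :: "'a measure \<Rightarrow> ('a \<Rightarrow> real) \<Rightarrow> real" where
  "L2_norm M f = sqrt (\<integral>x. (f x)\<^sup>2 \<partial>M)"

lemma L2_norm_nonneg [simp]: "0 \<le> L2_norm M f"
  by (simp add: L2_norm_def)

lemma L2_norm_power2: "(L2_norm M f)\<^sup>2 = (\<integral>x. (f x)\<^sup>2 \<partial>M)"
  by (simp add: L2_norm_def)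

lemma square_integrable_measurable [measurable_dest]:
  "square_integrable M f \<Longrightarrow> f \<in> borel_measurable M"
  by (simp add: square_integrable_def)

lemma integrable_mult_square_integrable:
  assumes "square_integrable M f" "square_integrable M g"
  shows "integrable M (\<lambda>x. f x * g x)"
proof (rule Bochner_Integration.integrable_bound)
  show "integrable M (\<lambda>x. (f x)\<^sup>2 + (g x)\<^sup>2)"
    using assms by (simp add: square_integrable_def)
  show "(\<lambda>x. f x * g x) \<in> borel_measurable M"
    using assms by (auto simp: square_integrable_def)
  show "AE x in M. norm (f x * g x) \<le> norm ((f x)\<^sup>2 + (g x)\<^sup>2)"
  proof (rule AE_I2)
    fix x
    have "2 * \<bar>f x\<bar> * \<bar>g x\<bar> \<le> \<bar>f x\<bar>\<^sup>2 + \<bar>g x\<bar>\<^sup>2"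
      by (rule sum_squares_bound)
    moreover have "0 \<le> \<bar>f x\<bar> * \<bar>g x\<bar>" by simp
    ultimately have "\<bar>f x\<bar> * \<bar>g x\<bar> \<le> (f x)\<^sup>2 + (g x)\<^sup>2" unfolding power2_abs by linarith
    thus "norm (f x * g x) \<le> norm ((f x)\<^sup>2 + (g x)\<^sup>2)"
      by (simp add: abs_mult)
  qed
qed

lemma square_integrable_add:
  assumes "square_integrable M f" "square_integrable M g"
  shows "square_integrable M (\<lambda>x. f x + g x)"
  using assms integrable_mult_square_integrable[OF assms]
  by (auto simp: square_integrable_def power2_sum mult.assoc)

lemma square_integrable_cmult:
  "square_integrable M f \<Longrightarrow> square_integrable M (\<lambda>x. c * f x)"
  by (auto simp: square_integrable_def power_mult_distrib)

lemma square_integrable_diff: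
  assumes "square_integrable M f" "square_integrable M g"
  shows "square_integrable M (\<lambda>x. f x - g x)"
  using square_integrable_add[OF assms(1) square_integrable_cmult[OF assms(2), of "-1"]] by simp

lemma square_integrable_sum:
  assumes "\<And>i. i \<in> I \<Longrightarrow> square_integrable M (f i)"
  shows "square_integrable M (\<lambda>x. \<Sum>i\<in>I. f i x)"
  using assms
proof (induction I rule: infinite_finite_induct)
  case (insert i I)
  thus ?case by (auto intro: square_integrable_add)
qed (simp_all add: square_integrable_def)

lemma (in finite_measure) square_integrable_bounded:
  assumes "f \<in> borel_measurable M" "\<And>x. x \<in> space M \<Longrightarrow> \<bar>f x\<bar> \<le> B"
  shows "square_integrable M f"
  unfolding square_integrable_def
proof
  show "integrable M (\<lambda>x. (f x)\<^sup>2)"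
    by (rule integrable_const_bound[where B = "B\<^sup>2"])
       (use assms in \<open>auto intro!: AE_I2 order_trans[OF assms(2) abs_ge_self] simp: abs_le_square_iff[symmetric]\<close>)
qed fact

lemma Cauchy_Schwarz_integral:
  assumes "square_integrable M f" "square_integrable M g"
  shows "\<bar>\<integral>x. f x * g x \<partial>M\<bar> \<le> L2_norm M f * L2_norm M g"
proof -
  define a b c where "a = (\<integral>x. (f x)\<^sup>2 \<partial>M)" and "b = (\<integral>x. (g x)\<^sup>2 \<partial>M)" and "c = (\<integral>x. f x * g x \<partial>M)"
  have int: "integrable M (\<lambda>x. (f x)\<^sup>2)" "integrable M (\<lambda>x. (g x)\<^sup>2)" "integrable M (\<lambda>x. f x * g x)"
    using assms integrable_mult_square_integrable[OF assms] by (auto simp: square_integrable_def)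
  have q: "0 \<le> a + 2 * t * c + t\<^sup>2 * b" for t
  proof -
    have "0 \<le> (\<integral>x. (f x + t * g x)\<^sup>2 \<partial>M)" by simp
    also have "\<dots> = (\<integral>x. (f x)\<^sup>2 + 2 * t * (f x * g x) + t\<^sup>2 * (g x)\<^sup>2 \<partial>M)"
      by (intro Bochner_Integration.integral_cong) (auto simp: power2_sum power_mult_distrib algebra_simps)
    also have "\<dots> = a + 2 * t * c + t\<^sup>2 * b"
      using int by (simp add: a_def b_def c_def)
    finally show ?thesis .
  qed
  have b: "0 \<le> b" by (simp add: b_def)
  have "c\<^sup>2 \<le> a * b"
  proof (cases "b = 0")
    case True
    have "c = 0"
    proof (rule ccontr)
      assume "c \<noteq> 0"
      have "0 \<le> a + 2 * (- (a + 1) / (2 * c)) * c" using q[of "- (a + 1) / (2 * c)"] True by simp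
      also have "\<dots> = -1" using \<open>c \<noteq> 0\<close> by (simp add: field_simps)
      finally show False by simp
    qed
    thus ?thesis using True by simp
  next
    case False
    have "0 \<le> (a + 2 * (- c / b) * c + (- c / b)\<^sup>2 * b) * b"
      using q[of "- c / b"] b by (intro mult_nonneg_nonneg)
    also have "\<dots> = a * b - c\<^sup>2" using False by (simp add: field_simps power2_eq_square)
    finally show ?thesis by simp
  qed
  hence "sqrt (c\<^sup>2) \<le> sqrt (a * b)" by (rule real_sqrt_le_mono)
  thus ?thesis by (simp add: L2_norm_def a_def b_def c_def real_sqrt_mult)
qed

lemma L2_norm_triangle:
  assumes "square_integrable M f" "square_integrable M g"
  shows "L2_norm M (\<lambda>x. f x + g x) \<le> L2_norm M f + L2_norm M g"
proof (rule power2_le_imp_le)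
  have int: "integrable M (\<lambda>x. (f x)\<^sup>2)" "integrable M (\<lambda>x. (g x)\<^sup>2)" "integrable M (\<lambda>x. f x * g x)"
    using assms integrable_mult_square_integrable[OF assms] by (auto simp: square_integrable_def)
  have "(L2_norm M (\<lambda>x. f x + g x))\<^sup>2 = (\<integral>x. (f x)\<^sup>2 + (g x)\<^sup>2 + 2 * (f x * g x) \<partial>M)"
    by (simp add: L2_norm_power2 power2_sum mult.assoc)
  also have "\<dots> = (L2_norm M f)\<^sup>2 + (L2_norm M g)\<^sup>2 + 2 * (\<integral>x. f x * g x \<partial>M)"
    using int by (simp add: L2_norm_power2)
  also have "\<dots> \<le> (L2_norm M f + L2_norm M g)\<^sup>2"
    using Cauchy_Schwarz_integral[OF assms] by (simp add: power2_sum)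
  finally show "(L2_norm M (\<lambda>x. f x + g x))\<^sup>2 \<le> (L2_norm M f + L2_norm M g)\<^sup>2" .
qed simp

lemma L2_norm_cmult: "L2_norm M (\<lambda>x. c * f x) = \<bar>c\<bar> * L2_norm M f"
  by (simp add: L2_norm_def power_mult_distrib real_sqrt_mult)

lemma (in finite_measure) L2_norm_bounded:
  assumes "f \<in> borel_measurable M" "\<And>x. x \<in> space M \<Longrightarrow> \<bar>f x\<bar> \<le> B" "0 \<le> B"
  shows "L2_norm M f \<le> B * sqrt (measure M (space M))"
proof -
  have "(\<integral>x. (f x)\<^sup>2 \<partial>M) \<le> (\<integral>x. B\<^sup>2 \<partial>M)"
    using square_integrable_bounded[OF assms(1,2)] assms
    by (intro integral_mono) (auto simp: square_integrable_def abs_le_square_iff[symmetric])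
  hence "L2_norm M f \<le> sqrt (measure M (space M) * B\<^sup>2)"
    unfolding L2_norm_def by (intro real_sqrt_le_mono) simp
  thus ?thesis using assms by (simp add: real_sqrt_mult mult.commute)
qed

subsection \<open>Orthonormal series\<close>

lemma orthonormal_sum_mult:
  fixes e :: "nat \<Rightarrow> 'a \<Rightarrow> real"
  assumes e: "\<And>j. square_integrable M (e j)"
    and orth: "\<And>j k. (\<integral>t. e j t * e k t \<partial>M) = (if j = k then 1 else 0)"
    and K: "finite K"
  shows "(\<integral>t. (\<Sum>j\<in>K. x j * e j t) * e k t \<partial>M) = (if k \<in> K then x k else 0)"
proof -
  have int: "integrable M (\<lambda>t. e j t * e k t)" for j k
    by (rule integrable_mult_square_integrable[OF e e])
  have "(\<integral>t. (\<Sum>j\<in>K. x j * e j t) * e k t \<partial>M) = (\<integral>t. (\<Sum>j\<in>K. x j * (e j t * e k t)) \<partial>M)"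
    by (simp add: sum_distrib_right mult.assoc)
  also have "\<dots> = (\<Sum>j\<in>K. x j * (\<integral>t. e j t * e k t \<partial>M))"
    using int by (simp add: Bochner_Integration.integral_sum)
  also have "\<dots> = (if k \<in> K then x k else 0)"
    using K by (simp add: orth if_distrib cong: if_cong)
  finally show ?thesis .
qed

lemma orthonormal_sum_square:
  fixes e :: "nat \<Rightarrow> 'a \<Rightarrow> real"
  assumes e: "\<And>j. square_integrable M (e j)"
    and orth: "\<And>j k. (\<integral>t. e j t * e k t \<partial>M) = (if j = k then 1 else 0)"
    and K: "finite K"
  shows "(\<integral>t. (\<Sum>j\<in>K. x j * e j t)\<^sup>2 \<partial>M) = (\<Sum>j\<in>K. (x j)\<^sup>2)"
proof -
  have P: "square_integrable M (\<lambda>t. \<Sum>j\<in>K. x j * e j t)"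
    by (intro square_integrable_sum square_integrable_cmult e)
  have "(\<integral>t. (\<Sum>j\<in>K. x j * e j t)\<^sup>2 \<partial>M) = (\<integral>t. (\<Sum>k\<in>K. x k * ((\<Sum>j\<in>K. x j * e j t) * e k t)) \<partial>M)"
    by (simp add: power2_eq_square sum_distrib_left sum_distrib_right mult_ac)
  also have "\<dots> = (\<Sum>k\<in>K. x k * (\<integral>t. (\<Sum>j\<in>K. x j * e j t) * e k t \<partial>M))"
    using integrable_mult_square_integrable[OF P e] by (simp add: Bochner_Integration.integral_sum)
  also have "\<dots> = (\<Sum>j\<in>K. (x j)\<^sup>2)"
    by (intro sum.cong refl) (simp add: orthonormal_sum_mult[OF e orth K] power2_eq_square)
  finally show ?thesis .
qed

text \<open>The series is assumed to converge pointwise; its partial sums are a Cauchy sequence in \<open>L\<^sup>2\<close> because the coefficients are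
  square-summable.  By Fatou's lemma the pointwise limit is also the limit in \<open>L\<^sup>2\<close>, so coefficients and norms pass to
  the limit.\<close>

lemma orthonormal_series:
  fixes e :: "nat \<Rightarrow> 'a \<Rightarrow> real" and x :: "nat \<Rightarrow> real"
  assumes e: "\<And>j. square_integrable M (e j)"
    and orth: "\<And>j k. (\<integral>t. e j t * e k t \<partial>M) = (if j = k then 1 else 0)"
    and x: "summable (\<lambda>j. (x j)\<^sup>2)"
    and S: "\<And>t. t \<in> space M \<Longrightarrow> (\<lambda>j. x j * e j t) sums S t"
  shows "square_integrable M S"
    and "(\<integral>t. S t * e k t \<partial>M) = x k"
    and "L2_norm M (\<lambda>t. \<Sum>j<m. x j * e j t) \<le> L2_norm M S"
proof -
  define P where "P m t = (\<Sum>j<m. x j * e j t)" for m t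
  have P: "square_integrable M (P m)" for m
    unfolding P_def by (intro square_integrable_sum square_integrable_cmult e)
  have lim: "(\<lambda>m. P m t) \<longlonglongrightarrow> S t" if "t \<in> space M" for t
    using S[OF that] by (simp add: sums_def P_def)
  have SM [measurable]: "S \<in> borel_measurable M"
    by (rule borel_measurable_LIMSEQ_real[OF lim]) (use P in \<open>auto simp: square_integrable_def\<close>)
  have [measurable]: "P m \<in> borel_measurable M" for m using P by (simp add: square_integrable_def)
  define r where "r m = (\<Sum>j. (x (j + m))\<^sup>2)" for m
  have r0: "r \<longlonglongrightarrow> 0"
    unfolding r_def using suminf_exist_split2[OF x] by simp
  have tail: "(\<integral>t. (P p t - P m t)\<^sup>2 \<partial>M) \<le> r m" if "m \<le> p" for m p
  proof -
    have "P p t - P m t = (\<Sum>j\<in>{m..<p}. x j * e j t)" for t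
      using that unfolding P_def lessThan_atLeast0 by (subst sum.atLeastLessThan_concat[of 0 m p, symmetric]) auto
    hence "(\<integral>t. (P p t - P m t)\<^sup>2 \<partial>M) = (\<Sum>j\<in>{m..<p}. (x j)\<^sup>2)"
      using orthonormal_sum_square[OF e orth, of "{m..<p}"] by simp
    also have "\<dots> = (\<Sum>j<p - m. (x (j + m))\<^sup>2)"
      using that by (intro sum.reindex_bij_witness[of _ "\<lambda>j. j + m" "\<lambda>j. j - m"]) auto
    also have "\<dots> \<le> r m"
      unfolding r_def using summable_ignore_initial_segment[OF x] by (intro sum_le_suminf) auto
    finally show ?thesis .
  qed
  \<comment> \<open>Fatou's lemma, applied to the squared distance of \<open>P m\<close> from the later partial sums\<close>
  have nn: "(\<integral>\<^sup>+t. ennreal ((S t - P m t)\<^sup>2) \<partial>M) \<le> ennreal (r m)" for m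
  proof -
    have "(\<integral>\<^sup>+t. ennreal ((S t - P m t)\<^sup>2) \<partial>M) = (\<integral>\<^sup>+t. liminf (\<lambda>p. ennreal ((P p t - P m t)\<^sup>2)) \<partial>M)"
    proof (rule nn_integral_cong)
      fix t assume t: "t \<in> space M"
      have "(\<lambda>p. ennreal ((P p t - P m t)\<^sup>2)) \<longlonglongrightarrow> ennreal ((S t - P m t)\<^sup>2)"
        by (intro tendsto_ennrealI tendsto_intros lim t)
      thus "ennreal ((S t - P m t)\<^sup>2) = liminf (\<lambda>p. ennreal ((P p t - P m t)\<^sup>2))"
        by (metis lim_imp_Liminf trivial_limit_sequentially)
    qed
    also have "\<dots> \<le> liminf (\<lambda>p. \<integral>\<^sup>+t. ennreal ((P p t - P m t)\<^sup>2) \<partial>M)"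
      by (rule nn_integral_liminf) measurable
    also have "\<dots> \<le> limsup (\<lambda>p. \<integral>\<^sup>+t. ennreal ((P p t - P m t)\<^sup>2) \<partial>M)"
      by (rule Liminf_le_Limsup) simp
    also have "\<dots> \<le> ennreal (r m)"
    proof (rule Limsup_bounded)
      show "\<forall>\<^sub>F p in sequentially. (\<integral>\<^sup>+t. ennreal ((P p t - P m t)\<^sup>2) \<partial>M) \<le> ennreal (r m)"
        using eventually_ge_at_top[of m]
      proof eventually_elim
        case (elim p)
        have "(\<integral>\<^sup>+t. ennreal ((P p t - P m t)\<^sup>2) \<partial>M) = ennreal (\<integral>t. (P p t - P m t)\<^sup>2 \<partial>M)"
          using square_integrable_diff[OF P P]
          by (intro nn_integral_eq_integral) (auto simp: square_integrable_def)
        thus ?case using tail[OF elim] by (simp add: ennreal_leI)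
      qed
    qed
    finally show ?thesis .
  qed
  have D: "square_integrable M (\<lambda>t. S t - P m t)" for m
    unfolding square_integrable_def
  proof
    show "integrable M (\<lambda>t. (S t - P m t)\<^sup>2)"
      by (rule integrableI_bounded) (use nn[of m] in \<open>auto simp: top_unique less_top[symmetric]\<close>)
  qed measurable
  have Sq: "square_integrable M S"
    using square_integrable_add[OF D[of 0] P[of 0]] by simp
  thus "square_integrable M S" .
  have r_nonneg: "0 \<le> r m" for m
    unfolding r_def using summable_ignore_initial_segment[OF x] by (intro suminf_nonneg) auto
  have Dr: "L2_norm M (\<lambda>t. S t - P m t) \<le> sqrt (r m)" for m
  proof -
    have "ennreal (\<integral>t. (S t - P m t)\<^sup>2 \<partial>M) \<le> ennreal (r m)"
      using nn[of m] D[of m] by (subst (asm) nn_integral_eq_integral) (auto simp: square_integrable_def)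
    thus ?thesis unfolding L2_norm_def using r_nonneg by (intro real_sqrt_le_mono) simp
  qed
  have coeff: "(\<integral>t. S t * e k t \<partial>M) = x k" for k
  proof -
    have bd: "\<bar>(\<integral>t. S t * e k t \<partial>M) - x k\<bar> \<le> sqrt (r m) * L2_norm M (e k)" if "k < m" for m
    proof -
      have "(\<integral>t. S t * e k t \<partial>M) - x k = (\<integral>t. S t * e k t \<partial>M) - (\<integral>t. P m t * e k t \<partial>M)"
        unfolding P_def using that by (subst orthonormal_sum_mult[OF e orth]) auto
      also have "\<dots> = (\<integral>t. (S t - P m t) * e k t \<partial>M)"
        using integrable_mult_square_integrable[OF Sq e] integrable_mult_square_integrable[OF P e]
        by (simp add: left_diff_distrib)
      also have "\<bar>\<dots>\<bar> \<le> L2_norm M (\<lambda>t. S t - P m t) * L2_norm M (e k)"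
        by (rule Cauchy_Schwarz_integral[OF D e])
      also have "\<dots> \<le> sqrt (r m) * L2_norm M (e k)"
        by (intro mult_right_mono Dr) simp
      finally show ?thesis .
    qed
    have "(\<lambda>m. sqrt (r m) * L2_norm M (e k)) \<longlonglongrightarrow> sqrt 0 * L2_norm M (e k)"
      by (intro tendsto_intros r0)
    hence "\<bar>(\<integral>t. S t * e k t \<partial>M) - x k\<bar> \<le> sqrt 0 * L2_norm M (e k)"
      by (rule LIMSEQ_le_const) (use bd in \<open>auto intro!: exI[of _ "Suc k"]\<close>)
    thus ?thesis by simp
  qed
  thus "(\<integral>t. S t * e k t \<partial>M) = x k" .
  show "L2_norm M (\<lambda>t. \<Sum>j<m. x j * e j t) \<le> L2_norm M S"
  proof -
    have "(\<integral>t. S t * P m t \<partial>M) = (\<integral>t. (\<Sum>j<m. x j * (S t * e j t)) \<partial>M)"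
      by (simp add: P_def sum_distrib_left mult_ac)
    also have "\<dots> = (\<Sum>j<m. x j * x j)"
      using integrable_mult_square_integrable[OF Sq e] by (simp add: Bochner_Integration.integral_sum coeff)
    finally have SP: "(\<integral>t. S t * P m t \<partial>M) = (\<Sum>j<m. (x j)\<^sup>2)" by (simp add: power2_eq_square)
    have PP: "(\<integral>t. (P m t)\<^sup>2 \<partial>M) = (\<Sum>j<m. (x j)\<^sup>2)"
      unfolding P_def by (rule orthonormal_sum_square[OF e orth]) auto
    have "0 \<le> (\<integral>t. (S t - P m t)\<^sup>2 \<partial>M)" by simp
    also have "\<dots> = (\<integral>t. (S t)\<^sup>2 + (P m t)\<^sup>2 - 2 * (S t * P m t) \<partial>M)"
      by (simp add: power2_diff mult.assoc)
    also have "\<dots> = (\<integral>t. (S t)\<^sup>2 \<partial>M) + (\<integral>t. (P m t)\<^sup>2 \<partial>M) - 2 * (\<integral>t. S t * P m t \<partial>M)"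
      using Sq P[of m] integrable_mult_square_integrable[OF Sq P[of m]] by (simp add: square_integrable_def)
    finally have "(\<integral>t. (P m t)\<^sup>2 \<partial>M) \<le> (\<integral>t. (S t)\<^sup>2 \<partial>M)" by (simp add: SP PP)
    thus ?thesis unfolding L2_norm_def P_def by (rule real_sqrt_le_mono)
  qed
qed

lemma set_integral_restrict: "T \<in> sets borel \<Longrightarrow> (LINT t:T|lborel. f t) = (\<integral>t. f t \<partial>restrict_space lborel T)"
  for f :: "real \<Rightarrow> real"
  by (subst integral_restrict_space) (auto simp: set_lebesgue_integral_def)

lemma L2_on_iff:
  assumes "T \<in> sets borel"
  shows "L2_on T f \<longleftrightarrow> square_integrable (restrict_space lborel T) f"
  using assms unfolding L2_on_def square_integrable_def set_borel_measurable_def set_integrable_def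
  by (subst borel_measurable_restrict_space_iff) (auto simp: integrable_restrict_space)

section \<open>Excess loss, uniformly over the weights\<close>

text \<open>Independence passes to variables that are determined by the original ones in the sense of generated
  sigma-algebras, without a common formula for them.  This suits the conditional quantiles, which are only known to be
  measurable with respect to \<open>sigma_traj\<close>.\<close>

lemma (in prob_space) indep_vars_vimage_algebra:
  assumes X: "indep_vars N X I"
    and Z: "\<And>i. i \<in> I \<Longrightarrow> Z i \<in> vimage_algebra (space M) (X i) (N i) \<rightarrow>\<^sub>M L i"
  shows "indep_vars L Z I"
proof -
  have XM: "X i \<in> M \<rightarrow>\<^sub>M N i" if "i \<in> I" for i
    using X that by (simp add: indep_vars_def)
  have sets: "sets (vimage_algebra (space M) (X i) (N i)) = {X i -` A \<inter> space M |A. A \<in> sets (N i)}"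
    if "i \<in> I" for i
    using XM[OF that] by (intro sets_vimage_algebra2) (auto dest: measurable_space)
  have ZM: "Z i \<in> M \<rightarrow>\<^sub>M L i" if "i \<in> I" for i
  proof (rule measurableI)
    show "Z i x \<in> space (L i)" if "x \<in> space M" for x
      using measurable_space[OF Z[OF \<open>i \<in> I\<close>]] that by simp
    fix A assume "A \<in> sets (L i)"
    from measurable_sets[OF Z[OF \<open>i \<in> I\<close>] this]
    show "Z i -` A \<inter> space M \<in> sets M"
      using XM[OF that] by (auto simp: sets[OF that])
  qed
  have "indep_sets (\<lambda>i. {Z i -` A \<inter> space M |A. A \<in> sets (L i)}) I"
  proof (rule indep_sets_mono_sets)
    show "indep_sets (\<lambda>i. {X i -` A \<inter> space M |A. A \<in> sets (N i)}) I"
      using X by (simp add: indep_vars_def2)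
    fix i assume i: "i \<in> I"
    show "{Z i -` A \<inter> space M |A. A \<in> sets (L i)} \<subseteq> {X i -` A \<inter> space M |A. A \<in> sets (N i)}"
      using measurable_sets[OF Z[OF i]] by (auto simp: sets[OF i])
  qed
  thus ?thesis using ZM by (simp add: indep_vars_def2)
qed

lemma chaining_constant_exists:
  assumes "0 < (e::real)"
  shows "\<exists>A>0. exp (2 - A\<^sup>2 / 2) \<le> 1 / 2 \<and> 4 * exp (2 - A\<^sup>2 / 2) \<le> e"
proof -
  define m where "m = min (1 / 2) (e / 4)"
  have m: "0 < m" "m \<le> 1 / 2" "4 * m \<le> e" using assms by (auto simp: m_def)
  have "ln m \<le> 0" using m by simp
  hence pos: "0 < 2 * (2 - ln m)" by simp
  hence "(sqrt (2 * (2 - ln m)))\<^sup>2 = 2 * (2 - ln m)" by (intro real_sqrt_pow2) simp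
  hence "exp (2 - (sqrt (2 * (2 - ln m)))\<^sup>2 / 2) = exp (ln m)" by (simp only:) (simp add: field_simps)
  also have "\<dots> = m" using m by simp
  finally have "exp (2 - (sqrt (2 * (2 - ln m)))\<^sup>2 / 2) = m" "sqrt (2 * (2 - ln m)) > 0"
    using pos by simp_all
  thus ?thesis using m by (intro exI[of _ "sqrt (2 * (2 - ln m))"]) auto
qed

context flqr_model
begin

definition sigma_pair :: "nat \<Rightarrow> 'a measure" where
  "sigma_pair i = vimage_algebra (space (prb D)) (\<lambda>\<omega>. (resp D i \<omega>, traj D i \<omega>)) (borel \<Otimes>\<^sub>M path_space (tdom D))"

lemma resp_measurable [measurable]: "resp D i \<in> borel_measurable (prb D)"
  using measurable_compose[OF sample_rv measurable_fst] by simp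

lemma traj_path [measurable]: "traj D i \<in> prb D \<rightarrow>\<^sub>M path_space (tdom D)"
  using measurable_compose[OF sample_rv measurable_snd] by simp

lemma space_sigma [simp]: "space (sigma_traj D i) = space (prb D)" "space (sigma_pair i) = space (prb D)"
  by (simp_all add: sigma_traj_def sigma_pair_def)

lemma traj_sigma_traj: "traj D i \<in> sigma_traj D i \<rightarrow>\<^sub>M path_space (tdom D)"
  unfolding sigma_traj_def
  by (rule measurable_vimage_algebra1) (use measurable_space[OF traj_path] in auto)

lemma pair_sigma_pair: "(\<lambda>\<omega>. (resp D i \<omega>, traj D i \<omega>)) \<in> sigma_pair i \<rightarrow>\<^sub>M borel \<Otimes>\<^sub>M path_space (tdom D)"
  unfolding sigma_pair_def
  by (rule measurable_vimage_algebra1) (use measurable_space[OF sample_rv] in auto)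

lemma resp_sigma_pair: "resp D i \<in> borel_measurable (sigma_pair i)"
  using measurable_compose[OF pair_sigma_pair measurable_fst] by simp

lemma sets_sigma_traj: "sets (sigma_traj D i) = {traj D i -` A \<inter> space (prb D) |A. A \<in> sets (path_space (tdom D))}"
  unfolding sigma_traj_def
  by (rule sets_vimage_algebra2) (use measurable_space[OF traj_path] in auto)

lemma subalgebra_sigma_traj: "subalgebra (prb D) (sigma_traj D i)" "subalgebra (sigma_pair i) (sigma_traj D i)"
  using measurable_sets[OF traj_path] measurable_sets[OF measurable_compose[OF pair_sigma_pair measurable_snd]]
  by (auto simp: subalgebra_def sets_sigma_traj)

lemma Qtrue_sigma_traj: "Qtrue D i \<in> borel_measurable (sigma_traj D i)"
  using quantile by (simp add: cond_quantile_def)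

lemma Qtrue_measurable [measurable]: "Qtrue D i \<in> borel_measurable (prb D)"
  using measurable_from_subalg[OF subalgebra_sigma_traj(1) Qtrue_sigma_traj] .

lemma resid_measurable [measurable]: "resid D i \<in> borel_measurable (prb D)"
  unfolding resid_def by measurable

text \<open>The quadratic lower bound for the expectation is subtracted before the deviation bound is applied.  The difference is
  still Lipschitz in the weights, because the errors of the limit fits are bounded by \<open>\<rho>\<close>; so a single uniform
  deviation bound transfers the curvature to the sample, and \<open>V\<^sup>2\<close> appears as a sample mean.\<close>

lemma excess_loss_lower_bound:
  assumes functional: "functional_condition D as bs Xs qs"
    and bias: "bias_condition D as bs Xs \<rho>"
    and dens_bd: "\<And>i. 1 \<le> i \<Longrightarrow> AE \<omega> in prb D. \<forall>s. \<bar>s\<bar> \<le> \<rho> \<longrightarrow>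
        Cl \<le> dens D s (traj D i \<omega>) \<and> dens D s (traj D i \<omega>) \<le> Cu"
    and Cl: "0 < Cl" and e: "0 < e"
  shows "\<exists>C>0. \<forall>n. \<forall>S\<subseteq>{1..n}. S \<noteq> {} \<longrightarrow> cand D n \<noteq> {} \<longrightarrow>
    likely (prb D) e (\<lambda>\<omega>. \<forall>w\<in>weights D n.
       Cl / 2 * (\<Sum>i\<in>S. (\<Sum>J\<in>cand D n. w J * (Qlim D as bs Xs J i \<omega> - Qtrue D i \<omega>))\<^sup>2) -
         C * sqrt (real (card S) * real (card (cand D n)))
       \<le> (\<Sum>i\<in>S. check_loss (tau D) (resid D i \<omega> -
              (\<Sum>J\<in>cand D n. w J * (Qlim D as bs Xs J i \<omega> - Qtrue D i \<omega>))) -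
            check_loss (tau D) (resid D i \<omega>)))"
proof -
  have \<rho>: "0 < \<rho>" using bias by (simp add: bias_condition_def)
  obtain A where A: "0 < A" "exp (2 - A\<^sup>2 / 2) \<le> 1 / 2" "4 * exp (2 - A\<^sup>2 / 2) \<le> e"
    using chaining_constant_exists[OF e] by blast
  define L where "L = \<rho> * (1 + Cl * \<rho>)"
  have L: "0 < L" using \<rho> Cl by (simp add: L_def add_pos_pos)
  \<comment> \<open>almost surely \<open>Qlim - Qtrue\<close>; written through \<open>qs\<close> to depend on the trajectory only, and clamped to be bounded everywhere\<close>
  define dl where "dl J i \<omega> = max (- \<rho>) (min \<rho> (qs J (traj D i \<omega>) - Qtrue D i \<omega>))" for J i \<omega>
  have dl_bd: "\<bar>dl J i \<omega>\<bar> \<le> \<rho>" for J i \<omega> using \<rho> by (auto simp: dl_def)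
  show ?thesis
  proof (intro exI[of _ "8 * A * L"] conjI allI impI)
    show "0 < 8 * A * L" using A L by simp
    fix n and S :: "nat set"
    assume S: "S \<subseteq> {1..n}" "S \<noteq> {}" and C: "cand D n \<noteq> {}"
    let ?C = "cand D n"
    have finS: "finite S" using S finite_subset by blast
    have dl_F: "dl J i \<in> borel_measurable (sigma_traj D i)" if "J \<in> ?C" for J i
    proof -
      have "qs J \<in> borel_measurable (path_space (tdom D))"
        using functional that by (auto simp: functional_condition_def)
      hence [measurable]: "(\<lambda>\<omega>. qs J (traj D i \<omega>)) \<in> borel_measurable (sigma_traj D i)"
        by (rule measurable_compose[OF traj_sigma_traj])
      note Qtrue_sigma_traj[measurable]
      show ?thesis unfolding dl_def by measurable
    qed
    define V where "V i w \<omega> = (\<Sum>J\<in>?C. w J * dl J i \<omega>)" for i w \<omega>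
    have V_F: "V i w \<in> borel_measurable (sigma_traj D i)" for i w
      unfolding V_def using dl_F by (intro borel_measurable_sum borel_measurable_times) auto
    have V_pair [measurable]: "V i w \<in> borel_measurable (sigma_pair i)" for i w
      by (rule measurable_from_subalg[OF subalgebra_sigma_traj(2) V_F])
    have V_M [measurable]: "V i w \<in> borel_measurable (prb D)" for i w
      by (rule measurable_from_subalg[OF subalgebra_sigma_traj(1) V_F])
    have V_lip: "\<bar>V i w \<omega> - V i v \<omega>\<bar> \<le> \<rho> * (\<Sum>J\<in>?C. \<bar>w J - v J\<bar>)" for i w v \<omega>
    proof -
      have "\<bar>V i w \<omega> - V i v \<omega>\<bar> = \<bar>\<Sum>J\<in>?C. (w J - v J) * dl J i \<omega>\<bar>"
        by (simp add: V_def sum_subtractf left_diff_distrib)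
      also have "\<dots> \<le> (\<Sum>J\<in>?C. \<bar>w J - v J\<bar> * \<rho>)"
        by (rule order_trans[OF sum_abs], rule sum_mono)
           (auto simp: abs_mult intro!: mult_left_mono dl_bd)
      also have "\<dots> = \<rho> * (\<Sum>J\<in>?C. \<bar>w J - v J\<bar>)" by (simp add: sum_distrib_left mult.commute)
      finally show ?thesis .
    qed
    have V0: "V i (\<lambda>_. 0) \<omega> = 0" for i \<omega> by (simp add: V_def)
    have V_bd: "\<bar>V i w \<omega>\<bar> \<le> \<rho>" if "w \<in> subsimplex ?C" for i w \<omega>
    proof -
      have "(\<Sum>J\<in>?C. \<bar>w J\<bar>) \<le> 1"
        using that by (auto simp: subsimplex_def)
      hence "\<rho> * (\<Sum>J\<in>?C. \<bar>w J\<bar>) \<le> \<rho> * 1" using \<rho> by (intro mult_left_mono) auto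
      thus ?thesis using V_lip[of i w \<omega> "\<lambda>_. 0"] by (simp add: V0)
    qed
    define X where "X i w \<omega> = check_loss (tau D) (resid D i \<omega> - V i w \<omega>) - check_loss (tau D) (resid D i \<omega>)
        - Cl / 2 * (V i w \<omega>)\<^sup>2" for i w \<omega>
    have loss_bd: "\<bar>check_loss (tau D) (resid D i \<omega> - V i w \<omega>) - check_loss (tau D) (resid D i \<omega>)\<bar> \<le> \<bar>V i w \<omega>\<bar>"
      for i w \<omega>
      using check_loss_lipschitz[OF tau, of "resid D i \<omega> - V i w \<omega>" "resid D i \<omega>"] by simp
    have EX: "0 \<le> expectation (X i w)" if i: "i \<in> S" and w: "w \<in> subsimplex ?C" for i w
    proof -
      have "Cl / 2 * expectation (\<lambda>\<omega>. (V i w \<omega>)\<^sup>2) \<le>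
         expectation (\<lambda>\<omega>. check_loss (tau D) (resid D i \<omega> - V i w \<omega>) - check_loss (tau D) (resid D i \<omega>))"
      proof (rule quantile_loss_excess[OF subalgebra_sigma_traj(1) _ V_F, where r = \<rho> and f = "\<lambda>s \<omega>. dens D s (traj D i \<omega>)" and c' = Cu])
        show "AE \<omega> in prb D. cond_probability (prb D) (sigma_traj D i) (\<lambda>\<omega>. resid D i \<omega> < 0) \<omega> \<le> tau D \<and>
            tau D \<le> cond_probability (prb D) (sigma_traj D i) (\<lambda>\<omega>. resid D i \<omega> \<le> 0) \<omega>"
          using quantile[of i] by (simp add: cond_quantile_def resid_def)
        show "(\<lambda>s. dens D s (traj D i \<omega>)) \<in> borel_measurable borel" if "\<omega> \<in> space (prb D)" for \<omega>
          using measurable_compose[OF measurable_Pair2' dens_measurable, of "traj D i \<omega>"] measurable_space[OF traj_path that]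
          by simp
        show "AE \<omega> in prb D. \<forall>s. \<bar>s\<bar> \<le> \<rho> \<longrightarrow> Cl \<le> dens D s (traj D i \<omega>) \<and> dens D s (traj D i \<omega>) \<le> Cu"
          using dens_bd[of i] i S by auto
      qed (use Cl V_bd[OF w] dens in auto)
      moreover have "integrable (prb D) (\<lambda>\<omega>. (V i w \<omega>)\<^sup>2)"
      proof (rule integrable_const_bound[where B = "\<rho>\<^sup>2"])
        show "AE \<omega> in prb D. norm ((V i w \<omega>)\<^sup>2) \<le> \<rho>\<^sup>2"
          using V_bd[OF w] \<rho> by (intro AE_I2) (auto simp: abs_le_square_iff[symmetric])
      qed measurable
      moreover have "integrable (prb D) (\<lambda>\<omega>. check_loss (tau D) (resid D i \<omega> - V i w \<omega>) - check_loss (tau D) (resid D i \<omega>))"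
      proof (rule integrable_const_bound[where B = \<rho>])
        show "AE \<omega> in prb D. norm (check_loss (tau D) (resid D i \<omega> - V i w \<omega>) - check_loss (tau D) (resid D i \<omega>)) \<le> \<rho>"
          using order_trans[OF loss_bd V_bd[OF w]] by (intro AE_I2) auto
      qed measurable
      moreover have "expectation (X i w) = expectation (\<lambda>\<omega>. (check_loss (tau D) (resid D i \<omega> - V i w \<omega>) -
          check_loss (tau D) (resid D i \<omega>)) - Cl / 2 * (V i w \<omega>)\<^sup>2)"
        by (rule Bochner_Integration.integral_cong) (simp_all add: X_def)
      ultimately show ?thesis by simp
    qed
    have X_pair: "X i w \<in> borel_measurable (sigma_pair i)" for i w
    proof -
      note resp_sigma_pair[measurable] measurable_from_subalg[OF subalgebra_sigma_traj(2) Qtrue_sigma_traj, measurable]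
      show ?thesis unfolding X_def resid_def by measurable
    qed
    have "likely (prb D) e (\<lambda>\<omega>. \<forall>w\<in>subsimplex ?C.
        \<bar>\<Sum>i\<in>S. X i w \<omega> - expectation (X i w)\<bar> \<le> 8 * A * L * sqrt (real (card S) * real (card ?C)))"
    proof (rule subsimplex_process_deviation[OF finS S(2) cand_finite C L _ _ _ A])
      fix w v assume wv: "w \<in> subsimplex ?C" "v \<in> subsimplex ?C"
      show "indep_vars (\<lambda>_. borel) (\<lambda>i \<omega>. X i w \<omega> - X i v \<omega>) S"
      proof (rule indep_vars_vimage_algebra)
        show "indep_vars (\<lambda>_. borel \<Otimes>\<^sub>M path_space (tdom D)) (\<lambda>i \<omega>. (resp D i \<omega>, traj D i \<omega>)) S"
          using indep_vars_subset[OF sample_indep] by simp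
        show "(\<lambda>\<omega>. X i w \<omega> - X i v \<omega>) \<in> vimage_algebra (space (prb D)) (\<lambda>\<omega>. (resp D i \<omega>, traj D i \<omega>))
            (borel \<Otimes>\<^sub>M path_space (tdom D)) \<rightarrow>\<^sub>M borel" for i
          using borel_measurable_diff[OF X_pair X_pair] unfolding sigma_pair_def .
      qed
      fix i \<omega>
      have "\<bar>X i w \<omega> - X i v \<omega>\<bar> \<le> \<bar>V i w \<omega> - V i v \<omega>\<bar> * (1 + Cl * \<rho>)"
      proof -
        have "\<bar>check_loss (tau D) (resid D i \<omega> - V i w \<omega>) - check_loss (tau D) (resid D i \<omega> - V i v \<omega>)\<bar> \<le> \<bar>V i w \<omega> - V i v \<omega>\<bar>"
          using check_loss_lipschitz[OF tau, of "resid D i \<omega> - V i w \<omega>" "resid D i \<omega> - V i v \<omega>"] by (simp add: abs_minus_commute)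
        moreover have "\<bar>Cl / 2 * (V i w \<omega>)\<^sup>2 - Cl / 2 * (V i v \<omega>)\<^sup>2\<bar> \<le> \<bar>V i w \<omega> - V i v \<omega>\<bar> * (Cl * \<rho>)"
        proof -
          have "\<bar>Cl / 2 * (V i w \<omega>)\<^sup>2 - Cl / 2 * (V i v \<omega>)\<^sup>2\<bar> = \<bar>(V i w \<omega> - V i v \<omega>) * (Cl / 2 * (V i w \<omega> + V i v \<omega>))\<bar>"
            by (rule arg_cong[where f = abs]) (simp add: power2_eq_square field_simps)
          also have "\<dots> = \<bar>V i w \<omega> - V i v \<omega>\<bar> * (Cl / 2 * \<bar>V i w \<omega> + V i v \<omega>\<bar>)"
            using Cl by (simp add: abs_mult)
          also have "\<dots> \<le> \<bar>V i w \<omega> - V i v \<omega>\<bar> * (Cl / 2 * (2 * \<rho>))"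
            using Cl V_bd[OF wv(1), of i \<omega>] V_bd[OF wv(2), of i \<omega>] by (intro mult_left_mono) auto
          finally show ?thesis by simp
        qed
        moreover have "X i w \<omega> - X i v \<omega> =
            (check_loss (tau D) (resid D i \<omega> - V i w \<omega>) - check_loss (tau D) (resid D i \<omega> - V i v \<omega>)) -
            (Cl / 2 * (V i w \<omega>)\<^sup>2 - Cl / 2 * (V i v \<omega>)\<^sup>2)"
          by (simp add: X_def)
        ultimately show ?thesis
          unfolding distrib_left mult_1_right
          by (auto intro!: order_trans[OF abs_triangle_ineq4] add_mono)
      qed
      also have "\<dots> \<le> (\<rho> * (\<Sum>J\<in>?C. \<bar>w J - v J\<bar>)) * (1 + Cl * \<rho>)"
        using V_lip Cl \<rho> by (intro mult_right_mono) auto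
      finally show "\<bar>X i w \<omega> - X i v \<omega>\<bar> \<le> L * (\<Sum>J\<in>?C. \<bar>w J - v J\<bar>)"
        by (simp add: L_def mult_ac)
    qed (simp add: X_def V0)
    then obtain E where E: "E \<in> events" "prob E \<le> e" and dev:
      "\<And>\<omega> w. \<omega> \<in> space (prb D) - E \<Longrightarrow> w \<in> subsimplex ?C \<Longrightarrow>
        \<bar>\<Sum>i\<in>S. X i w \<omega> - expectation (X i w)\<bar> \<le> 8 * A * L * sqrt (real (card S) * real (card ?C))"
      unfolding likely_def by blast
    have "AE \<omega> in prb D. \<forall>i\<in>{0..n}. \<forall>J\<in>?C. \<bar>Qlim D as bs Xs J i \<omega> - Qtrue D i \<omega>\<bar> \<le> \<rho>"
      using bias by (auto simp: bias_condition_def)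
    moreover have "AE \<omega> in prb D. \<forall>i\<in>{0..n}. \<forall>J\<in>?C. Qlim D as bs Xs J i \<omega> = qs J (traj D i \<omega>)"
      using functional cand_finite[of n] by (auto simp: functional_condition_def intro!: AE_finite_allI)
    ultimately have "AE \<omega> in prb D. \<forall>i\<in>{0..n}. \<forall>J\<in>?C. dl J i \<omega> = Qlim D as bs Xs J i \<omega> - Qtrue D i \<omega>"
    proof eventually_elim
      case (elim \<omega>)
      show ?case
      proof (intro ballI)
        fix i J assume "i \<in> {0..n}" "J \<in> ?C"
        with elim have "\<bar>qs J (traj D i \<omega>) - Qtrue D i \<omega>\<bar> \<le> \<rho>" "Qlim D as bs Xs J i \<omega> = qs J (traj D i \<omega>)"
          by fastforce+
        thus "dl J i \<omega> = Qlim D as bs Xs J i \<omega> - Qtrue D i \<omega>" unfolding dl_def by linarith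
      qed
    qed
    then obtain N where N: "N \<in> null_sets (prb D)" and
      dl: "\<And>\<omega> i J. \<omega> \<in> space (prb D) - N \<Longrightarrow> i \<in> {0..n} \<Longrightarrow> J \<in> ?C \<Longrightarrow> dl J i \<omega> = Qlim D as bs Xs J i \<omega> - Qtrue D i \<omega>"
      by (auto elim!: AE_E3)
    show "likely (prb D) e (\<lambda>\<omega>. \<forall>w\<in>weights D n.
       Cl / 2 * (\<Sum>i\<in>S. (\<Sum>J\<in>?C. w J * (Qlim D as bs Xs J i \<omega> - Qtrue D i \<omega>))\<^sup>2) -
         8 * A * L * sqrt (real (card S) * real (card ?C))
       \<le> (\<Sum>i\<in>S. check_loss (tau D) (resid D i \<omega> -
              (\<Sum>J\<in>?C. w J * (Qlim D as bs Xs J i \<omega> - Qtrue D i \<omega>))) -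
            check_loss (tau D) (resid D i \<omega>)))"
      unfolding likely_def
    proof (intro bexI[of _ "E \<union> N"] conjI ballI)
      show "E \<union> N \<in> events" using E N by auto
      show "prob (E \<union> N) \<le> e" using E N by (simp add: measure_Un_null_set)
      fix \<omega> w assume \<omega>: "\<omega> \<in> space (prb D) - (E \<union> N)" and w: "w \<in> weights D n"
      have wC: "w \<in> subsimplex ?C" using w by (auto simp: weights_def subsimplex_def)
      have V: "V i w \<omega> = (\<Sum>J\<in>?C. w J * (Qlim D as bs Xs J i \<omega> - Qtrue D i \<omega>))" if "i \<in> S" for i
        unfolding V_def using dl[of \<omega> i] \<omega> that S by (intro sum.cong) auto
      have "0 \<le> (\<Sum>i\<in>S. expectation (X i w))" using EX wC by (intro sum_nonneg) auto
      hence "- (8 * A * L * sqrt (real (card S) * real (card ?C))) \<le> (\<Sum>i\<in>S. X i w \<omega>)"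
        using dev[of \<omega> w] \<omega> wC by (auto simp: sum_subtractf)
      also have "(\<Sum>i\<in>S. X i w \<omega>) = (\<Sum>i\<in>S. check_loss (tau D) (resid D i \<omega> - V i w \<omega>) - check_loss (tau D) (resid D i \<omega>))
          - Cl / 2 * (\<Sum>i\<in>S. (V i w \<omega>)\<^sup>2)"
        by (simp add: X_def sum_subtractf sum_distrib_left)
      finally show "Cl / 2 * (\<Sum>i\<in>S. (\<Sum>J\<in>?C. w J * (Qlim D as bs Xs J i \<omega> - Qtrue D i \<omega>))\<^sup>2) -
         8 * A * L * sqrt (real (card S) * real (card ?C))
       \<le> (\<Sum>i\<in>S. check_loss (tau D) (resid D i \<omega> -
              (\<Sum>J\<in>?C. w J * (Qlim D as bs Xs J i \<omega> - Qtrue D i \<omega>))) -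
            check_loss (tau D) (resid D i \<omega>))"
        by (simp add: V cong: sum.cong)
    qed
  qed
qed

end

section \<open>Population and fitted trajectories\<close>

text \<open>The scalar product in \<open>scorehat\<close> runs over the dimension of its second argument, so the dimension of the inverse
  decides which observations enter a score.\<close>

lemma mat_inverse_carrier:
  fixes A :: "'b :: field mat"
  assumes A: "A \<in> carrier_mat n n" and inv: "invertible_mat A"
  shows "the (mat_inverse A) \<in> carrier_mat n n"
proof -
  obtain B where AB: "A * B = 1\<^sub>m (dim_row A)" and BA: "B * A = 1\<^sub>m (dim_row B)"
    using inv by (auto simp: invertible_mat_def inverts_mat_def)
  have "dim_col (A * B) = dim_col (1\<^sub>m (dim_row A) :: 'b mat)" by (simp only: AB)
  moreover have "dim_col (B * A) = dim_col (1\<^sub>m (dim_row B) :: 'b mat)" by (simp only: BA)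
  ultimately have B: "B \<in> carrier_mat n n" using A by auto
  have "A \<in> Units (ring_mat TYPE('b) n ())"
    using A B AB BA by (auto simp: Units_def ring_mat_def)
  hence "mat_inverse A \<noteq> None" using mat_inverse(1)[OF A] by metis
  thus ?thesis using mat_inverse(2)[OF A] by auto
qed

(* Index sets keep the form {1..n} in which the estimators are written. *)
declare One_nat_def [simp del]

context flqr_model
begin

abbreviation Leb :: "real measure" where "Leb \<equiv> restrict_space lborel (tdom D)"

lemma tdom_borel [measurable, simp]: "tdom D \<in> sets borel"
  using tdom by auto

lemma space_Leb [simp]: "space Leb = tdom D"
  by (simp add: space_restrict_space)

lemma finite_measure_Leb: "finite_measure Leb"
proof
  obtain lo hi where "lo < hi" "tdom D = {lo..hi}" using tdom by blast
  thus "emeasure Leb (space Leb) \<noteq> \<infinity>"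
    by (simp add: emeasure_restrict_space)
qed

lemma measurable_Leb_iff: "f \<in> borel_measurable Leb \<longleftrightarrow> f \<in> borel_measurable (restrict_space borel (tdom D))"
  by (intro arg_cong[where f = "\<lambda>A. f \<in> A"] measurable_cong_sets) (simp_all add: sets_restrict_space)

lemma path_square_integrable: "\<omega> \<in> space (prb D) \<Longrightarrow> square_integrable Leb (traj D i \<omega>)"
proof -
  assume "\<omega> \<in> space (prb D)"
  hence "(resp D i \<omega>, traj D i \<omega>) \<in> space (borel \<Otimes>\<^sub>M path_space (tdom D))"
    using measurable_space[OF sample_rv] by blast
  hence "traj D i \<omega> \<in> space (path_space (tdom D))" by (simp add: space_pair_measure)
  thus ?thesis by (simp add: path_space_def space_measure_of_conv L2_on_iff)
qed

lemma measurable_section: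
  assumes "(\<lambda>(\<omega>, t). f \<omega> t) \<in> borel_measurable (prb D \<Otimes>\<^sub>M restrict_space borel (tdom D))" "\<omega> \<in> space (prb D)"
  shows "f \<omega> \<in> borel_measurable Leb"
  using measurable_compose[OF measurable_Pair1'[OF assms(2)] assms(1)] by (simp add: measurable_Leb_iff)

lemma mean_measurable: "mean_fun D \<in> borel_measurable Leb"
proof -
  have "(\<lambda>(t, \<omega>). traj D 0 \<omega> t) \<in> borel_measurable (restrict_space borel (tdom D) \<Otimes>\<^sub>M prb D)"
    using measurable_pair_swap[OF traj_measurable[of 0]] by (simp add: case_prod_beta)
  hence "(\<lambda>t. \<integral>\<omega>. traj D 0 \<omega> t \<partial>prb D) \<in> borel_measurable (restrict_space borel (tdom D))"
    by (intro borel_measurable_lebesgue_integral) simp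
  thus ?thesis unfolding measurable_Leb_iff mean_fun_def[abs_def] .
qed

text \<open>Nothing in the model bounds the mean function, but \<open>muhat\<close> is uniformly bounded and uniformly close to it
  with positive probability for some \<open>n\<close>; a single such outcome bounds this nonrandom function.  Without it the
  integral of \<open>slope * (traj - mean)\<close> could not be split over the eigenfunctions.\<close>

lemma mean_square_integrable:
  assumes "Op_unif (prb D) (\<lambda>n. tdom D) (\<lambda>n t \<omega>. muhat D n {1..n} \<omega> t - mean_fun D t) c"
    and "Op_unif (prb D) (\<lambda>_. tdom D) (\<lambda>n t \<omega>. muhat D n {1..n} \<omega> t) (\<lambda>_. 1)"
  shows "square_integrable Leb (mean_fun D)"
proof -
  interpret Leb: finite_measure Leb by (rule finite_measure_Leb)
  have "\<forall>\<^sub>F C in at_top.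
      (\<forall>\<^sub>F n in sequentially. likely (prb D) (1 / 4) (\<lambda>\<omega>. \<forall>t\<in>tdom D. \<bar>muhat D n {1..n} \<omega> t - mean_fun D t\<bar> \<le> C * c n)) \<and>
      (\<forall>\<^sub>F n in sequentially. likely (prb D) (1 / 4) (\<lambda>\<omega>. \<forall>t\<in>tdom D. \<bar>muhat D n {1..n} \<omega> t\<bar> \<le> C * 1))"
    using Op_unif_likely[OF assms(1), of "1 / 4"] Op_unif_likely[OF assms(2), of "1 / 4"]
    by (simp add: eventually_conj)
  then obtain C where "\<forall>\<^sub>F n in sequentially. likely (prb D) (1 / 4) (\<lambda>\<omega>. \<forall>t\<in>tdom D. \<bar>muhat D n {1..n} \<omega> t - mean_fun D t\<bar> \<le> C * c n)"
      "\<forall>\<^sub>F n in sequentially. likely (prb D) (1 / 4) (\<lambda>\<omega>. \<forall>t\<in>tdom D. \<bar>muhat D n {1..n} \<omega> t\<bar> \<le> C * 1)"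
    using eventually_happens'[OF trivial_limit_at_top_linorder] by blast
  hence "\<forall>\<^sub>F n in sequentially. likely (prb D) (1 / 4 + 1 / 4) (\<lambda>\<omega>. (\<forall>t\<in>tdom D. \<bar>muhat D n {1..n} \<omega> t - mean_fun D t\<bar> \<le> C * c n) \<and>
      (\<forall>t\<in>tdom D. \<bar>muhat D n {1..n} \<omega> t\<bar> \<le> C * 1))"
    by eventually_elim (rule likely_conj)
  then obtain n where "likely (prb D) (1 / 4 + 1 / 4) (\<lambda>\<omega>. (\<forall>t\<in>tdom D. \<bar>muhat D n {1..n} \<omega> t - mean_fun D t\<bar> \<le> C * c n) \<and>
      (\<forall>t\<in>tdom D. \<bar>muhat D n {1..n} \<omega> t\<bar> \<le> C * 1))"
    using eventually_happens'[OF sequentially_bot] by blast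
  from likely_witness[OF this] obtain \<omega> where "\<forall>t\<in>tdom D. \<bar>muhat D n {1..n} \<omega> t - mean_fun D t\<bar> \<le> C * c n"
      "\<forall>t\<in>tdom D. \<bar>muhat D n {1..n} \<omega> t\<bar> \<le> C * 1"
    by auto
  hence "\<bar>mean_fun D t\<bar> \<le> C + C * c n" if "t \<in> space Leb" for t
    using that by fastforce
  thus ?thesis by (intro Leb.square_integrable_bounded[OF mean_measurable])
qed

lemma slope_square_integrable: "square_integrable Leb (slope D)"
  using slope_L2 by (simp add: L2_on_iff)

lemma eigfun_square_integrable: "1 \<le> j \<Longrightarrow> square_integrable Leb (eigfun D j)"
  using eigfun_basis by (auto simp: orthonormal_basis_on_def orthonormal_on_def L2_on_iff)

text \<open>The slope of a true model lies in the span of the first \<open>J\<close> eigenfunctions, so truncating the trajectory after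
  \<open>J\<close> components does not change its inner product with the slope.\<close>

lemma Qlim_true_model:
  assumes mean: "square_integrable Leb (mean_fun D)" and \<omega>: "\<omega> \<in> space (prb D)"
    and true: "true_model D J"
    and as: "as J = icpt D" and bs: "AE t in lborel. t \<in> tdom D \<longrightarrow> bs J t = slope D t"
    and bs_sq: "square_integrable Leb (bs J)"
    and Xs: "\<And>t. t \<in> tdom D \<Longrightarrow> Xs i J \<omega> t = mean_fun D t + (\<Sum>j=1..J. score D i j \<omega> * eigfun D j t)"
  shows "Qlim D as bs Xs J i \<omega> = Qtrue D i \<omega>"
proof -
  let ?X = "\<lambda>t. traj D i \<omega> t - mean_fun D t"
  let ?b = "\<lambda>j. inner_on (tdom D) (slope D) (eigfun D j)"
  have X: "square_integrable Leb ?X"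
    by (intro square_integrable_diff path_square_integrable \<omega> mean)
  note sq = slope_square_integrable eigfun_square_integrable X
  have "(LINT t:tdom D|lborel. bs J t * (Xs i J \<omega> t - mean_fun D t)) =
      (\<integral>t. slope D t * (\<Sum>j=1..J. score D i j \<omega> * eigfun D j t) \<partial>Leb)"
    unfolding set_integral_restrict[OF tdom_borel]
  proof (rule integral_cong_AE)
    have [measurable]: "slope D \<in> borel_measurable Leb" "bs J \<in> borel_measurable Leb"
      using bs_sq slope_square_integrable by (auto simp: square_integrable_def)
    have S [measurable]: "(\<lambda>t. \<Sum>j=1..J. score D i j \<omega> * eigfun D j t) \<in> borel_measurable Leb"
      using eigfun_square_integrable by (intro borel_measurable_sum borel_measurable_times) (auto simp: square_integrable_def)
    show "(\<lambda>t. slope D t * (\<Sum>j=1..J. score D i j \<omega> * eigfun D j t)) \<in> borel_measurable Leb"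
      by measurable
    have "(\<lambda>t. bs J t * (\<Sum>j=1..J. score D i j \<omega> * eigfun D j t)) \<in> borel_measurable Leb" by measurable
    also have "?this \<longleftrightarrow> (\<lambda>t. bs J t * (Xs i J \<omega> t - mean_fun D t)) \<in> borel_measurable Leb"
      using Xs by (intro measurable_cong) auto
    finally show "(\<lambda>t. bs J t * (Xs i J \<omega> t - mean_fun D t)) \<in> borel_measurable Leb" .
    show "AE t in Leb. bs J t * (Xs i J \<omega> t - mean_fun D t) = slope D t * (\<Sum>j=1..J. score D i j \<omega> * eigfun D j t)"
      using bs Xs by (subst AE_restrict_space_iff) auto
  qed
  also have "\<dots> = (\<integral>t. (\<Sum>j=1..J. score D i j \<omega> * (slope D t * eigfun D j t)) \<partial>Leb)"
    by (simp add: sum_distrib_left mult_ac)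
  also have "\<dots> = (\<Sum>j=1..J. score D i j \<omega> * ?b j)"
    using integrable_mult_square_integrable[OF sq(1) sq(2)]
    by (simp add: Bochner_Integration.integral_sum inner_on_def set_integral_restrict)
  also have "\<dots> = (\<integral>t. (\<Sum>j=1..J. ?b j * (?X t * eigfun D j t)) \<partial>Leb)"
    using integrable_mult_square_integrable[OF sq(3) sq(2)]
    by (simp add: Bochner_Integration.integral_sum inner_on_def set_integral_restrict score_def mult.commute)
  also have "\<dots> = (LINT t:tdom D|lborel. slope D t * ?X t)"
    unfolding set_integral_restrict[OF tdom_borel]
  proof (rule integral_cong_AE)
    have [measurable]: "slope D \<in> borel_measurable Leb" "?X \<in> borel_measurable Leb"
      using X slope_square_integrable by (auto simp: square_integrable_def)
    show "(\<lambda>t. slope D t * ?X t) \<in> borel_measurable Leb" by measurable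
    show "(\<lambda>t. \<Sum>j=1..J. ?b j * (?X t * eigfun D j t)) \<in> borel_measurable Leb"
    proof (intro borel_measurable_sum borel_measurable_times)
      show "?X \<in> borel_measurable Leb" by fact
    qed (use eigfun_square_integrable in \<open>auto simp: square_integrable_def\<close>)
    have "AE t in Leb. slope D t = (\<Sum>j=1..J. ?b j * eigfun D j t)"
      using true by (subst AE_restrict_space_iff) (auto simp: true_model_def)
    thus "AE t in Leb. (\<Sum>j=1..J. ?b j * (?X t * eigfun D j t)) = slope D t * ?X t"
    proof eventually_elim
      case (elim t)
      show ?case by (subst elim) (simp add: sum_distrib_left sum_distrib_right mult_ac)
    qed
  qed
  finally show ?thesis by (simp add: Qlim_def Qtrue_def as)
qed

text \<open>A score is a finite linear combination, over the observation times \<open>s\<close> of the subject, of the numbers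
  \<open>\<kappa>\<^sub>j * \<phi>\<^sub>j s\<close>.  These are square-summable in \<open>j\<close> since \<open>\<kappa>\<^sub>j * (\<phi>\<^sub>j s)\<^sup>2\<close> sums to \<open>Ghat (s, s)\<close> and the
  eigenvalues are bounded by the first one.\<close>

lemma fitted_trajectory:
  assumes \<omega>: "\<omega> \<in> space (prb D)" and fit: "fpca_fit D n S \<omega>"
    and inv: "invertible_mat (Sigmahat D n S i \<omega>)"
  shows "\<And>j. square_integrable Leb (\<lambda>t. eigfunhat D n S (Suc j) \<omega> t)"
    and "\<And>j k. (\<integral>t. eigfunhat D n S (Suc j) \<omega> t * eigfunhat D n S (Suc k) \<omega> t \<partial>Leb) = (if j = k then 1 else 0)"
    and "summable (\<lambda>j. (scorehat D n S i (Suc j) \<omega>)\<^sup>2)"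
    and "\<And>t. t \<in> tdom D \<Longrightarrow> summable (\<lambda>j. scorehat D n S i (Suc j) \<omega> * eigfunhat D n S (Suc j) \<omega> t)"
proof -
  let ?\<phi> = "\<lambda>j. eigfunhat D n S (Suc j) \<omega>" and ?\<kappa> = "\<lambda>j. eigvalhat D n S (Suc j) \<omega>"
  have orth: "orthonormal_on (tdom D) (\<lambda>j. eigfunhat D n S j \<omega>)" using fit by (simp add: fpca_fit_def)
  show "square_integrable Leb (\<lambda>t. ?\<phi> j t)" for j
    using orth by (simp add: orthonormal_on_def L2_on_iff)
  show "(\<integral>t. ?\<phi> j t * ?\<phi> k t \<partial>Leb) = (if j = k then 1 else 0)" for j k
    using orth by (simp add: orthonormal_on_def inner_on_def set_integral_restrict)
  have \<kappa>: "0 \<le> ?\<kappa> j" "?\<kappa> (Suc j) \<le> ?\<kappa> j" for j using fit by (auto simp: fpca_fit_def)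
  have \<kappa>0: "?\<kappa> j \<le> ?\<kappa> 0" for j
    by (induction j) (use \<kappa>(2) order_trans in blast)+
  define s where "s l = tpt D n i (Suc l) \<omega>" for l
  have s: "s l \<in> tdom D" for l using tpt_in \<omega> by (simp add: s_def)
  define N where "N = nobs D n i"
  define v where "v = mult_mat_vec (the (mat_inverse (Sigmahat D n S i \<omega>)))
         (vec (nobs D n i) (\<lambda>l. uobs D n i (Suc l) \<omega> - muhat D n S \<omega> (tpt D n i (Suc l) \<omega>)))"
  have "the (mat_inverse (Sigmahat D n S i \<omega>)) \<in> carrier_mat N N"
    by (rule mat_inverse_carrier[OF _ inv]) (simp add: Sigmahat_def N_def)
  hence dv: "dim_vec v = N" by (simp add: v_def)
  have x: "scorehat D n S i (Suc j) \<omega> = (\<Sum>l<N. v $ l * (?\<kappa> j * ?\<phi> j (s l)))" for j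
  proof -
    have "scorehat D n S i (Suc j) \<omega> = ?\<kappa> j * (\<Sum>l<N. ?\<phi> j (s l) * v $ l)"
      unfolding scorehat_def v_def[symmetric] scalar_prod_def dv
      by (simp add: N_def s_def atLeast0LessThan)
    thus ?thesis by (simp add: sum_distrib_left mult_ac)
  qed
  have G: "(\<lambda>j. ?\<kappa> j * ?\<phi> j a * ?\<phi> j b) sums Ghat D n S \<omega> (a, b)" if "a \<in> tdom D" "b \<in> tdom D" for a b
    using fit that by (auto simp: fpca_fit_def)
  have sq: "summable (\<lambda>j. (?\<kappa> j * ?\<phi> j (s l))\<^sup>2)" for l
  proof (rule summable_comparison_test'[of "\<lambda>j. ?\<kappa> 0 * (?\<kappa> j * ?\<phi> j (s l) * ?\<phi> j (s l))" 0])
    show "summable (\<lambda>j. ?\<kappa> 0 * (?\<kappa> j * ?\<phi> j (s l) * ?\<phi> j (s l)))"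
      using sums_summable[OF G[OF s s]] by (rule summable_mult)
    show "norm ((?\<kappa> j * ?\<phi> j (s l))\<^sup>2) \<le> ?\<kappa> 0 * (?\<kappa> j * ?\<phi> j (s l) * ?\<phi> j (s l))" for j
    proof -
      have "?\<kappa> j * (?\<kappa> j * (?\<phi> j (s l))\<^sup>2) \<le> ?\<kappa> 0 * (?\<kappa> j * (?\<phi> j (s l))\<^sup>2)"
        using \<kappa>(1) by (intro mult_right_mono \<kappa>0) auto
      thus ?thesis unfolding real_norm_def abs_power2 by (simp add: power2_eq_square mult_ac)
    qed
  qed
  show "summable (\<lambda>j. (scorehat D n S i (Suc j) \<omega>)\<^sup>2)"
  proof (rule summable_comparison_test'[of "\<lambda>j. (\<Sum>l<N. (v $ l)\<^sup>2) * (\<Sum>l<N. (?\<kappa> j * ?\<phi> j (s l))\<^sup>2)" 0])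
    show "summable (\<lambda>j. (\<Sum>l<N. (v $ l)\<^sup>2) * (\<Sum>l<N. (?\<kappa> j * ?\<phi> j (s l))\<^sup>2))"
      by (intro summable_mult summable_sum sq)
    show "norm ((scorehat D n S i (Suc j) \<omega>)\<^sup>2) \<le> (\<Sum>l<N. (v $ l)\<^sup>2) * (\<Sum>l<N. (?\<kappa> j * ?\<phi> j (s l))\<^sup>2)" for j
      unfolding x by (simp add: Cauchy_Schwarz_ineq_sum)
  qed
  show "summable (\<lambda>j. scorehat D n S i (Suc j) \<omega> * ?\<phi> j t)" if "t \<in> tdom D" for t
  proof -
    have "summable (\<lambda>j. \<Sum>l<N. v $ l * (?\<kappa> j * ?\<phi> j (s l) * ?\<phi> j t))"
      by (intro summable_sum summable_mult sums_summable[OF G] s that)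
    thus ?thesis by (simp add: x sum_distrib_right mult.assoc)
  qed
qed

text \<open>The slope estimate of model \<open>J\<close> is spanned by the first \<open>J\<close> estimated eigenfunctions and hence orthogonal to the rest
  of the expansion of the trajectory.  This is why \<open>trajhat\<close>, which does not depend on the model, can replace
  \<open>trajhat_trunc\<close> in every prediction, as \<open>eigen_condition\<close> requires.\<close>

lemma fitted_trajectory_facts:
  assumes \<omega>: "\<omega> \<in> space (prb D)" and fit: "fpca_fit D n {1..n} \<omega>"
    and inv: "invertible_mat (Sigmahat D n {1..n} i \<omega>)"
  shows "square_integrable Leb (\<lambda>t. trajhat D n i \<omega> t - muhat D n {1..n} \<omega> t)"
    and "square_integrable Leb (\<lambda>t. trajhat_trunc D n i J \<omega> t - muhat D n {1..n} \<omega> t)"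
    and "L2_norm Leb (\<lambda>t. trajhat_trunc D n i J \<omega> t - muhat D n {1..n} \<omega> t) \<le>
         L2_norm Leb (\<lambda>t. trajhat D n i \<omega> t - muhat D n {1..n} \<omega> t)"
    and "square_integrable Leb (slopehat D n {1..n} J \<omega>)"
    and "Qhat D n {1..n} J i \<omega> = icpthat D n {1..n} J \<omega> +
           (\<integral>t. slopehat D n {1..n} J \<omega> t * (trajhat D n i \<omega> t - muhat D n {1..n} \<omega> t) \<partial>Leb)"
    and "Qhat D n {1..n} J i \<omega> = icpthat D n {1..n} J \<omega> +
           (\<integral>t. slopehat D n {1..n} J \<omega> t * (trajhat_trunc D n i J \<omega> t - muhat D n {1..n} \<omega> t) \<partial>Leb)"
proof -
  let ?e = "\<lambda>j. eigfunhat D n {1..n} (Suc j) \<omega>" and ?x = "\<lambda>j. scorehat D n {1..n} i (Suc j) \<omega>"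
  let ?S = "\<lambda>t. trajhat D n i \<omega> t - muhat D n {1..n} \<omega> t"
  let ?c = "\<lambda>j. coefhat D n {1..n} J \<omega> (Suc j)"
  note ft = fitted_trajectory[OF \<omega> fit inv]
  have sums: "(\<lambda>j. ?x j * ?e j t) sums ?S t" if "t \<in> space Leb" for t
    using summable_sums[OF ft(4), of t] that by (simp add: trajhat_def)
  note series = orthonormal_series[OF ft(1) ft(2) ft(3) sums]
  have shift: "(\<Sum>j=1..J. F j) = (\<Sum>j<J. F (Suc j))" for F :: "nat \<Rightarrow> real"
    by (intro sum.reindex_bij_witness[of _ Suc "\<lambda>j. j - 1"]) auto
  have trunc: "(\<lambda>t. trajhat_trunc D n i J \<omega> t - muhat D n {1..n} \<omega> t) = (\<lambda>t. \<Sum>j<J. ?x j * ?e j t)"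
    unfolding trajhat_trunc_def shift by simp
  have slope: "slopehat D n {1..n} J \<omega> = (\<lambda>t. \<Sum>j<J. ?c j * ?e j t)"
    unfolding slopehat_def[abs_def] shift ..
  show S: "square_integrable Leb ?S" by (rule series(1))
  show "square_integrable Leb (\<lambda>t. trajhat_trunc D n i J \<omega> t - muhat D n {1..n} \<omega> t)"
    unfolding trunc by (intro square_integrable_sum square_integrable_cmult ft)
  show "square_integrable Leb (slopehat D n {1..n} J \<omega>)"
    unfolding slope by (intro square_integrable_sum square_integrable_cmult ft)
  show "L2_norm Leb (\<lambda>t. trajhat_trunc D n i J \<omega> t - muhat D n {1..n} \<omega> t) \<le> L2_norm Leb ?S"
    unfolding trunc by (rule series(3))
  show Q: "Qhat D n {1..n} J i \<omega> = icpthat D n {1..n} J \<omega> +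
           (\<integral>t. slopehat D n {1..n} J \<omega> t * (trajhat_trunc D n i J \<omega> t - muhat D n {1..n} \<omega> t) \<partial>Leb)"
    by (simp add: Qhat_def set_integral_restrict)
  have P: "square_integrable Leb (\<lambda>t. \<Sum>j<J. ?x j * ?e j t)"
    by (intro square_integrable_sum square_integrable_cmult ft)
  have expand: "(\<Sum>k<J. ?c k * ?e k t) * p = (\<Sum>k<J. ?c k * (p * ?e k t))" for p t
    by (subst sum_distrib_right) (simp add: mult_ac)
  have "(\<integral>t. slopehat D n {1..n} J \<omega> t * ?S t \<partial>Leb) = (\<integral>t. (\<Sum>k<J. ?c k * (?S t * ?e k t)) \<partial>Leb)"
    unfolding slope expand ..
  also have "\<dots> = (\<Sum>k<J. ?c k * (\<integral>t. ?S t * ?e k t \<partial>Leb))"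
    using integrable_mult_square_integrable[OF S ft(1)] by (simp add: Bochner_Integration.integral_sum)
  also have "\<dots> = (\<Sum>k<J. ?c k * ?x k)"
    by (simp only: series(2))
  also have "\<dots> = (\<Sum>k<J. ?c k * (\<integral>t. (\<Sum>j<J. ?x j * ?e j t) * ?e k t \<partial>Leb))"
    by (intro sum.cong refl) (simp add: orthonormal_sum_mult[OF ft(1) ft(2)])
  also have "\<dots> = (\<integral>t. (\<Sum>k<J. ?c k * ((\<Sum>j<J. ?x j * ?e j t) * ?e k t)) \<partial>Leb)"
    using integrable_mult_square_integrable[OF P ft(1)] by (simp add: Bochner_Integration.integral_sum)
  also have "\<dots> = (\<integral>t. slopehat D n {1..n} J \<omega> t * (trajhat_trunc D n i J \<omega> t - muhat D n {1..n} \<omega> t) \<partial>Leb)"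
    unfolding slope expand fun_cong[OF trunc] ..
  finally show "Qhat D n {1..n} J i \<omega> = icpthat D n {1..n} J \<omega> +
           (\<integral>t. slopehat D n {1..n} J \<omega> t * ?S t \<partial>Leb)"
    using Q by simp
qed

end

section \<open>From the loss to the estimation error on a good outcome\<close>

lemma sum_blocks:
  fixes F :: "nat \<Rightarrow> real"
  shows "(\<Sum>k=1..K. \<Sum>m=1..M. F ((k - 1) * M + m)) = (\<Sum>i=1..K * M. F i)"
proof (induction K)
  case (Suc K)
  have "(\<Sum>i=1..Suc K * M. F i) = (\<Sum>i=1..K * M + M. F i)" by (simp add: add.commute)
  also have "\<dots> = (\<Sum>i=1..K * M. F i) + (\<Sum>i=K * M + 1..K * M + M. F i)"
    by (rule sum.ub_add_nat) simp
  also have "(\<Sum>i=K * M + 1..K * M + M. F i) = (\<Sum>m=1..M. F (K * M + m))"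
    by (intro sum.reindex_bij_witness[of _ "\<lambda>m. K * M + m" "\<lambda>i. i - K * M"]) auto
  finally show ?case using Suc by simp
qed simp

context flqr_model
begin

text \<open>The constants below depend on the model and on the common constant \<open>C\<close> of the stochastic orders, but neither on the
  sample size nor on the outcome: \<open>plugin_const\<close> and \<open>fit_const\<close> bound the distance of a prediction from its limit
  (before and after the norm of the limit slope has been bounded by \<open>slope_bound\<close>), and \<open>anchor_const\<close> the error of the
  estimated true model.\<close>

definition vol :: real where "vol = sqrt (measure Leb (tdom D))"

definition plugin_const :: "real \<Rightarrow> real" where
  "plugin_const C = C * (1 + 2 * C * vol * vol + 2 * vol)"

definition anchor_const :: "real \<Rightarrow> real" where
  "anchor_const C = C + sqrt C * (2 * C * vol)"

definition slope_bound :: "real \<Rightarrow> real \<Rightarrow> real \<Rightarrow> real" where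
  "slope_bound C lmin \<rho> = 2 * (L2_norm Leb (slope D) + C * vol +
     (\<rho> + anchor_const C + plugin_const C * (2 + L2_norm Leb (slope D))) / sqrt lmin)"

definition fit_const :: "real \<Rightarrow> real \<Rightarrow> real \<Rightarrow> real" where
  "fit_const C lmin \<rho> = plugin_const C * (1 + slope_bound C lmin \<rho>)"

lemma vol_nonneg [simp]: "0 \<le> vol" by (simp add: vol_def)

lemma weighted_average_le:
  assumes "w \<in> weights D n" "\<And>J. J \<in> cand D n \<Longrightarrow> \<bar>x J\<bar> \<le> B"
  shows "\<bar>\<Sum>J\<in>cand D n. w J * x J\<bar> \<le> B"
proof -
  have "\<bar>\<Sum>J\<in>cand D n. w J * x J\<bar> \<le> (\<Sum>J\<in>cand D n. w J * B)"
    using assms by (intro order_trans[OF sum_abs] sum_mono) (auto simp: weights_def abs_mult intro!: mult_left_mono)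
  also have "\<dots> = (\<Sum>J\<in>cand D n. w J) * B" by (simp add: sum_distrib_right)
  also have "\<dots> = B" using assms(1) by (simp add: weights_def)
  finally show ?thesis .
qed

lemma unit_weight: "J \<in> cand D n \<Longrightarrow> (\<lambda>J'. if J' = J then 1 else 0) \<in> weights D n"
  using cand_finite[of n] by (auto simp: weights_def)

end

text \<open>One sample size and one outcome at which all stochastic orders hold with the constant \<open>C\<close> and the almost sure
  statements are true; \<open>c\<close>, \<open>d\<close> and \<open>g\<close> are the values of the rates at that sample size.  Everything proved here is
  deterministic.  The assumption \<open>small\<close> allows \<open>slope_limit_bound\<close> to absorb the norm that it bounds.\<close>

locale good_sample = flqr_model D for D :: "'a flqr" +
  fixes as :: "nat \<Rightarrow> real" and bs :: "nat \<Rightarrow> real \<Rightarrow> real"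
    and Xs :: "nat \<Rightarrow> nat \<Rightarrow> 'a \<Rightarrow> real \<Rightarrow> real"
    and \<omega> :: 'a and n Jtrue :: nat and C c d g \<rho> lmin \<delta> :: real
  assumes outcome: "\<omega> \<in> space (prb D)" and n: "0 < n"
    and C: "0 < C" and rates: "0 \<le> c" "c \<le> 1" "0 \<le> d" "d \<le> 1" "0 \<le> g"
    and lmin: "0 < lmin" and \<delta>: "0 < \<delta>"
    and small: "c * plugin_const C \<le> sqrt lmin / 2"
    and Jtrue: "Jtrue \<in> cand D n"
    and limit_sq: "\<And>J. J \<in> cand D n \<Longrightarrow> square_integrable Leb (bs J)"
    and limit_meas: "\<And>i J. J \<in> cand D n \<Longrightarrow> Xs i J \<omega> \<in> borel_measurable Leb"
    and fit: "fpca_fit D n {1..n} \<omega>"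
    and inv: "\<And>i. i \<in> {1..n} \<Longrightarrow> invertible_mat (Sigmahat D n {1..n} i \<omega>)"
    and Qlim_Jtrue: "\<And>i. i \<in> {1..n} \<Longrightarrow> Qlim D as bs Xs Jtrue i \<omega> = Qtrue D i \<omega>"
    and slope_Jtrue: "AE t in lborel. t \<in> tdom D \<longrightarrow> bs Jtrue t = slope D t"
    and bias: "\<And>i J. i \<in> {1..n} \<Longrightarrow> J \<in> cand D n \<Longrightarrow> \<bar>Qlim D as bs Xs J i \<omega> - Qtrue D i \<omega>\<bar> \<le> \<rho>"
    and icpt_lim: "\<And>J. J \<in> cand D n \<Longrightarrow> \<bar>icpthat D n {1..n} J \<omega> - as J\<bar> \<le> C * c"
    and slope_lim: "\<And>J t. J \<in> cand D n \<Longrightarrow> t \<in> tdom D \<Longrightarrow> \<bar>slopehat D n {1..n} J \<omega> t - bs J t\<bar> \<le> C * c"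
    and mu_lim: "\<And>t. t \<in> tdom D \<Longrightarrow> \<bar>muhat D n {1..n} \<omega> t - mean_fun D t\<bar> \<le> C * c"
    and traj_lim: "\<And>i J t. i \<in> {1..n} \<Longrightarrow> J \<in> cand D n \<Longrightarrow> t \<in> tdom D \<Longrightarrow>
        \<bar>trajhat_trunc D n i J \<omega> t - Xs i J \<omega> t\<bar> \<le> C * c"
    and cv_lim: "\<And>w k m. w \<in> weights D n \<Longrightarrow> k \<in> {1..nfold D} \<Longrightarrow> m \<in> {1..fold_size D n} \<Longrightarrow>
        \<bar>Qavg D n {1..n} w ((k - 1) * fold_size D n + m) \<omega> -
         Qavg D n (train_set D n k) w ((k - 1) * fold_size D n + m) \<omega>\<bar> \<le> C * g"
    and traj_bd: "\<And>i t. i \<in> {1..n} \<Longrightarrow> t \<in> tdom D \<Longrightarrow> \<bar>trajhat D n i \<omega> t\<bar> \<le> C"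
    and mu_bd: "\<And>t. t \<in> tdom D \<Longrightarrow> \<bar>muhat D n {1..n} \<omega> t\<bar> \<le> C"
    and icpt_rate: "\<bar>icpthat D n {1..n} Jtrue \<omega> - icpt D\<bar> \<le> C * d"
    and slope_rate: "(LINT t:tdom D|lborel. (slopehat D n {1..n} Jtrue \<omega> t - slope D t)\<^sup>2) \<le> C * d\<^sup>2"
    and eigen: "\<And>w. w \<in> weights D n \<Longrightarrow> \<delta> * real n \<le> real (card {i \<in> {1..n}.
          (icptavg D n w \<omega> - icpt D +
            (LINT t:tdom D|lborel. (slopeavg D n w \<omega> t - slope D t) *
               (trajhat D n i \<omega> t - muhat D n {1..n} \<omega> t)))\<^sup>2
          \<ge> lmin * ((icptavg D n w \<omega> - icpt D)\<^sup>2 +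
                (LINT t:tdom D|lborel. (slopeavg D n w \<omega> t - slope D t)\<^sup>2))})"
begin

abbreviation Xc :: "nat \<Rightarrow> real \<Rightarrow> real" where
  "Xc i t \<equiv> trajhat D n i \<omega> t - muhat D n {1..n} \<omega> t"

abbreviation bhat :: "nat \<Rightarrow> real \<Rightarrow> real" where "bhat J \<equiv> slopehat D n {1..n} J \<omega>"

abbreviation Qh :: "nat \<Rightarrow> nat \<Rightarrow> real" where "Qh J i \<equiv> Qhat D n {1..n} J i \<omega>"

abbreviation Ql :: "nat \<Rightarrow> nat \<Rightarrow> real" where "Ql J i \<equiv> Qlim D as bs Xs J i \<omega>"

abbreviation contrast :: "(nat \<Rightarrow> real) \<Rightarrow> nat \<Rightarrow> real" where
  "contrast w i \<equiv> \<Sum>J\<in>cand D n. w J * (Ql J i - Qtrue D i \<omega>)"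

text \<open>How far the estimated true model is from the true coefficients, as seen by subject \<open>i\<close>.\<close>

definition anchor :: "nat \<Rightarrow> real" where
  "anchor i = icpthat D n {1..n} Jtrue \<omega> - icpt D + (\<integral>t. (bhat Jtrue t - slope D t) * Xc i t \<partial>Leb)"

text \<open>The quantity that is squared on the left of the inequality in \<open>eigen_condition\<close>.\<close>

definition fitted_contrast :: "(nat \<Rightarrow> real) \<Rightarrow> nat \<Rightarrow> real" where
  "fitted_contrast w i = icptavg D n w \<omega> - icpt D +
     (LINT t:tdom D|lborel. (slopeavg D n w \<omega> t - slope D t) * Xc i t)"

definition est_error :: "(nat \<Rightarrow> real) \<Rightarrow> real" where
  "est_error w = (icptavg D n w \<omega> - icpt D)\<^sup>2 + (LINT t:tdom D|lborel. (slopeavg D n w \<omega> t - slope D t)\<^sup>2)"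

lemmas traj_facts = fitted_trajectory_facts[OF outcome fit inv]

lemma Xc_norm: "i \<in> {1..n} \<Longrightarrow> L2_norm Leb (Xc i) \<le> 2 * C * vol"
proof -
  assume i: "i \<in> {1..n}"
  interpret Leb: finite_measure Leb by (rule finite_measure_Leb)
  have "L2_norm Leb (Xc i) \<le> (2 * C) * sqrt (measure Leb (space Leb))"
  proof (rule Leb.L2_norm_bounded)
    show "Xc i \<in> borel_measurable Leb" using traj_facts(1)[OF i] by (simp add: square_integrable_def)
    show "\<bar>Xc i t\<bar> \<le> 2 * C" if "t \<in> space Leb" for t
      using traj_bd[OF i, of t] mu_bd[of t] that by auto
  qed (use C in auto)
  thus ?thesis by (simp add: vol_def)
qed

lemma bhat_sq: "square_integrable Leb (bhat J)"
  using traj_facts(4)[of 1] n by simp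

lemma slope_lim_norm: "J \<in> cand D n \<Longrightarrow> L2_norm Leb (\<lambda>t. bhat J t - bs J t) \<le> C * c * vol"
proof -
  assume J: "J \<in> cand D n"
  interpret Leb: finite_measure Leb by (rule finite_measure_Leb)
  show ?thesis
    using Leb.L2_norm_bounded[of "\<lambda>t. bhat J t - bs J t" "C * c"] slope_lim[OF J]
      square_integrable_diff[OF bhat_sq limit_sq[OF J], of J] C rates
    by (simp add: vol_def square_integrable_def)
qed

text \<open>Split \<open>bhat * (Xhat - muhat) - b * (X - mean)\<close> into \<open>(bhat - b) * (Xhat - muhat)\<close> and
  \<open>b * ((Xhat - muhat) - (X - mean))\<close>.  In each product one factor is uniformly of order \<open>c\<close>; the other factor of the
  second product is the limit slope, whose norm is still uncontrolled at this point.\<close>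

lemma Qhat_Qlim:
  assumes i: "i \<in> {1..n}" and J: "J \<in> cand D n"
  shows "\<bar>Qh J i - Ql J i\<bar> \<le> c * plugin_const C * (1 + L2_norm Leb (bs J))"
proof -
  interpret Leb: finite_measure Leb by (rule finite_measure_Leb)
  let ?T = "\<lambda>t. trajhat_trunc D n i J \<omega> t - muhat D n {1..n} \<omega> t"
  let ?X = "\<lambda>t. Xs i J \<omega> t - mean_fun D t"
  let ?c = "C * c"
  note sq = traj_facts(2)[OF i, of J]
  have c0: "0 \<le> C * c" using C rates by simp
  have Xm: "?X \<in> borel_measurable Leb"
    using limit_meas[OF J] mean_measurable by (intro borel_measurable_diff)
  have TX: "(\<lambda>t. ?T t - ?X t) \<in> borel_measurable Leb"
    by (rule borel_measurable_diff[OF square_integrable_measurable[OF sq] Xm])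
  have TX_bd: "\<bar>?T t - ?X t\<bar> \<le> 2 * ?c" if "t \<in> space Leb" for t
    using traj_lim[OF i J, of t] mu_lim[of t] that by auto
  have sqTX: "square_integrable Leb (\<lambda>t. ?T t - ?X t)"
    by (rule Leb.square_integrable_bounded[OF TX TX_bd])
  have sqX: "square_integrable Leb ?X"
    using square_integrable_diff[OF sq sqTX] by simp
  note int = integrable_mult_square_integrable
  have "Qh J i - Ql J i = (icpthat D n {1..n} J \<omega> - as J) + ((\<integral>t. bhat J t * ?T t \<partial>Leb) - (\<integral>t. bs J t * ?X t \<partial>Leb))"
    by (simp add: traj_facts(6)[OF i] Qlim_def set_integral_restrict)
  also have "(\<integral>t. bhat J t * ?T t \<partial>Leb) - (\<integral>t. bs J t * ?X t \<partial>Leb) = (\<integral>t. bhat J t * ?T t - bs J t * ?X t \<partial>Leb)"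
    using int[OF bhat_sq sq] int[OF limit_sq[OF J] sqX] by simp
  also have "\<dots> = (\<integral>t. (bhat J t - bs J t) * ?T t + bs J t * (?T t - ?X t) \<partial>Leb)"
    by (intro Bochner_Integration.integral_cong) (auto simp: algebra_simps)
  also have "\<dots> = (\<integral>t. (bhat J t - bs J t) * ?T t \<partial>Leb) + (\<integral>t. bs J t * (?T t - ?X t) \<partial>Leb)"
    using int[OF square_integrable_diff[OF bhat_sq limit_sq[OF J]] sq] int[OF limit_sq[OF J] sqTX] by simp
  finally have "\<bar>Qh J i - Ql J i\<bar> \<le> \<bar>icpthat D n {1..n} J \<omega> - as J\<bar> +
      (\<bar>\<integral>t. (bhat J t - bs J t) * ?T t \<partial>Leb\<bar> + \<bar>\<integral>t. bs J t * (?T t - ?X t) \<partial>Leb\<bar>)"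
    by linarith
  also have "\<dots> \<le> ?c + (?c * vol * (2 * C * vol) + L2_norm Leb (bs J) * (2 * ?c * vol))"
  proof (intro add_mono icpt_lim J)
    have "\<bar>\<integral>t. (bhat J t - bs J t) * ?T t \<partial>Leb\<bar> \<le> L2_norm Leb (\<lambda>t. bhat J t - bs J t) * L2_norm Leb ?T"
      by (rule Cauchy_Schwarz_integral[OF square_integrable_diff[OF bhat_sq limit_sq[OF J]] sq])
    also have "\<dots> \<le> ?c * vol * (2 * C * vol)"
      using order_trans[OF traj_facts(3)[OF i] Xc_norm[OF i]] c0
      by (intro mult_mono slope_lim_norm J) auto
    finally show "\<bar>\<integral>t. (bhat J t - bs J t) * ?T t \<partial>Leb\<bar> \<le> ?c * vol * (2 * C * vol)" .
    have "\<bar>\<integral>t. bs J t * (?T t - ?X t) \<partial>Leb\<bar> \<le> L2_norm Leb (bs J) * L2_norm Leb (\<lambda>t. ?T t - ?X t)"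
      by (rule Cauchy_Schwarz_integral[OF limit_sq[OF J] sqTX])
    also have "\<dots> \<le> L2_norm Leb (bs J) * (2 * ?c * vol)"
      using Leb.L2_norm_bounded[OF TX TX_bd] c0 by (intro mult_left_mono) (auto simp: vol_def)
    finally show "\<bar>\<integral>t. bs J t * (?T t - ?X t) \<partial>Leb\<bar> \<le> L2_norm Leb (bs J) * (2 * ?c * vol)" .
  qed
  also have "\<dots> \<le> c * plugin_const C * (1 + L2_norm Leb (bs J))"
  proof -
    have "0 \<le> ?c * L2_norm Leb (bs J) + ?c * (vol * (2 * C * vol)) * L2_norm Leb (bs J) + 2 * ?c * vol"
      using C rates by (intro add_nonneg_nonneg mult_nonneg_nonneg) auto
    thus ?thesis by (simp add: plugin_const_def algebra_simps)
  qed
  finally show ?thesis .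
qed

lemma anchor_bound:
  assumes i: "i \<in> {1..n}"
  shows "\<bar>anchor i\<bar> \<le> anchor_const C * d"
proof -
  have sq: "square_integrable Leb (\<lambda>t. bhat Jtrue t - slope D t)"
    by (intro square_integrable_diff bhat_sq slope_square_integrable)
  have "L2_norm Leb (\<lambda>t. bhat Jtrue t - slope D t) \<le> sqrt (C * d\<^sup>2)"
    using slope_rate unfolding L2_norm_def by (intro real_sqrt_le_mono) (simp add: set_integral_restrict)
  hence *: "L2_norm Leb (\<lambda>t. bhat Jtrue t - slope D t) \<le> sqrt C * d"
    using rates by (simp add: real_sqrt_mult)
  have "\<bar>\<integral>t. (bhat Jtrue t - slope D t) * Xc i t \<partial>Leb\<bar> \<le> L2_norm Leb (\<lambda>t. bhat Jtrue t - slope D t) * L2_norm Leb (Xc i)"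
    by (rule Cauchy_Schwarz_integral[OF sq traj_facts(1)[OF i]])
  also have "\<dots> \<le> (sqrt C * d) * (2 * C * vol)"
    using C rates by (intro mult_mono * Xc_norm i) auto
  finally show ?thesis
    using icpt_rate unfolding anchor_def anchor_const_def by (simp add: algebra_simps)
qed

text \<open>Comparing with the estimated true model, rather than with the true coefficients, keeps the unknown inner product of
  the slope with the full fitted trajectory inside \<open>anchor\<close>, where it meets the small factor \<open>bhat Jtrue - slope\<close>.\<close>

lemma fitted_contrast_eq:
  assumes w: "w \<in> weights D n" and i: "i \<in> {1..n}"
  shows "fitted_contrast w i = (\<Sum>J\<in>cand D n. w J * (Qh J i - Qh Jtrue i)) + anchor i"
proof -
  have w1: "(\<Sum>J\<in>cand D n. w J) = 1" using w by (simp add: weights_def)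
  note int = integrable_mult_square_integrable[OF _ traj_facts(1)[OF i]]
  have avg: "square_integrable Leb (\<lambda>t. slopeavg D n w \<omega> t)"
    unfolding slopeavg_def by (intro square_integrable_sum square_integrable_cmult bhat_sq)
  have "(\<integral>t. (slopeavg D n w \<omega> t - slope D t) * Xc i t \<partial>Leb) =
      (\<integral>t. slopeavg D n w \<omega> t * Xc i t \<partial>Leb) - (\<integral>t. slope D t * Xc i t \<partial>Leb)"
    using int[OF avg] int[OF slope_square_integrable] by (simp add: left_diff_distrib)
  also have "(\<integral>t. slopeavg D n w \<omega> t * Xc i t \<partial>Leb) = (\<integral>t. (\<Sum>J\<in>cand D n. w J * (bhat J t * Xc i t)) \<partial>Leb)"
    unfolding slopeavg_def by (simp add: sum_distrib_right mult.assoc)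
  also have "\<dots> = (\<Sum>J\<in>cand D n. w J * (\<integral>t. bhat J t * Xc i t \<partial>Leb))"
    using int[OF bhat_sq] by (simp add: Bochner_Integration.integral_sum)
  also have "\<dots> = (\<Sum>J\<in>cand D n. w J * (Qh J i - icpthat D n {1..n} J \<omega>))"
    by (simp add: traj_facts(5)[OF i])
  also have "\<dots> = (\<Sum>J\<in>cand D n. w J * Qh J i) - icptavg D n w \<omega>"
    by (simp add: icptavg_def right_diff_distrib sum_subtractf)
  finally have 1: "fitted_contrast w i = (\<Sum>J\<in>cand D n. w J * Qh J i) - icpt D - (\<integral>t. slope D t * Xc i t \<partial>Leb)"
    by (simp add: fitted_contrast_def set_integral_restrict)
  have "(\<integral>t. (bhat Jtrue t - slope D t) * Xc i t \<partial>Leb) = (\<integral>t. bhat Jtrue t * Xc i t \<partial>Leb) - (\<integral>t. slope D t * Xc i t \<partial>Leb)"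
    using int[OF bhat_sq] int[OF slope_square_integrable] by (simp add: left_diff_distrib)
  hence 2: "anchor i = Qh Jtrue i - icpt D - (\<integral>t. slope D t * Xc i t \<partial>Leb)"
    by (simp add: anchor_def traj_facts(5)[OF i])
  have "(\<Sum>J\<in>cand D n. w J * (Qh J i - Qh Jtrue i)) = (\<Sum>J\<in>cand D n. w J * Qh J i) - (\<Sum>J\<in>cand D n. w J) * Qh Jtrue i"
    by (simp add: right_diff_distrib sum_subtractf sum_distrib_right)
  thus ?thesis using 1 2 w1 by simp
qed

lemma plugin_const_pos: "0 < plugin_const C"
  unfolding plugin_const_def using C vol_nonneg by (intro mult_pos_pos add_pos_nonneg mult_nonneg_nonneg) auto

text \<open>At the unit weight of \<open>J\<close>, the inequality of \<open>eigen_condition\<close> holds for at least one subject.  It bounds the distance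
  of the slope estimate from the true slope by a difference of two predictions.  By \<open>bias_condition\<close>, the limits of
  these predictions differ by at most \<open>\<rho>\<close>, and the plug-in error contributes, besides constants, at most half of the
  norm in question, which moves to the other side.\<close>

lemma slope_limit_bound:
  assumes J: "J \<in> cand D n"
  shows "L2_norm Leb (bs J) \<le> slope_bound C lmin \<rho>"
proof -
  let ?w = "\<lambda>J'. if J' = J then 1 else (0::real)"
  let ?\<beta> = "L2_norm Leb (slope D)" and ?y = "L2_norm Leb (bs J)" and ?K = "plugin_const C"
  have w: "?w \<in> weights D n" by (rule unit_weight[OF J])
  have pick: "(\<Sum>J'\<in>cand D n. ?w J' * x J') = x J" for x :: "nat \<Rightarrow> real"
    using J cand_finite[of n] by (simp add: if_distrib[where f = "\<lambda>a. a * _"] cong: if_cong)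
  have "0 < \<delta> * real n" using \<delta> n by simp
  hence "0 < card {i \<in> {1..n}. lmin * est_error ?w \<le> (fitted_contrast ?w i)\<^sup>2}"
    using eigen[OF w] unfolding est_error_def fitted_contrast_def by linarith
  then obtain i where i: "i \<in> {1..n}" and le: "lmin * est_error ?w \<le> (fitted_contrast ?w i)\<^sup>2"
    by (auto simp: card_gt_0_iff)
  have "L2_norm Leb (bs Jtrue) = ?\<beta>"
  proof -
    have "AE t in Leb. bs Jtrue t = slope D t"
      using slope_Jtrue by (subst AE_restrict_space_iff) auto
    hence "(\<integral>t. (bs Jtrue t)\<^sup>2 \<partial>Leb) = (\<integral>t. (slope D t)\<^sup>2 \<partial>Leb)"
      using limit_sq[OF Jtrue] slope_square_integrable
      by (intro integral_cong_AE) (auto simp: square_integrable_def)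
    thus ?thesis by (simp add: L2_norm_def)
  qed
  hence "\<bar>Qh Jtrue i - Ql Jtrue i\<bar> \<le> c * ?K * (1 + ?\<beta>)"
    using Qhat_Qlim[OF i Jtrue] by simp
  moreover have "\<bar>Qh J i - Ql J i\<bar> \<le> c * ?K * (1 + ?y)" by (rule Qhat_Qlim[OF i J])
  moreover have "\<bar>Ql J i - Ql Jtrue i\<bar> \<le> \<rho>" using bias[OF i J] Qlim_Jtrue[OF i] by simp
  moreover have "fitted_contrast ?w i = Qh J i - Qh Jtrue i + anchor i"
    unfolding fitted_contrast_eq[OF w i] pick ..
  moreover have "\<bar>anchor i\<bar> \<le> anchor_const C * d" by (rule anchor_bound[OF i])
  moreover have "anchor_const C * d \<le> anchor_const C * 1"
    using C rates by (intro mult_left_mono) (auto simp: anchor_const_def)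
  ultimately have fc: "\<bar>fitted_contrast ?w i\<bar> \<le> \<rho> + anchor_const C + c * ?K * (2 + ?\<beta>) + c * ?K * ?y"
    by (simp add: algebra_simps)
  also have "c * ?K * (2 + ?\<beta>) \<le> ?K * (2 + ?\<beta>)"
    using plugin_const_pos rates mult_right_mono[of c 1 "?K * (2 + ?\<beta>)"] by (simp add: mult.assoc)
  finally have fc: "\<bar>fitted_contrast ?w i\<bar> \<le> \<rho> + anchor_const C + ?K * (2 + ?\<beta>) + c * ?K * ?y" by simp
  have eq: "slopeavg D n ?w \<omega> = bhat J"
    unfolding slopeavg_def[abs_def] pick by simp
  have "lmin * (L2_norm Leb (\<lambda>t. bhat J t - slope D t))\<^sup>2 \<le> lmin * est_error ?w"
    using lmin by (intro mult_left_mono) (auto simp: est_error_def L2_norm_power2 set_integral_restrict eq)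
  also note le
  finally have "sqrt (lmin * (L2_norm Leb (\<lambda>t. bhat J t - slope D t))\<^sup>2) \<le> sqrt ((fitted_contrast ?w i)\<^sup>2)"
    by (rule real_sqrt_le_mono)
  hence "sqrt lmin * L2_norm Leb (\<lambda>t. bhat J t - slope D t) \<le> \<bar>fitted_contrast ?w i\<bar>"
    by (simp add: real_sqrt_mult)
  also note fc
  also have "c * ?K * ?y \<le> sqrt lmin / 2 * ?y"
    using small by (intro mult_right_mono) auto
  finally have dist: "L2_norm Leb (\<lambda>t. bhat J t - slope D t) \<le> (\<rho> + anchor_const C + ?K * (2 + ?\<beta>)) / sqrt lmin + ?y / 2"
    using lmin by (simp add: field_simps)
  have "?y = L2_norm Leb (\<lambda>t. (slope D t + (bhat J t - slope D t)) + (-1) * (bhat J t - bs J t))"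
    by simp
  also have "\<dots> \<le> L2_norm Leb (\<lambda>t. slope D t + (bhat J t - slope D t)) + L2_norm Leb (\<lambda>t. (-1) * (bhat J t - bs J t))"
    by (intro L2_norm_triangle square_integrable_add square_integrable_cmult square_integrable_diff
        bhat_sq slope_square_integrable limit_sq J)
  also have "L2_norm Leb (\<lambda>t. slope D t + (bhat J t - slope D t)) \<le> ?\<beta> + L2_norm Leb (\<lambda>t. bhat J t - slope D t)"
    by (intro L2_norm_triangle square_integrable_diff bhat_sq slope_square_integrable)
  also have "L2_norm Leb (\<lambda>t. (-1) * (bhat J t - bs J t)) = L2_norm Leb (\<lambda>t. bhat J t - bs J t)"
    unfolding L2_norm_cmult by simp
  also have "\<dots> \<le> C * c * vol" by (rule slope_lim_norm[OF J])
  also have "C * c * vol \<le> C * vol"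
    using C rates mult_right_mono[of c 1 "C * vol"] by (simp add: mult_ac)
  finally have "?y \<le> ?\<beta> + L2_norm Leb (\<lambda>t. bhat J t - slope D t) + C * vol" by simp
  moreover have "y \<le> 2 * (b + v + q)" if "x \<le> q + y / 2" "y \<le> b + x + v" for x y b v q :: real
    using that by simp
  ultimately show ?thesis using dist unfolding slope_bound_def by blast
qed

lemma fit_const_nonneg: "0 \<le> fit_const C lmin \<rho>"
proof -
  have "0 \<le> L2_norm Leb (bs Jtrue)" by simp
  also have "\<dots> \<le> slope_bound C lmin \<rho>" by (rule slope_limit_bound[OF Jtrue])
  finally show ?thesis using plugin_const_pos by (simp add: fit_const_def)
qed

lemma Qhat_Qlim_uniform:
  assumes "i \<in> {1..n}" "J \<in> cand D n"
  shows "\<bar>Qh J i - Ql J i\<bar> \<le> fit_const C lmin \<rho> * c"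
proof -
  have "c * plugin_const C * (1 + L2_norm Leb (bs J)) \<le> c * plugin_const C * (1 + slope_bound C lmin \<rho>)"
    using rates plugin_const_pos slope_limit_bound[OF assms(2)] by (intro mult_left_mono) auto
  thus ?thesis using Qhat_Qlim[OF assms] by (simp add: fit_const_def mult_ac)
qed

lemma fitted_contrast_approx:
  assumes w: "w \<in> weights D n" and i: "i \<in> {1..n}"
  shows "\<bar>fitted_contrast w i - contrast w i\<bar> \<le> 2 * fit_const C lmin \<rho> * c + anchor_const C * d"
proof -
  have "(\<Sum>J\<in>cand D n. w J * (Qh J i - Qh Jtrue i)) - contrast w i =
      (\<Sum>J\<in>cand D n. w J * ((Qh J i - Qh Jtrue i) - (Ql J i - Qtrue D i \<omega>)))"
    by (simp add: sum_subtractf right_diff_distrib)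
  also have "\<bar>\<dots>\<bar> \<le> 2 * fit_const C lmin \<rho> * c"
    using Qhat_Qlim_uniform[OF i] Qhat_Qlim_uniform[OF i Jtrue] Qlim_Jtrue[OF i]
    by (intro weighted_average_le[OF w]) fastforce
  finally show ?thesis
    using anchor_bound[OF i] unfolding fitted_contrast_eq[OF w i] by linarith
qed

text \<open>The folds cover the first \<open>nfold D * fold_size D n\<close> subjects, each of them once, so the double sum is a sum over an
  initial segment of the sample.\<close>

lemma cv_approx:
  assumes w: "w \<in> weights D n"
  shows "\<bar>real n * cv_criterion D n \<omega> w -
      (\<Sum>i=1..nfold D * fold_size D n. check_loss (tau D) (resid D i \<omega> - contrast w i))\<bar>
    \<le> real n * (C * g + fit_const C lmin \<rho> * c)"
proof -
  let ?M = "fold_size D n" and ?K = "nfold D"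
  let ?B = "C * g + fit_const C lmin \<rho> * c"
  let ?loss = "\<lambda>i. check_loss (tau D) (resid D i \<omega> - contrast w i)"
  let ?cv = "\<lambda>k m. check_loss (tau D) (resp D ((k - 1) * ?M + m) \<omega> -
       Qavg D n (train_set D n k) w ((k - 1) * ?M + m) \<omega>)"
  have KM: "?K * ?M \<le> n" by (simp add: fold_size_def)
  have pointwise: "\<bar>?cv k m - ?loss ((k - 1) * ?M + m)\<bar> \<le> ?B" if km: "k \<in> {1..?K}" "m \<in> {1..?M}" for k m
  proof -
    let ?i = "(k - 1) * ?M + m"
    have "?i \<le> (k - 1) * ?M + ?M" using km by simp
    also have "\<dots> = k * ?M" using km by (cases k) auto
    also have "\<dots> \<le> ?K * ?M" using km by (intro mult_right_mono) auto
    finally have i: "?i \<in> {1..n}" using KM km by auto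
    have w1: "(\<Sum>J\<in>cand D n. w J) = 1" using w by (simp add: weights_def)
    have "Qavg D n {1..n} w ?i \<omega> - (Qtrue D ?i \<omega> + contrast w ?i) = (\<Sum>J\<in>cand D n. w J * (Qh J ?i - Ql J ?i))"
      using w1 by (simp add: Qavg_def sum_subtractf right_diff_distrib flip: sum_distrib_right)
    also have "\<bar>\<dots>\<bar> \<le> fit_const C lmin \<rho> * c"
      by (intro weighted_average_le[OF w] Qhat_Qlim_uniform i)
    finally have "\<bar>Qavg D n {1..n} w ?i \<omega> - (Qtrue D ?i \<omega> + contrast w ?i)\<bar> \<le> fit_const C lmin \<rho> * c" .
    moreover have "\<bar>Qavg D n {1..n} w ?i \<omega> - Qavg D n (train_set D n k) w ?i \<omega>\<bar> \<le> C * g"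
      by (rule cv_lim[OF w km])
    ultimately have "\<bar>(resp D ?i \<omega> - Qavg D n (train_set D n k) w ?i \<omega>) - (resid D ?i \<omega> - contrast w ?i)\<bar> \<le> ?B"
      unfolding resid_def by linarith
    thus ?thesis by (rule order_trans[OF check_loss_lipschitz[OF tau]])
  qed
  have double_const: "(\<Sum>k=1..K. \<Sum>m=1..M. b) = real (K * M) * b" for K M :: nat and b :: real
    by simp
  have blocks: "(\<Sum>i=1..?K * ?M. ?loss i) = (\<Sum>k=1..?K. \<Sum>m=1..?M. ?loss ((k - 1) * ?M + m))"
    by (rule sum_blocks[symmetric])
  have eq: "real n * cv_criterion D n \<omega> w - (\<Sum>i=1..?K * ?M. ?loss i) =
      (\<Sum>k=1..?K. \<Sum>m=1..?M. ?cv k m - ?loss ((k - 1) * ?M + m))"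
    unfolding blocks cv_criterion_def using n by (simp add: sum_subtractf)
  have "\<bar>\<Sum>k=1..?K. \<Sum>m=1..?M. ?cv k m - ?loss ((k - 1) * ?M + m)\<bar> \<le> (\<Sum>k=1..?K. \<Sum>m=1..?M. ?B)"
    by (intro order_trans[OF sum_abs] sum_mono pointwise)
  also have "\<dots> = real (?K * ?M) * ?B"
    by (rule double_const)
  also have "\<dots> \<le> real n * ?B"
    by (rule mult_right_mono) (use KM C rates fit_const_nonneg in \<open>simp_all only: of_nat_le_iff, simp\<close>)
  finally show ?thesis unfolding eq .
qed

text \<open>Optimality bounds the total excess loss from above and \<open>excess\<close> bounds it from below; together they bound the sum of
  squared contrasts over the folds.  The folds miss fewer than \<open>nfold D\<close> subjects, so for \<open>large\<close> sample sizes at least half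
  of the subjects provided by \<open>eigen\<close> lie in the folds, and each of them contributes \<open>lmin * est_error w\<close> up to terms
  of order \<open>c\<close> and \<open>d\<^sup>2\<close>.\<close>

lemma est_error_le:
  assumes w: "w \<in> weights D n"
    and cv: "cv_criterion D n \<omega> w \<le> cv_criterion D n \<omega> (\<lambda>J. if J = Jtrue then 1 else 0)"
    and Cl: "0 < Cl" and Ce: "0 \<le> Ce" and K: "0 < nfold D" and large: "2 * real (nfold D) \<le> \<delta> * real n"
    and excess: "Cl / 2 * (\<Sum>i=1..nfold D * fold_size D n. (contrast w i)\<^sup>2) -
         Ce * sqrt (real (nfold D * fold_size D n) * real (card (cand D n)))
       \<le> (\<Sum>i=1..nfold D * fold_size D n. check_loss (tau D) (resid D i \<omega> - contrast w i) -
            check_loss (tau D) (resid D i \<omega>))"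
  shows "est_error w \<le> 2 / (\<delta> * lmin) * (8 * C / Cl + 8 * fit_const C lmin \<rho> / Cl + 4 * Ce / Cl +
      16 * (fit_const C lmin \<rho>)\<^sup>2 + 4 * (anchor_const C)\<^sup>2) *
      (d\<^sup>2 + c + g + sqrt (real (card (cand D n))) / sqrt (real n))"
proof -
  let ?u = "\<lambda>J. if J = Jtrue then 1 else (0::real)"
  let ?N = "nfold D * fold_size D n"
  let ?K3 = "fit_const C lmin \<rho>" and ?K2 = "anchor_const C"
  let ?s = "sqrt (real (card (cand D n))) / sqrt (real n)"
  let ?V2 = "\<Sum>i=1..?N. (contrast w i)\<^sup>2"
  have N: "?N \<le> n" by (simp add: fold_size_def)
  \<comment> \<open>the limit fit of the true model makes no error\<close>
  have u: "contrast ?u i = 0" if "i \<in> {1..?N}" for i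
    using Jtrue cand_finite[of n] Qlim_Jtrue[of i] that N
    by (simp add: if_distrib[where f = "\<lambda>a. a * _"] cong: if_cong)
  have "(\<Sum>i=1..?N. check_loss (tau D) (resid D i \<omega> - contrast w i)) \<le>
      (\<Sum>i=1..?N. check_loss (tau D) (resid D i \<omega> - contrast ?u i)) + 2 * (real n * (C * g + ?K3 * c))"
    using cv_approx[OF w] cv_approx[OF unit_weight[OF Jtrue]] mult_left_mono[OF cv, of "real n"] by linarith
  also have "(\<Sum>i=1..?N. check_loss (tau D) (resid D i \<omega> - contrast ?u i)) = (\<Sum>i=1..?N. check_loss (tau D) (resid D i \<omega>))"
    by (intro sum.cong refl) (simp only: u diff_zero)
  finally have "Cl / 2 * ?V2 \<le> Ce * sqrt (real ?N * real (card (cand D n))) + 2 * (real n * (C * g + ?K3 * c))"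
    using excess unfolding sum_subtractf by linarith
  moreover have "sqrt (real ?N * real (card (cand D n))) \<le> real n * ?s"
  proof -
    have "sqrt (real ?N * real (card (cand D n))) \<le> sqrt (real n * real (card (cand D n)))"
      using N by (intro real_sqrt_le_mono mult_right_mono) (auto simp del: of_nat_mult)
    also have "\<dots> = real n * ?s"
      using n by (simp add: real_sqrt_mult field_simps)
    finally show ?thesis .
  qed
  hence "Ce * sqrt (real ?N * real (card (cand D n))) \<le> Ce * (real n * ?s)"
    using Ce by (rule mult_left_mono)
  moreover have "real n * (Ce * ?s + 2 * (C * g + ?K3 * c)) = Ce * (real n * ?s) + 2 * (real n * (C * g + ?K3 * c))"
    by (simp add: algebra_simps)
  ultimately have V2: "Cl / 2 * ?V2 \<le> real n * (Ce * ?s + 2 * (C * g + ?K3 * c))"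
    by linarith
  have V2: "2 * ?V2 \<le> real n * (4 * Ce / Cl * ?s + 8 * C / Cl * g + 8 * ?K3 / Cl * c)"
  proof -
    have "2 * ?V2 = 4 / Cl * (Cl / 2 * ?V2)" using Cl by simp
    also have "\<dots> \<le> 4 / Cl * (real n * (Ce * ?s + 2 * (C * g + ?K3 * c)))"
      using Cl V2 by (intro mult_left_mono) auto
    also have "\<dots> = real n * (4 * Ce / Cl * ?s + 8 * C / Cl * g + 8 * ?K3 / Cl * c)"
      using Cl by (simp add: field_simps)
    finally show ?thesis .
  qed
  define G where "G = {i \<in> {1..n}. lmin * est_error w \<le> (fitted_contrast w i)\<^sup>2}"
  have "\<delta> * real n \<le> real (card G)"
    using eigen[OF w] by (simp add: G_def est_error_def fitted_contrast_def)
  also have "real (card G) \<le> real (card (G \<inter> {1..?N}) + card ({?N + 1..n}))"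
  proof -
    have "G \<subseteq> (G \<inter> {1..?N}) \<union> {?N + 1..n}" by (auto simp: G_def)
    hence "card G \<le> card ((G \<inter> {1..?N}) \<union> {?N + 1..n})" by (intro card_mono) (auto simp: G_def)
    also have "\<dots> \<le> card (G \<inter> {1..?N}) + card {?N + 1..n}" by (rule card_Un_le)
    finally show ?thesis by linarith
  qed
  also have "card {?N + 1..n} \<le> nfold D"
  proof -
    have "n - ?N = n mod nfold D" by (simp add: fold_size_def minus_mult_div_eq_mod)
    thus ?thesis using K mod_less_divisor[of "nfold D" n] by simp
  qed
  finally have "\<delta> * real n \<le> real (card (G \<inter> {1..?N})) + real (nfold D)" by simp
  hence card: "\<delta> * real n / 2 \<le> real (card (G \<inter> {1..?N}))" using large by linarith
  have est0: "0 \<le> est_error w"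
    by (simp add: est_error_def set_integral_restrict)
  have "\<delta> * real n / 2 * (lmin * est_error w) \<le> real (card (G \<inter> {1..?N})) * (lmin * est_error w)"
    using card lmin est0 by (intro mult_right_mono) auto
  also have "\<dots> = (\<Sum>i\<in>G \<inter> {1..?N}. lmin * est_error w)" by simp
  also have "\<dots> \<le> (\<Sum>i\<in>G \<inter> {1..?N}. (fitted_contrast w i)\<^sup>2)"
    by (intro sum_mono) (auto simp: G_def)
  also have "\<dots> \<le> (\<Sum>i=1..?N. (fitted_contrast w i)\<^sup>2)"
    by (intro sum_mono2) auto
  also have "\<dots> \<le> (\<Sum>i=1..?N. 2 * (contrast w i)\<^sup>2 + (16 * ?K3\<^sup>2 * c + 4 * ?K2\<^sup>2 * d\<^sup>2))"
  proof (rule sum_mono)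
    fix i assume "i \<in> {1..?N}"
    hence i: "i \<in> {1..n}" using N by auto
    let ?a = "2 * ?K3 * c + ?K2 * d"
    have "(fitted_contrast w i - contrast w i)\<^sup>2 \<le> ?a\<^sup>2"
      using fitted_contrast_approx[OF w i] by (subst power2_le_iff_abs_le) (use order_trans[OF abs_ge_zero fitted_contrast_approx[OF w i]] in auto)
    moreover have sq: "(x + y)\<^sup>2 \<le> 2 * x\<^sup>2 + 2 * y\<^sup>2" for x y :: real
      using zero_le_power2[of "x - y"] by (simp add: power2_sum power2_diff)
    moreover have "?a\<^sup>2 \<le> 2 * (2 * ?K3 * c)\<^sup>2 + 2 * (?K2 * d)\<^sup>2" by (rule sq)
    moreover have "(2 * ?K3 * c)\<^sup>2 \<le> 4 * ?K3\<^sup>2 * c"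
    proof -
      have "c * c \<le> 1 * c" using rates by (intro mult_right_mono) auto
      hence "4 * ?K3\<^sup>2 * (c * c) \<le> 4 * ?K3\<^sup>2 * (1 * c)" by (rule mult_left_mono) simp
      thus ?thesis by (simp add: power2_eq_square mult_ac)
    qed
    moreover have "(fitted_contrast w i)\<^sup>2 \<le> 2 * (contrast w i)\<^sup>2 + 2 * (fitted_contrast w i - contrast w i)\<^sup>2"
      using sq[of "contrast w i" "fitted_contrast w i - contrast w i"] by simp
    ultimately show "(fitted_contrast w i)\<^sup>2 \<le> 2 * (contrast w i)\<^sup>2 + (16 * ?K3\<^sup>2 * c + 4 * ?K2\<^sup>2 * d\<^sup>2)"
      by (simp add: power_mult_distrib)
  qed
  also have "\<dots> = 2 * ?V2 + real ?N * (16 * ?K3\<^sup>2 * c + 4 * ?K2\<^sup>2 * d\<^sup>2)"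
    by (simp add: sum.distrib sum_distrib_left)
  also have "\<dots> \<le> 2 * ?V2 + real n * (16 * ?K3\<^sup>2 * c + 4 * ?K2\<^sup>2 * d\<^sup>2)"
    using N rates by (intro add_left_mono mult_right_mono) (auto simp del: of_nat_mult)
  also have "\<dots> \<le> real n * (4 * Ce / Cl * ?s + 8 * C / Cl * g + 8 * ?K3 / Cl * c) + real n * (16 * ?K3\<^sup>2 * c + 4 * ?K2\<^sup>2 * d\<^sup>2)"
    using V2 by simp
  also have "\<dots> = real n * (4 * Ce / Cl * ?s + 8 * C / Cl * g + (8 * ?K3 / Cl + 16 * ?K3\<^sup>2) * c + 4 * ?K2\<^sup>2 * d\<^sup>2)"
    by (simp add: algebra_simps)
  also have "\<dots> \<le> real n * ((8 * C / Cl + 8 * ?K3 / Cl + 4 * Ce / Cl + 16 * ?K3\<^sup>2 + 4 * ?K2\<^sup>2) * (d\<^sup>2 + c + g + ?s))"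
  proof (rule mult_left_mono)
    note K3 = fit_const_nonneg
    have coef: "a1 * x1 + a2 * x2 + a3 * x3 + a4 * x4 \<le> (a2 + a3 + a1 + a4) * (x4 + x3 + x2 + x1)"
      if "0 \<le> a1" "0 \<le> a2" "0 \<le> a3" "0 \<le> a4" "0 \<le> x1" "0 \<le> x2" "0 \<le> x3" "0 \<le> x4" for a1 a2 a3 a4 x1 x2 x3 x4 :: real
    proof -
      have "a * x \<le> (a2 + a3 + a1 + a4) * x" if "a \<in> {a1, a2, a3, a4}" "0 \<le> x" for a x
        using that \<open>0 \<le> a1\<close> \<open>0 \<le> a2\<close> \<open>0 \<le> a3\<close> \<open>0 \<le> a4\<close> by (intro mult_right_mono) auto
      from this[of a1 x1] this[of a2 x2] this[of a3 x3] this[of a4 x4] show ?thesis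
        using that(5-8) by (simp add: distrib_left)
    qed
    show "4 * Ce / Cl * ?s + 8 * C / Cl * g + (8 * ?K3 / Cl + 16 * ?K3\<^sup>2) * c + 4 * ?K2\<^sup>2 * d\<^sup>2 \<le>
        (8 * C / Cl + 8 * ?K3 / Cl + 4 * Ce / Cl + 16 * ?K3\<^sup>2 + 4 * ?K2\<^sup>2) * (d\<^sup>2 + c + g + ?s)"
      using coef[of "4 * Ce / Cl" "8 * C / Cl" "8 * ?K3 / Cl + 16 * ?K3\<^sup>2" "4 * ?K2\<^sup>2" ?s g c "d\<^sup>2"]
        C Cl Ce K3 rates by (simp add: add_ac)
  qed simp
  finally have bound: "\<delta> * real n / 2 * (lmin * est_error w) \<le> real n *
      ((8 * C / Cl + 8 * ?K3 / Cl + 4 * Ce / Cl + 16 * ?K3\<^sup>2 + 4 * ?K2\<^sup>2) * (d\<^sup>2 + c + g + ?s))" .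
  have solve: "x \<le> 2 / (\<delta> * lmin) * k * r" if "\<delta> * m / 2 * (lmin * x) \<le> m * (k * r)" "0 < m" for x k r m :: real
  proof -
    have "m * (\<delta> * lmin * x / 2) \<le> m * (k * r)" using that(1) by (simp add: mult_ac)
    hence "\<delta> * lmin * x / 2 \<le> k * r" using that(2) by simp
    thus ?thesis using \<delta> lmin by (simp add: field_simps)
  qed
  show ?thesis by (rule solve[OF bound]) (use n in simp)
qed

end

section \<open>The rate of the averaged estimator\<close>

theorem theorem2:
  fixes D :: "'a flqr"
    and as :: "nat \<Rightarrow> real" and bs :: "nat \<Rightarrow> real \<Rightarrow> real"
    and Xs :: "nat \<Rightarrow> nat \<Rightarrow> 'a \<Rightarrow> real \<Rightarrow> real"
    and qs :: "nat \<Rightarrow> (real \<Rightarrow> real) \<Rightarrow> real"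
    and what :: "nat \<Rightarrow> 'a \<Rightarrow> nat \<Rightarrow> real"
    and c d g :: "nat \<Rightarrow> real" and \<rho> :: real and Jtrue :: nat
  assumes model: "flqr_model D" and estimators: "flqr_estimators D" and folds: "2 \<le> nfold D"
    and what: "\<And>n. AE \<omega> in prb D.
      is_arg_min (cv_criterion D n \<omega>) (\<lambda>w. w \<in> weights D n) (what n \<omega>)"
    and Jtrue: "\<And>n. Jtrue \<in> cand D n" "true_model D Jtrue"
    and d: "d \<longlonglongrightarrow> 0"
    and icpt_rate: "Op (prb D) (\<lambda>n \<omega>. icpthat D n {1..n} Jtrue \<omega> - icpt D) d"
    and slope_rate: "Op (prb D)
      (\<lambda>n \<omega>. LINT t:tdom D|lborel. (slopehat D n {1..n} Jtrue \<omega> t - slope D t)\<^sup>2) (\<lambda>n. (d n)\<^sup>2)"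
    and limits: "limit_condition D as bs Xs c"
    and functional: "functional_condition D as bs Xs qs"
    and bias: "bias_condition D as bs Xs \<rho>"
    and cv: "cv_condition D g"
    and density: "density_condition D \<rho>"
    and bounded: "bounded_condition D"
    and eigen: "eigen_condition D"
    and card_cand: "(\<lambda>n. real (card (cand D n)) / real n) \<longlonglongrightarrow> 0"
  shows "Op (prb D)
    (\<lambda>n \<omega>. (icptavg D n (what n \<omega>) \<omega> - icpt D)\<^sup>2 +
      (LINT t:tdom D|lborel. (slopeavg D n (what n \<omega>) \<omega> t - slope D t)\<^sup>2))
    (\<lambda>n. (d n)\<^sup>2 + c n + g n + sqrt (real (card (cand D n))) / sqrt (real n))"
proof -
  interpret flqr_model D by (rule model)
  interpret est: flqr_estimators D by (rule estimators)
  obtain lmin \<delta> A where lmin: "0 < lmin" and \<delta>: "0 < \<delta>"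
    and A: "\<And>n. A n \<in> events" "(\<lambda>n. prob (A n)) \<longlonglongrightarrow> 0"
    and eigenA: "\<forall>\<^sub>F n in sequentially. \<forall>\<omega>\<in>space (prb D) - A n. \<forall>w\<in>weights D n.
        \<delta> * real n \<le> real (card {i \<in> {1..n}.
          (icptavg D n w \<omega> - icpt D +
            (LINT t:tdom D|lborel. (slopeavg D n w \<omega> t - slope D t) *
               (trajhat D n i \<omega> t - muhat D n {1..n} \<omega> t)))\<^sup>2
          \<ge> lmin * ((icptavg D n w \<omega> - icpt D)\<^sup>2 +
                (LINT t:tdom D|lborel. (slopeavg D n w \<omega> t - slope D t)\<^sup>2))})"
    using eigen unfolding eigen_condition_def by blast
  obtain Cl Cu where Cl: "0 < Cl" and dens_bd: "\<And>i. 1 \<le> i \<Longrightarrow> AE \<omega> in prb D. \<forall>s. \<bar>s\<bar> \<le> \<rho> \<longrightarrow>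
        Cl \<le> dens D s (traj D i \<omega>) \<and> dens D s (traj D i \<omega>) \<le> Cu"
    using density unfolding density_condition_def by blast
  have c0: "c \<longlonglongrightarrow> 0" using limits by (simp add: limit_condition_def)
  have mean: "square_integrable Leb (mean_fun D)"
    using limits bounded by (intro mean_square_integrable[of c]) (auto simp: limit_condition_def bounded_condition_def)
  have bs_sq: "square_integrable Leb (bs J)" if "J \<in> cand D n" for n J
    using limits that unfolding limit_condition_def L2_on_iff[OF tdom_borel] by blast
  have true_as: "as Jtrue = icpt D"
    and true_bs: "AE t in lborel. t \<in> tdom D \<longrightarrow> bs Jtrue t = slope D t"
    and true_Xs: "\<And>i. AE \<omega> in prb D. \<forall>t\<in>tdom D.
           Xs i Jtrue \<omega> t = mean_fun D t + (\<Sum>j=1..Jtrue. score D i j \<omega> * eigfun D j t)"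
    using limits Jtrue unfolding limit_condition_def by blast+
  define regular where "regular n \<omega> \<longleftrightarrow>
      is_arg_min (cv_criterion D n \<omega>) (\<lambda>w. w \<in> weights D n) (what n \<omega>) \<and> fpca_fit D n {1..n} \<omega> \<and>
      (\<forall>i\<in>{1..n}. invertible_mat (Sigmahat D n {1..n} i \<omega>)) \<and>
      (\<forall>i\<in>{1..n}. Qlim D as bs Xs Jtrue i \<omega> = Qtrue D i \<omega>) \<and>
      (\<forall>i\<in>{0..n}. \<forall>J\<in>cand D n. \<bar>Qlim D as bs Xs J i \<omega> - Qtrue D i \<omega>\<bar> \<le> \<rho>)" for n \<omega>
  have regular: "AE \<omega> in prb D. regular n \<omega>" for n
  proof -
    have S: "{1..n} \<in> fit_sets D n" by (simp add: fit_sets_def)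
    have "AE \<omega> in prb D. \<forall>i\<in>{1..n}. Qlim D as bs Xs Jtrue i \<omega> = Qtrue D i \<omega>"
    proof (rule AE_finite_allI)
      fix i
      show "AE \<omega> in prb D. Qlim D as bs Xs Jtrue i \<omega> = Qtrue D i \<omega>"
        using true_Xs[of i] AE_space
        by eventually_elim
           (rule Qlim_true_model[where as = as and bs = bs and Xs = Xs, OF mean _ Jtrue(2) true_as true_bs bs_sq[OF Jtrue(1)]], auto)
    qed simp
    moreover have "AE \<omega> in prb D. \<forall>i\<in>{1..n}. invertible_mat (Sigmahat D n {1..n} i \<omega>)"
      by (intro AE_finite_allI est.Sigmahat_invertible S) auto
    moreover have "AE \<omega> in prb D. \<forall>i\<in>{0..n}. \<forall>J\<in>cand D n. \<bar>Qlim D as bs Xs J i \<omega> - Qtrue D i \<omega>\<bar> \<le> \<rho>"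
      using bias by (simp add: bias_condition_def)
    ultimately show ?thesis
      using what[of n] est.fpca[OF S] unfolding regular_def by eventually_elim blast
  qed
  show ?thesis
    unfolding Op_def Op_unif_def
  proof (intro allI impI)
    fix e :: real assume "0 < e"
    \<comment> \<open>eleven exceptional events: nine stochastic orders, the excess loss bound and \<open>eigen_condition\<close>\<close>
    define \<eta> where "\<eta> = e / 11"
    have \<eta>: "0 < \<eta>" using \<open>0 < e\<close> by (simp add: \<eta>_def)
    define ok where "ok C n \<omega> \<longleftrightarrow>
        (\<forall>J\<in>cand D n. \<bar>icpthat D n {1..n} J \<omega> - as J\<bar> \<le> C * c n) \<and>
        (\<forall>(t, J)\<in>tdom D \<times> cand D n. \<bar>slopehat D n {1..n} J \<omega> t - bs J t\<bar> \<le> C * c n) \<and>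
        (\<forall>t\<in>tdom D. \<bar>muhat D n {1..n} \<omega> t - mean_fun D t\<bar> \<le> C * c n) \<and>
        (\<forall>(t, J, i)\<in>tdom D \<times> cand D n \<times> {1..n}. \<bar>trajhat_trunc D n i J \<omega> t - Xs i J \<omega> t\<bar> \<le> C * c n) \<and>
        (\<forall>(w, k, m)\<in>weights D n \<times> {1..nfold D} \<times> {1..fold_size D n}.
           \<bar>Qavg D n {1..n} w ((k - 1) * fold_size D n + m) \<omega> -
            Qavg D n (train_set D n k) w ((k - 1) * fold_size D n + m) \<omega>\<bar> \<le> C * g n) \<and>
        (\<forall>(i, t)\<in>{1..n} \<times> tdom D. \<bar>trajhat D n i \<omega> t\<bar> \<le> C * 1) \<and>
        (\<forall>t\<in>tdom D. \<bar>muhat D n {1..n} \<omega> t\<bar> \<le> C * 1) \<and>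
        \<bar>icpthat D n {1..n} Jtrue \<omega> - icpt D\<bar> \<le> C * d n \<and>
        \<bar>LINT t:tdom D|lborel. (slopehat D n {1..n} Jtrue \<omega> t - slope D t)\<^sup>2\<bar> \<le> C * (d n)\<^sup>2" for C n \<omega>
    have "\<forall>\<^sub>F C in at_top. \<forall>\<^sub>F n in sequentially. likely (prb D) (9 * \<eta>) (ok C n)"
    proof -
      have "Op_unif (prb D) (cand D) (\<lambda>n J \<omega>. icpthat D n {1..n} J \<omega> - as J) c"
        "Op_unif (prb D) (\<lambda>n. tdom D \<times> cand D n) (\<lambda>n (t, J) \<omega>. slopehat D n {1..n} J \<omega> t - bs J t) c"
        "Op_unif (prb D) (\<lambda>n. tdom D) (\<lambda>n t \<omega>. muhat D n {1..n} \<omega> t - mean_fun D t) c"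
        "Op_unif (prb D) (\<lambda>n. tdom D \<times> cand D n \<times> {1..n}) (\<lambda>n (t, J, i) \<omega>. trajhat_trunc D n i J \<omega> t - Xs i J \<omega> t) c"
        using limits unfolding limit_condition_def by blast+
      note this(1)[THEN Op_unif_likely, OF \<eta>] this(2)[THEN Op_unif_likely, OF \<eta>]
        this(3)[THEN Op_unif_likely, OF \<eta>] this(4)[THEN Op_unif_likely, OF \<eta>]
        cv[unfolded cv_condition_def, THEN conjunct2, THEN Op_unif_likely, OF \<eta>]
        bounded[unfolded bounded_condition_def, THEN conjunct1, THEN Op_unif_likely, OF \<eta>]
        bounded[unfolded bounded_condition_def, THEN conjunct2, THEN Op_unif_likely, OF \<eta>]
        icpt_rate[unfolded Op_def, THEN Op_unif_likely, OF \<eta>]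
        slope_rate[unfolded Op_def, THEN Op_unif_likely, OF \<eta>]
      thus ?thesis
      proof eventually_elim
        case (elim C)
        thus ?case
        proof eventually_elim
          case (elim n)
          show ?case
            by (rule likely_mono[OF likely_conj[OF elim(1) likely_conj[OF elim(2) likely_conj[OF elim(3)
                likely_conj[OF elim(4) likely_conj[OF elim(5) likely_conj[OF elim(6) likely_conj[OF elim(7)
                likely_conj[OF elim(8) elim(9)]]]]]]]]])
               (auto simp: ok_def split_def)
        qed
      qed
    qed
    then obtain C where C: "0 < C" and ok: "\<forall>\<^sub>F n in sequentially. likely (prb D) (9 * \<eta>) (ok C n)"
      using eventually_happens'[OF trivial_limit_at_top_linorder eventually_conj[OF _ eventually_gt_at_top[of 0]]] by blast
    obtain Ce where Ce: "0 < Ce" and excess: "\<forall>n. \<forall>S\<subseteq>{1..n}. S \<noteq> {} \<longrightarrow> cand D n \<noteq> {} \<longrightarrow>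
      likely (prb D) \<eta> (\<lambda>\<omega>. \<forall>w\<in>weights D n.
       Cl / 2 * (\<Sum>i\<in>S. (\<Sum>J\<in>cand D n. w J * (Qlim D as bs Xs J i \<omega> - Qtrue D i \<omega>))\<^sup>2) -
         Ce * sqrt (real (card S) * real (card (cand D n)))
       \<le> (\<Sum>i\<in>S. check_loss (tau D) (resid D i \<omega> -
              (\<Sum>J\<in>cand D n. w J * (Qlim D as bs Xs J i \<omega> - Qtrue D i \<omega>))) -
            check_loss (tau D) (resid D i \<omega>)))"
      using excess_loss_lower_bound[OF functional bias dens_bd Cl \<eta>] by blast
    define K where "K = 2 / (\<delta> * lmin) * (8 * C / Cl + 8 * fit_const C lmin \<rho> / Cl + 4 * Ce / Cl +
      16 * (fit_const C lmin \<rho>)\<^sup>2 + 4 * (anchor_const C)\<^sup>2)"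
    show "\<exists>C>0. \<forall>\<^sub>F n in sequentially. \<exists>A\<in>events. prob A \<le> e \<and> (\<forall>\<omega>\<in>space (prb D) - A. \<forall>i\<in>{()}.
        \<bar>(icptavg D n (what n \<omega>) \<omega> - icpt D)\<^sup>2 +
          (LINT t:tdom D|lborel. (slopeavg D n (what n \<omega>) \<omega> t - slope D t)\<^sup>2)\<bar>
        \<le> C * ((d n)\<^sup>2 + c n + g n + sqrt (real (card (cand D n))) / sqrt (real n)))"
    proof (intro exI[of _ "\<bar>K\<bar> + 1"] conjI)
      have "\<forall>\<^sub>F n in sequentially. c n < 1" using c0 by (rule order_tendstoD) simp
      moreover have "\<forall>\<^sub>F n in sequentially. d n < 1" using d by (rule order_tendstoD) simp
      moreover have "\<forall>\<^sub>F n in sequentially. c n * plugin_const C < sqrt lmin / 2"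
        using tendsto_mult[OF c0 tendsto_const[of "plugin_const C"]] by (rule order_tendstoD) (use lmin in simp)
      moreover have "\<forall>\<^sub>F n in sequentially. prob (A n) < \<eta>" using A(2) by (rule order_tendstoD) (rule \<eta>)
      moreover have "\<forall>\<^sub>F n in sequentially. nfold D \<le> n" by (rule eventually_ge_at_top)
      moreover have "\<forall>\<^sub>F n in sequentially. 2 * real (nfold D) / \<delta> \<le> real n"
        by (rule filterlim_real_sequentially[unfolded filterlim_at_top, rule_format])
      ultimately show "\<forall>\<^sub>F n in sequentially. \<exists>A\<in>events. prob A \<le> e \<and> (\<forall>\<omega>\<in>space (prb D) - A. \<forall>i\<in>{()}.
          \<bar>(icptavg D n (what n \<omega>) \<omega> - icpt D)\<^sup>2 +
            (LINT t:tdom D|lborel. (slopeavg D n (what n \<omega>) \<omega> t - slope D t)\<^sup>2)\<bar>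
          \<le> (\<bar>K\<bar> + 1) * ((d n)\<^sup>2 + c n + g n + sqrt (real (card (cand D n))) / sqrt (real n)))"
        using ok eigenA
      proof eventually_elim
        case (elim n)
        have n: "0 < n" and large: "2 * real (nfold D) \<le> \<delta> * real n"
          using elim(5,6) folds \<delta> by (auto simp: field_simps)
        have fs: "1 \<le> fold_size D n"
          using elim(5) folds by (simp add: fold_size_def div_greater_zero_iff Suc_le_eq One_nat_def)
        let ?S = "{1..nfold D * fold_size D n}"
        have S: "?S \<subseteq> {1..n}" "?S \<noteq> {}" using fs folds by (auto simp: fold_size_def intro: order_trans)
        define low where "low \<omega> \<longleftrightarrow> (\<forall>w\<in>weights D n.
          Cl / 2 * (\<Sum>i\<in>?S. (\<Sum>J\<in>cand D n. w J * (Qlim D as bs Xs J i \<omega> - Qtrue D i \<omega>))\<^sup>2) -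
           Ce * sqrt (real (card ?S) * real (card (cand D n)))
          \<le> (\<Sum>i\<in>?S. check_loss (tau D) (resid D i \<omega> -
              (\<Sum>J\<in>cand D n. w J * (Qlim D as bs Xs J i \<omega> - Qtrue D i \<omega>))) -
            check_loss (tau D) (resid D i \<omega>)))" for \<omega>
        have "likely (prb D) \<eta> low"
          using excess[rule_format, OF S] Jtrue(1)[of n] unfolding low_def by blast
        moreover have "likely (prb D) \<eta> (\<lambda>\<omega>. \<omega> \<notin> A n)"
          unfolding likely_def using A(1) elim(4) by (intro bexI[of _ "A n"]) auto
        ultimately have "likely (prb D) (9 * \<eta> + (\<eta> + (\<eta> + 0)))
            (\<lambda>\<omega>. ok C n \<omega> \<and> low \<omega> \<and> \<omega> \<notin> A n \<and> regular n \<omega>)"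
          by (intro likely_conj elim(7) likely_AE regular)
        hence "likely (prb D) e (\<lambda>\<omega>. \<forall>i\<in>{()}.
          \<bar>(icptavg D n (what n \<omega>) \<omega> - icpt D)\<^sup>2 +
            (LINT t:tdom D|lborel. (slopeavg D n (what n \<omega>) \<omega> t - slope D t)\<^sup>2)\<bar>
          \<le> (\<bar>K\<bar> + 1) * ((d n)\<^sup>2 + c n + g n + sqrt (real (card (cand D n))) / sqrt (real n)))"
        proof (rule likely_mono)
          fix \<omega> assume \<omega>: "\<omega> \<in> space (prb D)" and good: "ok C n \<omega> \<and> low \<omega> \<and> \<omega> \<notin> A n \<and> regular n \<omega>"
          note okC = good[THEN conjunct1, unfolded ok_def]
          note reg = good[THEN conjunct2, THEN conjunct2, THEN conjunct2, unfolded regular_def]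
          \<comment> \<open>a bound of an absolute value forces the rate to be nonnegative; for \<open>g\<close> this takes a nonempty fold\<close>
          have rates: "0 \<le> c n" "0 \<le> d n" "0 \<le> g n"
          proof -
            have pos: "0 \<le> r" if "\<bar>z\<bar> \<le> C * r" for z r :: real
              using order_trans[OF abs_ge_zero that] C by (simp add: zero_le_mult_iff)
            show "0 \<le> c n" using okC Jtrue(1)[of n] by (blast intro: pos)
            show "0 \<le> d n" using okC by (blast intro: pos)
            have "(\<lambda>J. if J = Jtrue then 1 else 0, 1, 1) \<in> weights D n \<times> {1..nfold D} \<times> {1..fold_size D n}"
              using unit_weight[OF Jtrue(1)] fs folds by auto
            with okC show "0 \<le> g n" by (blast intro: pos)
          qed
          interpret good: good_sample D as bs Xs \<omega> n Jtrue C "c n" "d n" "g n" \<rho> lmin \<delta>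
          proof unfold_locales
            show "Xs i J \<omega> \<in> borel_measurable Leb" if "J \<in> cand D n" for i J
              using limits that \<omega> unfolding limit_condition_def by (blast intro: measurable_section)
            show "\<delta> * real n \<le> real (card {i \<in> {1..n}.
              (icptavg D n w \<omega> - icpt D +
                (LINT t:tdom D|lborel. (slopeavg D n w \<omega> t - slope D t) *
                   (trajhat D n i \<omega> t - muhat D n {1..n} \<omega> t)))\<^sup>2
              \<ge> lmin * ((icptavg D n w \<omega> - icpt D)\<^sup>2 +
                (LINT t:tdom D|lborel. (slopeavg D n w \<omega> t - slope D t)\<^sup>2))})" if "w \<in> weights D n" for w
              using elim(8) \<omega> good that by blast
            show "\<bar>Qavg D n {1..n} w ((k - 1) * fold_size D n + m) \<omega> -
                Qavg D n (train_set D n k) w ((k - 1) * fold_size D n + m) \<omega>\<bar> \<le> C * g n"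
              if "w \<in> weights D n" "k \<in> {1..nfold D}" "m \<in> {1..fold_size D n}" for w k m
              using okC that by blast
            show "(LINT t:tdom D|lborel. (slopehat D n {1..n} Jtrue \<omega> t - slope D t)\<^sup>2) \<le> C * (d n)\<^sup>2"
              using okC by linarith
            show "\<bar>icpthat D n {1..n} Jtrue \<omega> - icpt D\<bar> \<le> C * d n" using okC by blast
            show "\<bar>muhat D n {1..n} \<omega> t\<bar> \<le> C" if "t \<in> tdom D" for t using okC that by simp
            show "\<bar>trajhat D n i \<omega> t\<bar> \<le> C" if "i \<in> {1..n}" "t \<in> tdom D" for i t using okC that by auto
            show "\<bar>trajhat_trunc D n i J \<omega> t - Xs i J \<omega> t\<bar> \<le> C * c n" if "i \<in> {1..n}" "J \<in> cand D n" "t \<in> tdom D" for i J t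
              using okC that by blast
            show "\<bar>slopehat D n {1..n} J \<omega> t - bs J t\<bar> \<le> C * c n" if "J \<in> cand D n" "t \<in> tdom D" for J t
              using okC that by blast
          qed (use \<omega> n C rates elim(1-3) lmin \<delta> Jtrue bs_sq true_bs reg okC in auto)
          have wh: "what n \<omega> \<in> weights D n"
            and opt: "\<not> cv_criterion D n \<omega> (\<lambda>J. if J = Jtrue then 1 else 0) < cv_criterion D n \<omega> (what n \<omega>)"
            using reg unit_weight[OF Jtrue(1), of n] unfolding is_arg_min_def by blast+
          have "good.est_error (what n \<omega>) \<le> K * ((d n)\<^sup>2 + c n + g n + sqrt (real (card (cand D n))) / sqrt (real n))"
            unfolding K_def
          proof (rule good.est_error_le[OF wh _ Cl _ _ large])
            show "cv_criterion D n \<omega> (what n \<omega>) \<le> cv_criterion D n \<omega> (\<lambda>J. if J = Jtrue then 1 else 0)"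
              using opt by simp
            show "Cl / 2 * (\<Sum>i=1..nfold D * fold_size D n. (good.contrast (what n \<omega>) i)\<^sup>2) -
                Ce * sqrt (real (nfold D * fold_size D n) * real (card (cand D n)))
              \<le> (\<Sum>i=1..nfold D * fold_size D n. check_loss (tau D) (resid D i \<omega> - good.contrast (what n \<omega>) i) -
                  check_loss (tau D) (resid D i \<omega>))"
              using good wh unfolding low_def by simp
          qed (use Ce folds in auto)
          also have "\<dots> \<le> (\<bar>K\<bar> + 1) * ((d n)\<^sup>2 + c n + g n + sqrt (real (card (cand D n))) / sqrt (real n))"
            using rates by (intro mult_right_mono add_nonneg_nonneg) auto
          finally show "\<forall>i\<in>{()}.
            \<bar>(icptavg D n (what n \<omega>) \<omega> - icpt D)\<^sup>2 +
              (LINT t:tdom D|lborel. (slopeavg D n (what n \<omega>) \<omega> t - slope D t)\<^sup>2)\<bar>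
            \<le> (\<bar>K\<bar> + 1) * ((d n)\<^sup>2 + c n + g n + sqrt (real (card (cand D n))) / sqrt (real n))"
            by (simp add: good.est_error_def set_integral_restrict)
        qed (simp add: \<eta>_def)
        thus ?case unfolding likely_def .
      qed
    qed simp
  qed
qed

end
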